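(* Let $q\ge 2$ and $c\ge 1$ be fixed integers. There exist an integer $n_0=n_0(q,c)$ and a constant $K=K(q,c)$ such that for every $n\ge n_0$, $$MB(n,q,c)\le Kn,\qquad MC(n,q,c)\le Kn,\qquad PB(n,q,c)\le Kn,\qquad PC(n,q,c)\le Kn.$$ That is, for all $n\ge n_0$ each of these four search problems can be solved by an adaptive algorithm using at most $Kn$ queries of size exactly $q$ in the worst case.
   Context: Setting. We are given a set $X$ of $n$ distinguishable balls. Each ball has one color from a set of $c$ colors; the coloring is unknown and arbitrary (not every color needs to be used), while $X$ and $c$ are known. Definitions. Let $Y$ be a finite set of colored balls and $x\in Y$. - $x$ is a majority ball in $Y$ if more than $|Y|/2$ balls of $Y$ have the color of $x$. - $x$ is a non-minority ball in $Y$ if at least $|Y|/2$ balls of $Y$ have the color of $x$. - $x$ is a plurality ball in $Y$ if there are more balls of the color of $x$ in $Y$ than of any other color. - $x$ is an almost plurality ball in $Y$ if it is a plurality ball in $Y$ or a non-minority ball in $Y$. (The color of $x$ is counted including $x$ itself.) Queries. A query is a subset $Q\subseteq X$ with $|Q|=q$. - Majority query $Q$: the answer is NO if there is no majority ball in $Q$; otherwise the answer is YES together with some majority ball of $Q$. - Plurality query $Q$: the answer is NO if there is no plurality ball in $Q$; otherwise the answer is YES together with some plurality ball of $Q$. If several balls of $Q$ are valid answers, the answerer may present any one of them (the choice is adversarial). No other information about the colors is revealed. Algorithms. An algorithm asks queries adaptively: each query may depend on the previous answers. It must succeed for every coloring of $X$ and every valid choice of answers. At the end, based only on the queries and answers,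 it must either output a ball of $X$ that is of the required type in $X$ for every coloring consistent with the answers, or state that $X$ contains no ball of the required type, where this statement is true for every coloring consistent with the answers. Functions. Each of the following is the minimum, over all such algorithms, of the worst-case number of queries of size $q$ asked, for $n=|X|$ balls and $c$ colors (the value is $\infty$ if no algorithm exists, which may happen for small $n$). - $MB(n,q,c)$: majority queries are used; the required type is a non-minority ball in $X$. - $MC(n,q,c)$: majority queries are used; the required type is an almost plurality ball in $X$. - $PB(n,q,c)$: plurality queries are used; the required type is a non-minority ball in $X$. - $PC(n,q,c)$: plurality queries are used; the required type is an almost plurality ball in $X$. *)

theory Defs
  imports Main "HOL-Library.Extended_Nat"
begin

text \<open>
  The balls are the numbers below \<open>n\<close>, the colors are the numbers below \<open>c\<close>. A coloring is
  a function on all of \<open>nat\<close>; its values outside the ball set are irrelevant.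
\<close>

definition colorings :: "nat \<Rightarrow> nat \<Rightarrow> (nat \<Rightarrow> nat) set" where
  "colorings n c = {f. \<forall>x<n. f x < c}"

definition color_count :: "(nat \<Rightarrow> nat) \<Rightarrow> nat set \<Rightarrow> nat \<Rightarrow> nat" where
  "color_count f Y d = card {y \<in> Y. f y = d}"

definition majority_ball :: "(nat \<Rightarrow> nat) \<Rightarrow> nat set \<Rightarrow> nat \<Rightarrow> bool" where
  "majority_ball f Y x \<longleftrightarrow> x \<in> Y \<and> 2 * color_count f Y (f x) > card Y"

definition non_minority_ball :: "(nat \<Rightarrow> nat) \<Rightarrow> nat set \<Rightarrow> nat \<Rightarrow> bool" where
  "non_minority_ball f Y x \<longleftrightarrow> x \<in> Y \<and> 2 * color_count f Y (f x) \<ge> card Y"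

definition plurality_ball :: "(nat \<Rightarrow> nat) \<Rightarrow> nat set \<Rightarrow> nat \<Rightarrow> bool" where
  "plurality_ball f Y x \<longleftrightarrow>
     x \<in> Y \<and> (\<forall>d. d \<noteq> f x \<longrightarrow> color_count f Y d < color_count f Y (f x))"

definition almost_plurality_ball :: "(nat \<Rightarrow> nat) \<Rightarrow> nat set \<Rightarrow> nat \<Rightarrow> bool" where
  "almost_plurality_ball f Y x \<longleftrightarrow> plurality_ball f Y x \<or> non_minority_ball f Y x"

text \<open>
  Below, \<open>A\<close> is the notion of ball the queries ask for and \<open>P\<close> the notion of ball sought in
  the whole set. For queries as well as for the final output, \<open>Some x\<close> names a ball and
  \<open>None\<close> says that there is no ball of the kind in question. This relation lists all
  correct reports on \<open>Y\<close>; the answerer may choose any of them.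
\<close>

type_synonym ball_notion = "(nat \<Rightarrow> nat) \<Rightarrow> nat set \<Rightarrow> nat \<Rightarrow> bool"

fun correct_report :: "ball_notion \<Rightarrow> (nat \<Rightarrow> nat) \<Rightarrow> nat set \<Rightarrow> nat option \<Rightarrow> bool" where
  "correct_report A f Y None \<longleftrightarrow> (\<forall>x\<in>Y. \<not> A f Y x)"
| "correct_report A f Y (Some x) \<longleftrightarrow> x \<in> Y \<and> A f Y x"

text \<open>
  An adaptive algorithm is a decision tree that branches over the possible answers. Since
  trees are well-founded, every run terminates. Branches for impossible answers exist, but
  play no role.
\<close>

datatype algorithm =
  Output "nat option"
| Query "nat set" "nat option \<Rightarrow> algorithm"

type_synonym transcript = "(nat set \<times> nat option) list"

inductive run :: "ball_notion \<Rightarrow> (nat \<Rightarrow> nat) \<Rightarrow> algorithm \<Rightarrow> transcript \<Rightarrow> nat option \<Rightarrow> bool"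
  for A f where
  run_Output: "run A f (Output r) [] r"
| run_Query: "correct_report A f Q a \<Longrightarrow> run A f (T a) h r \<Longrightarrow> run A f (Query Q T) ((Q, a) # h) r"

definition consistent :: "ball_notion \<Rightarrow> (nat \<Rightarrow> nat) \<Rightarrow> transcript \<Rightarrow> bool" where
  "consistent A g h \<longleftrightarrow> (\<forall>(Q, a)\<in>set h. correct_report A g Q a)"

definition solves ::
  "ball_notion \<Rightarrow> ball_notion \<Rightarrow> nat \<Rightarrow> nat \<Rightarrow> nat \<Rightarrow> algorithm \<Rightarrow> bool" where
  "solves A P n q c T \<longleftrightarrow>
     (\<forall>f\<in>colorings n c. \<forall>h r. run A f T h r \<longrightarrow>
        (\<forall>(Q, a)\<in>set h. Q \<subseteq> {..<n} \<and> card Q = q) \<and>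
        (\<forall>g\<in>colorings n c. consistent A g h \<longrightarrow> correct_report P g {..<n} r))"

definition worst_case_queries :: "ball_notion \<Rightarrow> nat \<Rightarrow> nat \<Rightarrow> algorithm \<Rightarrow> enat" where
  "worst_case_queries A n c T =
     Sup {enat (length h) | h. \<exists>f\<in>colorings n c. \<exists>r. run A f T h r}"

text \<open>The infimum of the empty set in \<open>enat\<close> is \<open>\<infinity>\<close>.\<close>

definition min_queries :: "ball_notion \<Rightarrow> ball_notion \<Rightarrow> nat \<Rightarrow> nat \<Rightarrow> nat \<Rightarrow> enat" where
  "min_queries A P n q c = Inf {worst_case_queries A n c T | T. solves A P n q c T}"

definition MB :: "nat \<Rightarrow> nat \<Rightarrow> nat \<Rightarrow> enat" where
  "MB = min_queries majority_ball non_minority_ball"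

definition MC :: "nat \<Rightarrow> nat \<Rightarrow> nat \<Rightarrow> enat" where
  "MC = min_queries majority_ball almost_plurality_ball"

definition PB :: "nat \<Rightarrow> nat \<Rightarrow> nat \<Rightarrow> enat" where
  "PB = min_queries plurality_ball non_minority_ball"

definition PC :: "nat \<Rightarrow> nat \<Rightarrow> nat \<Rightarrow> enat" where
  "PC = min_queries plurality_ball almost_plurality_ball"

end

theory Submission
  imports Defs
begin

text \<open>
  A query answered by NO contains at least three colors or a tie. Once one such query is known, balls of
  different colors can be told apart by whether queries through a bounded sample get an answer at all, so
  linearly many queries reveal every large color class.

  Otherwise every answer is a plurality ball. Replacing a ball of a set \<open>W\<close> of \<open>q - 1\<close> balls by each new
  ball \<open>x\<close>, where the ball leaving is the answer to \<open>W \<union> {x}\<close>, ends with \<open>W\<close> such that the remaining balls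
  have one color, or \<open>q = 2 * k + 1\<close>, only two colors occur, and \<open>W\<close> has \<open>k\<close> balls of each. In the second
  case, for each way of splitting \<open>W\<close> into its two colors, queries that drop one ball of \<open>W\<close> and add two
  others compare these two, and linear-time selection finds a median. Hence boundedly many families cover
  all colorings still possible, and the members of each family share more than half of the balls as
  majority balls. If no ball is common to all families, a minimal subfamily without common ball has
  at least three members, each with a ball missed by no other member; adding three such balls to \<open>W\<close> minus two
  balls gives a query whose answer enlarges the common part of some family.
\<close>

text \<open>An unanswered query is a threshold: inside the sample it can be rearranged into two
  queries that differ in one ball and of which exactly one is answered, which separates two colors
  without naming either. If every query is answered, there is no such threshold. With two colors and
  a balanced \<open>W\<close>, an answer only relates the majority memberships of balls to each
  other: for a given split of \<open>W\<close>, either \<open>x\<close> and \<open>y\<close> are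
  ordered or they are merely known to be opposite. Opposite pairs fit into no order; they are what
  selection has to cope with, and a potential that counts undetermined balls pays for them. The
  split itself need not ever be learned, hence one median for each possible split and a final game
  between the families. For odd \<open>q\<close> the number of balls has to be odd, so that two
  colors cannot tie. This is where the target of a non-minority ball matters: for even
  \<open>n\<close> one ball is set aside, and a majority color of the others still has at least half
  of all balls.\<close>

section \<open>Winning positions and decision trees\<close>

text \<open>\<open>win A X q G k S\<close>: if \<open>S\<close> is the set of colorings still possible, then \<open>k\<close> further queries suffice to
  reach a set satisfying \<open>G\<close>.\<close>
inductive win ::
  "ball_notion \<Rightarrow> nat set \<Rightarrow> nat \<Rightarrow> ((nat \<Rightarrow> nat) set \<Rightarrow> bool) \<Rightarrow> nat \<Rightarrow> (nat \<Rightarrow> nat) set \<Rightarrow> bool"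
  for A X q G where
  win_goal: "G S \<Longrightarrow> win A X q G k S"
| win_query: "Q \<subseteq> X \<Longrightarrow> card Q = q \<Longrightarrow> (\<And>a. win A X q G k {g \<in> S. correct_report A g Q a})
    \<Longrightarrow> win A X q G (Suc k) S"

lemma win_mono: "win A X q G k S \<Longrightarrow> k \<le> k' \<Longrightarrow> win A X q G k' S"
proof (induction arbitrary: k' rule: win.induct)
  case (win_goal S k)
  then show ?case by (blast intro: win.win_goal)
next
  case (win_query Q k S)
  then obtain j where "k' = Suc j" "k \<le> j" by (cases k') auto
  show ?case unfolding \<open>k' = Suc j\<close>
    by (rule win.win_query[OF win_query(1,2) win_query(4)[OF \<open>k \<le> j\<close>]])
qed

text \<open>A derivation of \<open>win\<close> is a decision tree in disguise: goals become
  \<open>Output\<close> nodes, and filtering \<open>S\<close> by an answer is consistency with one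
  more entry of the transcript. \<open>G\<close> has to provide one report correct for all of
  \<open>S\<close>, since the output depends on the transcript only.\<close>

lemma win_imp_algorithm:
  assumes "win A {..<n} q G k S"
    and "\<And>S. G S \<Longrightarrow> \<exists>r. \<forall>g\<in>S. correct_report P g {..<n} r"
  shows "\<exists>T. \<forall>f\<in>S. \<forall>h r. run A f T h r \<longrightarrow> length h \<le> k \<and>
     (\<forall>(Q, a)\<in>set h. Q \<subseteq> {..<n} \<and> card Q = q) \<and>
     (\<forall>g\<in>S. consistent A g h \<longrightarrow> correct_report P g {..<n} r)"
  using assms(1)
proof (induction rule: win.induct)
  case (win_goal S k)
  then obtain r where r: "\<forall>g\<in>S. correct_report P g {..<n} r" using assms(2) by blast
  show ?case
  proof (intro exI[of _ "Output r"] ballI allI impI)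
    fix f h r' assume "f \<in> S" "run A f (Output r) h r'"
    then have "h = []" "r' = r" by (auto elim: run.cases)
    then show "length h \<le> k \<and> (\<forall>(Q, a)\<in>set h. Q \<subseteq> {..<n} \<and> card Q = q) \<and>
     (\<forall>g\<in>S. consistent A g h \<longrightarrow> correct_report P g {..<n} r')" using r by simp
  qed
next
  case (win_query Q k S)
  let ?ok = "\<lambda>a T. \<forall>f\<in>{g \<in> S. correct_report A g Q a}. \<forall>h r. run A f T h r \<longrightarrow> length h \<le> k \<and>
     (\<forall>(Q, a)\<in>set h. Q \<subseteq> {..<n} \<and> card Q = q) \<and>
     (\<forall>g\<in>{g \<in> S. correct_report A g Q a}. consistent A g h \<longrightarrow> correct_report P g {..<n} r)"
  define T where "T a = (SOME T. ?ok a T)" for a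
  have T0: "?ok a (T a)" for a unfolding T_def by (rule someI_ex[OF win_query(4)])
  have T: "length h \<le> k \<and> (\<forall>(Q, a)\<in>set h. Q \<subseteq> {..<n} \<and> card Q = q) \<and>
     (\<forall>g\<in>{g \<in> S. correct_report A g Q a}. consistent A g h \<longrightarrow> correct_report P g {..<n} r)"
    if "f \<in> S" "correct_report A f Q a" "run A f (T a) h r" for a f h r
    using T0[of a, THEN bspec, of f] that by simp
  show ?case
  proof (intro exI[of _ "Query Q T"] ballI allI impI)
    fix f h r assume f: "f \<in> S" and run: "run A f (Query Q T) h r"
    from run obtain a h' where h: "h = (Q, a) # h'" "correct_report A f Q a" "run A f (T a) h' r"
      by cases
    note T' = T[OF f h(2,3)]
    have "\<forall>g\<in>S. consistent A g h \<longrightarrow> correct_report P g {..<n} r"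
    proof (intro ballI impI)
      fix g assume "g \<in> S" "consistent A g h"
      then have "correct_report A g Q a" "consistent A g h'" by (simp_all add: h(1) consistent_def)
      with \<open>g \<in> S\<close> T' show "correct_report P g {..<n} r" by simp
    qed
    moreover have "length h \<le> Suc k" using T' by (simp add: h(1))
    moreover have "\<forall>(Q, a)\<in>set h. Q \<subseteq> {..<n} \<and> card Q = q"
      using T' win_query(1,2) by (simp add: h(1))
    ultimately show "length h \<le> Suc k \<and> (\<forall>(Q, a)\<in>set h. Q \<subseteq> {..<n} \<and> card Q = q) \<and>
     (\<forall>g\<in>S. consistent A g h \<longrightarrow> correct_report P g {..<n} r)" by blast
  qed
qed

lemma min_queries_le:
  assumes "win A {..<n} q (\<lambda>S. \<exists>r. \<forall>g\<in>S. correct_report P g {..<n} r) k (colorings n c)"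
  shows "min_queries A P n q c \<le> enat k"
proof -
  obtain T where T: "\<forall>f\<in>colorings n c. \<forall>h r. run A f T h r \<longrightarrow> length h \<le> k \<and>
     (\<forall>(Q, a)\<in>set h. Q \<subseteq> {..<n} \<and> card Q = q) \<and>
     (\<forall>g\<in>colorings n c. consistent A g h \<longrightarrow> correct_report P g {..<n} r)"
    using win_imp_algorithm[OF assms] by blast
  have "worst_case_queries A n c T \<le> enat k"
    unfolding worst_case_queries_def using T by (intro Sup_least) auto
  moreover have "solves A P n q c T" unfolding solves_def using T by blast
  ultimately show ?thesis unfolding min_queries_def
    by (intro Inf_lower2[of "worst_case_queries A n c T"]) auto
qed

section \<open>Color counts, and whether a query is answered at all\<close>

lemma color_count_insert:
  "finite Y \<Longrightarrow> x \<notin> Y \<Longrightarrow> color_count f (insert x Y) d = color_count f Y d + (if f x = d then 1 else 0)"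
proof -
  assume "finite Y" "x \<notin> Y"
  moreover have "{y \<in> insert x Y. f y = d} = (if f x = d then insert x {y \<in> Y. f y = d} else {y \<in> Y. f y = d})"
    by auto
  ultimately show ?thesis unfolding color_count_def by (simp only:) simp
qed

lemma color_count_remove:
  "finite Y \<Longrightarrow> x \<in> Y \<Longrightarrow> color_count f (Y - {x}) d + (if f x = d then 1 else 0) = color_count f Y d"
  using color_count_insert[of "Y - {x}" x f d] by (simp add: insert_absorb)

lemma color_count_le: "finite Y \<Longrightarrow> color_count f Y d \<le> card Y"
  by (simp add: color_count_def card_mono)

lemma color_count_mono: "finite Y \<Longrightarrow> Z \<subseteq> Y \<Longrightarrow> color_count f Z d \<le> color_count f Y d"
  unfolding color_count_def by (rule card_mono) auto

lemma color_count_add_le: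
  assumes "finite Y" "d \<noteq> e" shows "color_count f Y d + color_count f Y e \<le> card Y"
proof -
  have "card ({y \<in> Y. f y = d} \<union> {y \<in> Y. f y = e}) \<le> card Y" using assms(1) by (intro card_mono) auto
  then show ?thesis using assms by (subst (asm) card_Un_disjoint) (auto simp: color_count_def)
qed

lemma color_count_pos: "finite Y \<Longrightarrow> y \<in> Y \<Longrightarrow> 0 < color_count f Y (f y)"
  unfolding color_count_def by (auto simp: card_gt_0_iff)

lemma color_count_posD: "0 < color_count f Y d \<Longrightarrow> \<exists>y\<in>Y. f y = d"
  unfolding color_count_def by (auto simp: card_gt_0_iff)

text \<open>This lets answers to majority queries be used as answers to plurality queries, so that
  one strategy serves both.\<close>

lemma majority_imp_plurality:
  assumes "finite Y" "majority_ball f Y x" shows "plurality_ball f Y x"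
  unfolding plurality_ball_def
proof (intro conjI allI impI)
  show "x \<in> Y" using assms by (simp add: majority_ball_def)
  fix d assume "d \<noteq> f x"
  then show "color_count f Y d < color_count f Y (f x)"
    using color_count_add_le[of Y d "f x" f] assms by (simp add: majority_ball_def)
qed

text \<open>The part of an answer that the coloring alone determines; which valid ball is named is
  the choice of the answerer.\<close>

definition yes :: "ball_notion \<Rightarrow> (nat \<Rightarrow> nat) \<Rightarrow> nat set \<Rightarrow> bool" where
  "yes A f Q \<longleftrightarrow> (\<exists>x\<in>Q. A f Q x)"

lemma yes_majority: "yes majority_ball f Q \<longleftrightarrow> (\<exists>d. card Q < 2 * color_count f Q d)"
proof
  assume "yes majority_ball f Q" then show "\<exists>d. card Q < 2 * color_count f Q d"
    by (auto simp: yes_def majority_ball_def)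
next
  assume "\<exists>d. card Q < 2 * color_count f Q d"
  then obtain d where d: "card Q < 2 * color_count f Q d" by blast
  then obtain y where "y \<in> Q" "f y = d" using color_count_posD[of f Q d] by auto
  then show "yes majority_ball f Q" using d by (auto simp: yes_def majority_ball_def)
qed

lemma yes_plurality:
  "yes plurality_ball f Q \<longleftrightarrow> (\<exists>d. \<forall>e. e \<noteq> d \<longrightarrow> color_count f Q e < color_count f Q d)"
proof
  assume "yes plurality_ball f Q"
  then show "\<exists>d. \<forall>e. e \<noteq> d \<longrightarrow> color_count f Q e < color_count f Q d"
    by (auto simp: yes_def plurality_ball_def)
next
  assume "\<exists>d. \<forall>e. e \<noteq> d \<longrightarrow> color_count f Q e < color_count f Q d"
  then obtain d where d: "\<forall>e. e \<noteq> d \<longrightarrow> color_count f Q e < color_count f Q d" by blast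
  then have "0 < color_count f Q d" by (metis gr0I n_not_Suc_n not_less0)
  then obtain y where "y \<in> Q" "f y = d" using color_count_posD by blast
  then show "yes plurality_ball f Q" using d by (auto simp: yes_def plurality_ball_def)
qed

text \<open>By the two preceding lemmas, \<open>yes\<close> depends only on the size and the color
  counts of the query.\<close>

lemma yes_swap:
  assumes "A \<in> {majority_ball, plurality_ball}" "finite P" "x \<notin> P" "y \<notin> P" "g x = g y"
  shows "yes A g (insert x P) = yes A g (insert y P)"
proof -
  have "color_count g (insert x P) = color_count g (insert y P)"
    using assms(2-5) by (intro ext) (simp add: color_count_insert)
  moreover have "card (insert x P) = card (insert y P)" using assms(2-4) by simp
  moreover have "A = majority_ball \<or> A = plurality_ball" using assms(1) by simp
  ultimately show ?thesis unfolding yes_def by (metis yes_def yes_majority yes_plurality)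
qed

section \<open>Exploiting an unanswered query\<close>

lemma ex_max_card_Int:
  fixes Z :: "nat set"
  assumes "finite Z" "Q0 \<subseteq> Z" "\<Phi> Q0"
  obtains Q where "Q \<subseteq> Z" "\<Phi> Q" "\<And>Q'. Q' \<subseteq> Z \<Longrightarrow> \<Phi> Q' \<Longrightarrow> card (Q' \<inter> R) \<le> card (Q \<inter> R)"
proof -
  let ?F = "(\<lambda>Q. card (Q \<inter> R)) ` {Q. Q \<subseteq> Z \<and> \<Phi> Q}"
  have F: "finite ?F" "?F \<noteq> {}" using assms by auto
  have "Max ?F \<in> ?F" using F by (rule Max_in)
  then obtain Q where "Q \<subseteq> Z" "\<Phi> Q" "card (Q \<inter> R) = Max ?F" by (auto elim!: imageE)
  then show ?thesis using that F(1) by (metis (mono_tags, lifting) Max_ge imageI mem_Collect_eq)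
qed

lemma yes_mono_set:
  assumes "A \<in> {majority_ball, plurality_ball}" "finite Q" "Q \<noteq> {}" "\<forall>y\<in>Q. g y = r"
  shows "yes A g Q"
proof -
  obtain x where "x \<in> Q" using assms by auto
  have "color_count g Q (g x) = card Q" using assms \<open>x \<in> Q\<close> unfolding color_count_def
    by (intro arg_cong[of _ _ card]) auto
  then have "majority_ball g Q x" using \<open>x \<in> Q\<close> assms(2,3) by (simp add: majority_ball_def card_gt_0_iff)
  then show ?thesis using assms(1,2) \<open>x \<in> Q\<close> majority_imp_plurality unfolding yes_def by auto
qed

text \<open>Among the unanswered queries inside \<open>Z\<close>, one with most balls of
  \<open>R\<close> sits at the threshold: exchanging any ball outside \<open>R\<close> for a new
  ball \<open>\<rho>\<close> of \<open>R\<close> creates a majority. So \<open>Q\<close> minus a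
  ball \<open>z\<close> tells \<open>\<rho>\<close> from \<open>x\<close>, unless \<open>x\<close>
  in place of \<open>z\<close> creates a majority too. In that case \<open>r\<close> and
  \<open>g x\<close> are both one ball short of a majority, and trading a ball of color
  \<open>g x\<close> for \<open>z\<close> spoils it for \<open>x\<close> only.\<close>

lemma majority_distinguishes:
  assumes Z: "finite Z" and Q0: "Q0 \<subseteq> Z" "card Q0 = q" "\<not> yes majority_ball g Q0"
    and q: "q \<ge> 2" and R: "R \<subseteq> Z" "card R \<ge> 2 * q" "\<forall>y\<in>R. g y = r" and x: "g x \<noteq> r"
  shows "\<exists>\<rho>\<in>R. \<exists>P. P \<subseteq> Z - {x, \<rho>} \<and> card P = q - 1 \<and>
    yes majority_ball g (insert x P) \<noteq> yes majority_ball g (insert \<rho> P)"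
proof -
  let ?no = "\<lambda>Q. card Q = q \<and> \<not> yes majority_ball g Q"
  let ?cc = "color_count g"
  obtain Q where Q: "Q \<subseteq> Z" "?no Q" and max: "\<And>Q'. Q' \<subseteq> Z \<Longrightarrow> ?no Q' \<Longrightarrow> card (Q' \<inter> R) \<le> card (Q \<inter> R)"
    using ex_max_card_Int[of Z Q0 ?no R] Z Q0 by blast
  have fin: "finite Q" "finite R" using Q(1) R(1) Z finite_subset by auto
  have "\<not> R \<subseteq> Q" using card_mono[OF fin(1), of R] R(2) Q(2) q by linarith
  then obtain \<rho> where \<rho>: "\<rho> \<in> R" "\<rho> \<notin> Q" by auto
  have g\<rho>: "g \<rho> = r" using \<rho> R by auto
  have le: "2 * ?cc Q d \<le> q" for d using Q(2) unfolding yes_majority by (auto simp: not_less)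
  have bigger: "yes majority_ball g (insert \<rho> (Q - {z}))" if z: "z \<in> Q" "z \<notin> R" for z
  proof (rule ccontr)
    assume "\<not> yes majority_ball g (insert \<rho> (Q - {z}))"
    moreover have "card (insert \<rho> (Q - {z})) = q" using \<rho>(2) z fin Q(2) q by simp
    moreover have "insert \<rho> (Q - {z}) \<subseteq> Z" using \<rho> R Q by auto
    ultimately have "card (insert \<rho> (Q - {z}) \<inter> R) \<le> card (Q \<inter> R)" using max by blast
    moreover have "insert \<rho> (Q - {z}) \<inter> R = insert \<rho> (Q \<inter> R)" using z \<rho> by auto
    ultimately show False using \<rho> fin by simp
  qed
  show ?thesis
  proof (cases "x \<in> Q")
    case True
    then have "yes majority_ball g (insert \<rho> (Q - {x}))" using bigger x R by blast
    moreover have "insert x (Q - {x}) = Q" using True by auto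
    ultimately show ?thesis using Q True \<rho> q fin
      by (intro bexI[OF _ \<rho>(1)] exI[of _ "Q - {x}"]) auto
  next
    case False
    have "\<exists>z\<in>Q. g z \<noteq> r" using yes_mono_set[of majority_ball Q g r] Q(2) q fin by force
    then obtain z where z: "z \<in> Q" "g z \<noteq> r" by auto
    define P where "P = Q - {z}"
    have P: "finite P" "card P = q - 1" "P \<subseteq> Z - {x, \<rho>}" "z \<notin> P" "insert z P = Q" "x \<notin> P" "\<rho> \<notin> P"
      using Q z False \<rho> fin by (auto simp: P_def)
    have yes\<rho>: "yes majority_ball g (insert \<rho> P)" using bigger[of z] z R by (auto simp: P_def)
    have ccQ: "?cc Q d = ?cc P d + (if g z = d then 1 else 0)" for d
      using color_count_insert[of P z g d] P by simp
    have cc\<rho>: "?cc (insert \<rho> P) d = ?cc P d + (if r = d then 1 else 0)" for d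
      using color_count_insert[of P \<rho> g d] P g\<rho> by (auto)
    have ccx: "?cc (insert x P) d = ?cc P d + (if g x = d then 1 else 0)" for d
      using color_count_insert[of P x g d] P by auto
    have cards: "card (insert \<rho> P) = q" "card (insert x P) = q" using P q by (auto simp: card_insert_if)
    show ?thesis
    proof (cases "yes majority_ball g (insert x P)")
      case no: False
      then show ?thesis using yes\<rho> P \<rho> by blast
    next
      case yes: True
      from yes\<rho> obtain d where d: "q < 2 * ?cc (insert \<rho> P) d" unfolding yes_majority cards by auto
      \<comment> \<open>No color has a majority in \<open>Q\<close>, so the majority that arises
        with \<open>\<rho>\<close> is in the color of \<open>\<rho>\<close>; likewise for
        \<open>x\<close> below.\<close>
      have r: "q < 2 * (?cc P r + 1)" using d le[of d] ccQ[of d] cc\<rho>[of d] by (cases "r = d") (auto split: if_splits)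
      from yes obtain e where e: "q < 2 * ?cc (insert x P) e" unfolding yes_majority cards by auto
      have b: "q < 2 * (?cc P (g x) + 1)" using e le[of e] ccQ[of e] ccx[of e] by (cases "g x = e") (auto split: if_splits)
      have sum: "?cc P r + ?cc P (g x) \<le> q - 1" using color_count_add_le[of P r "g x" g] P x by auto
      have zb: "g z \<noteq> g x" using b le[of "g x"] ccQ[of "g x"] by auto
      have "?cc P (g x) > 0" using b q by (cases "?cc P (g x)") auto
      then obtain y where y: "y \<in> P" "g y = g x" using color_count_posD by blast
      \<comment> \<open>With this choice \<open>insert x P'\<close> has the color counts of
        \<open>Q\<close>.\<close>
      define P' where "P' = insert z (P - {y})"
      have P': "finite P'" "card P' = q - 1" "P' \<subseteq> Z - {x, \<rho>}" "x \<notin> P'" "\<rho> \<notin> P'"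
        using P y z False \<rho> Q(1) q by (auto simp: P'_def)
      have ccP': "?cc P' d + (if g x = d then 1 else 0) = ?cc P d + (if g z = d then 1 else 0)" for d
        using color_count_insert[of "P - {y}" z g d] color_count_remove[of P y g d] P y by (auto simp: P'_def)
      have cards': "card (insert \<rho> P') = q" "card (insert x P') = q" using P' q by (auto simp: card_insert_if)
      have "?cc (insert \<rho> P') r = ?cc P r + 1"
        using color_count_insert[of P' \<rho> g r] P' g\<rho> ccP'[of r] z x by auto
      then have "yes majority_ball g (insert \<rho> P')" using r unfolding yes_majority cards' by (intro exI[of _ r]) auto
      moreover have "\<not> yes majority_ball g (insert x P')"
      proof -
        have "2 * ?cc (insert x P') d \<le> q" for d
        proof -
          have "?cc (insert x P') d = ?cc Q d"
            using color_count_insert[of P' x g d] P' ccP'[of d] ccQ[of d] by auto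
          then show ?thesis using le by simp
        qed
        then show ?thesis unfolding yes_majority cards' by (auto simp: not_less)
      qed
      ultimately show ?thesis using P' \<rho> by blast
    qed
  qed
qed

lemma color_count_Un:
  "finite B \<Longrightarrow> finite C \<Longrightarrow> B \<inter> C = {} \<Longrightarrow> color_count f (B \<union> C) d = color_count f B d + color_count f C d"
  unfolding color_count_def by (subst card_Un_disjoint[symmetric]) (auto intro: arg_cong[of _ _ card])

lemma color_count_mono_set:
  "\<forall>y\<in>B. f y = t \<Longrightarrow> color_count f B d = (if d = t then card B else 0)"
proof -
  assume "\<forall>y\<in>B. f y = t"
  then have "{y \<in> B. f y = d} = (if d = t then B else {})" by auto
  then show ?thesis by (simp add: color_count_def)
qed

lemma top_color_exists:
  assumes "finite Q" obtains d where "\<And>e. color_count f Q e \<le> color_count f Q d"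
  using ex_has_greatest_nat[of "\<lambda>_. True" 0 "color_count f Q" "Suc (card Q)"] color_count_le[OF assms]
  by (auto simp: less_Suc_eq_le)

text \<open>Again \<open>Q\<close> is an unanswered query with most balls of \<open>R\<close>. Then
  \<open>r\<close> is among its tied top colors, as otherwise balls of another tied color could be
  traded for balls of \<open>R\<close> until \<open>r\<close> takes part in the tie. Removing a ball
  \<open>z\<close> of a second tied color \<open>t\<close> makes \<open>\<rho>\<close> decisive. If
  \<open>x\<close> gets an answer as well, trading a ball of color \<open>g x\<close> or
  \<open>r\<close> for \<open>z\<close> restores the counts of \<open>Q\<close> for exactly one of
  \<open>x\<close> and \<open>\<rho>\<close>.\<close>

lemma plurality_distinguishes:
  assumes Z: "finite Z" and Q0: "Q0 \<subseteq> Z" "card Q0 = q" "\<not> yes plurality_ball g Q0"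
    and q: "q \<ge> 2" and R: "R \<subseteq> Z" "card R \<ge> 2 * q" "\<forall>y\<in>R. g y = r" and x: "g x \<noteq> r"
  shows "\<exists>\<rho>\<in>R. \<exists>P. P \<subseteq> Z - {x, \<rho>} \<and> card P = q - 1 \<and>
    yes plurality_ball g (insert x P) \<noteq> yes plurality_ball g (insert \<rho> P)"
proof -
  let ?no = "\<lambda>Q. card Q = q \<and> \<not> yes plurality_ball g Q"
  let ?cc = "color_count g"
  obtain Q where Q: "Q \<subseteq> Z" "?no Q" and max: "\<And>Q'. Q' \<subseteq> Z \<Longrightarrow> ?no Q' \<Longrightarrow> card (Q' \<inter> R) \<le> card (Q \<inter> R)"
    using ex_max_card_Int[of Z Q0 ?no R] Z Q0 by blast
  have fin: "finite Q" "finite R" using Q(1) R(1) Z finite_subset by auto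
  have "\<not> R \<subseteq> Q" using card_mono[OF fin(1), of R] R(2) Q(2) q by linarith
  then obtain \<rho> where \<rho>: "\<rho> \<in> R" "\<rho> \<notin> Q" by auto
  have g\<rho>: "g \<rho> = r" using \<rho> R by auto
  have tie: "\<exists>e. e \<noteq> d \<and> ?cc Q d \<le> ?cc Q e" for d using Q(2) unfolding yes_plurality by (auto simp: not_less)
  have top: "?cc Q d \<le> ?cc Q r" for d
  proof (rule ccontr)
    assume "\<not> ?cc Q d \<le> ?cc Q r"
    obtain d where d: "\<And>e. ?cc Q e \<le> ?cc Q d" using top_color_exists[OF fin(1)] by blast
    then have lt: "?cc Q r < ?cc Q d" using \<open>\<not> ?cc Q _ \<le> ?cc Q r\<close> by (meson le_trans not_le)
    obtain t where t: "t \<noteq> d" "?cc Q t = ?cc Q d" using tie[of d] d by (metis le_antisym)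
    \<comment> \<open>Trading \<open>j\<close> balls of color \<open>t\<close> for balls of
      \<open>R\<close> lifts \<open>r\<close> to the level of \<open>d\<close>, which remains on
      top, so the tie persists. Outside \<open>Q\<close> there are at least \<open>q\<close> balls
      of \<open>R\<close>, which is enough.\<close>
    define j where "j = ?cc Q d - ?cc Q r"
    have "j \<le> card {y \<in> Q. g y = t}" using t by (simp add: j_def color_count_def)
    then obtain T where T: "T \<subseteq> {y \<in> Q. g y = t}" "card T = j" "finite T" by (meson obtain_subset_with_card_n)
    have "j \<le> q" using color_count_le[OF fin(1), of g d] Q(2) by (simp add: j_def)
    also have "q \<le> card (R - Q)" using diff_card_le_card_Diff[OF fin(1), of R] Q(2) R(2) by linarith
    finally obtain R' where R': "R' \<subseteq> R - Q" "card R' = j" "finite R'" by (meson obtain_subset_with_card_n)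
    define Q' where "Q' = (Q - T) \<union> R'"
    have cQT: "?cc Q e = ?cc (Q - T) e + (if e = t then j else 0)" for e
      using color_count_Un[of "Q - T" T g e] color_count_mono_set[of T g t e] T fin
      by (auto simp: Un_absorb2 subset_iff Diff_Int_distrib2 Int_commute[of _ T])
    have cQ': "?cc Q' e = ?cc (Q - T) e + (if e = r then j else 0)" for e
    proof -
      have "\<forall>y\<in>R'. g y = r" "(Q - T) \<inter> R' = {}" using R' R by auto
      then show ?thesis
        using color_count_Un[of "Q - T" R' g e] color_count_mono_set[of R' g r e] R' fin by (simp add: Q'_def)
    qed
    have tr: "t \<noteq> r" "d \<noteq> r" using lt t by auto
    have "card Q' = card (Q - T) + j" unfolding Q'_def using R' fin by (subst card_Un_disjoint) auto
    also have "T \<subseteq> Q" using T(1) by auto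
    then have "card (Q - T) + j = q"
      using T fin Q(2) card_mono[of Q T] by (simp add: card_Diff_subset)
    finally have 1: "card Q' = q" .
    have 2: "Q' \<subseteq> Z" using R' Q R by (auto simp: Q'_def)
    have "?cc Q' r = ?cc Q d" "?cc Q' d = ?cc Q d" "\<And>e. ?cc Q' e \<le> ?cc Q d"
    proof -
      show a: "?cc Q' r = ?cc Q d" using cQ'[of r] cQT[of r] tr lt by (simp add: j_def)
      show "?cc Q' d = ?cc Q d" using cQ'[of d] cQT[of d] tr t by simp
      show "?cc Q' e \<le> ?cc Q d" for e using cQ'[of e] cQT[of e] d[of e] a by (cases "e = r") auto
    qed
    then have 3: "\<not> yes plurality_ball g Q'" unfolding yes_plurality using tr(2) by (metis not_le)
    have "T \<inter> R = {}" using T R tr by auto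
    then have "Q' \<inter> R = (Q \<inter> R) \<union> R'" using R' by (auto simp: Q'_def)
    then have "card (Q' \<inter> R) = card (Q \<inter> R) + j" using R' fin by (simp, subst card_Un_disjoint) auto
    then show False using max[OF 2] 1 3 lt by (simp add: j_def)
  qed
  define M where "M = ?cc Q r"
  have M: "?cc Q d \<le> M" for d using top by (simp add: M_def)
  obtain t where t: "t \<noteq> r" "?cc Q t = M" using tie[of r] M by (metis M_def le_antisym)
  have "Q \<noteq> {}" using Q(2) q by auto
  then obtain y0 where "y0 \<in> Q" by auto
  then have M0: "M > 0" using color_count_pos[OF fin(1), of y0 g] M[of "g y0"] by simp
  then obtain z where z: "z \<in> Q" "g z = t" using t color_count_posD[of g Q t] by auto
  show ?thesis
  proof (cases "x \<in> Q")
    case True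
    define P where "P = Q - {x}"
    have P: "finite P" "card P = q - 1" "P \<subseteq> Z - {x, \<rho>}" "x \<notin> P" "insert x P = Q" "\<rho> \<notin> P"
      using Q True \<rho> fin by (auto simp: P_def)
    have ccQ: "?cc Q d = ?cc P d + (if g x = d then 1 else 0)" for d
      using color_count_insert[of P x g d] P by simp
    have cc\<rho>: "?cc (insert \<rho> P) d = ?cc P d + (if r = d then 1 else 0)" for d
      using color_count_insert[of P \<rho> g d] P g\<rho> by auto
    have "?cc (insert \<rho> P) e < ?cc (insert \<rho> P) r" if "e \<noteq> r" for e
      using cc\<rho>[of e] cc\<rho>[of r] ccQ[of e] ccQ[of r] M[of e] M_def x that by auto
    then have "yes plurality_ball g (insert \<rho> P)" unfolding yes_plurality by blast
    then show ?thesis using Q(2) P \<rho>(1) by blast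
  next
    case False
    define P where "P = Q - {z}"
    have P: "finite P" "card P = q - 1" "P \<subseteq> Z - {x, \<rho>}" "z \<notin> P" "insert z P = Q" "x \<notin> P" "\<rho> \<notin> P"
      using Q z False \<rho> fin by (auto simp: P_def)
    have ccQ: "?cc Q d = ?cc P d + (if t = d then 1 else 0)" for d
      using color_count_insert[of P z g d] P z by simp
    have cc\<rho>: "?cc (insert \<rho> P) d = ?cc P d + (if r = d then 1 else 0)" for d
      using color_count_insert[of P \<rho> g d] P g\<rho> by auto
    have ccx: "?cc (insert x P) d = ?cc P d + (if g x = d then 1 else 0)" for d
      using color_count_insert[of P x g d] P by auto
    have "?cc (insert \<rho> P) e < ?cc (insert \<rho> P) r" if "e \<noteq> r" for e
      using cc\<rho>[of e] cc\<rho>[of r] ccQ[of e] ccQ[of r] M[of e] M_def that t by auto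
    then have yes\<rho>: "yes plurality_ball g (insert \<rho> P)" unfolding yes_plurality by blast
    show ?thesis
    proof (cases "yes plurality_ball g (insert x P)")
      case no: False
      then show ?thesis using yes\<rho> P \<rho> by blast
    next
      case True
      have bt: "g x \<noteq> t"
      proof
        assume "g x = t"
        then have "yes plurality_ball g (insert x P) = yes plurality_ball g (insert z P)"
          using P z by (intro yes_swap) auto
        then show False using True P Q by simp
      qed
      \<comment> \<open>Both remaining cases trade some ball of \<open>P\<close> for the tied color \<open>t\<close>.\<close>
      define P' where "P' y = insert z (P - {y})" for y
      have P': "finite (P' y)" "card (P' y) = q - 1" "P' y \<subseteq> Z - {x, \<rho>}" "x \<notin> P' y" "\<rho> \<notin> P' y" if "y \<in> P" for y
        using P z False \<rho> Q(1) q that by (auto simp: P'_def)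
      have ccP': "?cc (P' y) d + (if g y = d then 1 else 0) = ?cc Q d" if "y \<in> P" for y d
        using color_count_insert[of "P - {y}" z g d] color_count_remove[of P y g d] P z ccQ[of d] that by (auto simp: P'_def)
      have cc\<rho>': "?cc (insert \<rho> (P' y)) d = ?cc (P' y) d + (if r = d then 1 else 0)" if "y \<in> P" for y d
        using color_count_insert[of "P' y" \<rho> g d] P'[OF that] g\<rho> by auto
      have ccx': "?cc (insert x (P' y)) d = ?cc (P' y) d + (if g x = d then 1 else 0)" if "y \<in> P" for y d
        using color_count_insert[of "P' y" x g d] P'[OF that] by auto
      have noQ: "\<not> yes plurality_ball g B" if "\<And>d. ?cc B d = ?cc Q d" for B
        using Q(2) that unfolding yes_plurality by simp
      show ?thesis
      \<comment> \<open>If \<open>g x\<close> is a third tied color, a ball of it is traded and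
        \<open>x\<close> restores the tie. Otherwise the plurality color of
        \<open>insert x P\<close> must be \<open>r\<close>: a ball of color \<open>r\<close> is
        traded, now \<open>\<rho>\<close> restores the tie, and with \<open>x\<close> the color
        \<open>t\<close> is alone on top.\<close>
      proof (cases "?cc P (g x) = M")
        case b: True
        then obtain y where y: "y \<in> P" "g y = g x" using M0 color_count_posD[of g P "g x"] by auto
        have "?cc (insert \<rho> (P' y)) e < ?cc (insert \<rho> (P' y)) r" if "e \<noteq> r" for e
          using cc\<rho>'[OF y(1), of e] cc\<rho>'[OF y(1), of r] ccP'[OF y(1), of e] ccP'[OF y(1), of r] M[of e] M_def that x y by auto
        then have "yes plurality_ball g (insert \<rho> (P' y))" unfolding yes_plurality by blast
        moreover have "\<not> yes plurality_ball g (insert x (P' y))"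
          by (rule noQ) (use ccx'[OF y(1)] ccP'[OF y(1)] y in auto)
        ultimately show ?thesis using P'[OF y(1)] \<rho> by blast
      next
        case b: False
        from True obtain e where e: "\<And>d. d \<noteq> e \<Longrightarrow> ?cc (insert x P) d < ?cc (insert x P) e"
          unfolding yes_plurality by auto
        have Pr: "?cc P r = M" using ccQ[of r] t by (simp add: M_def)
        have "e = r"
        proof (rule ccontr)
          assume "e \<noteq> r"
          then have "M < ?cc (insert x P) e" using e[of r] ccx[of r] Pr x by auto
          then show False using ccx[of e] ccQ[of e] M[of e] b bt by (auto split: if_splits)
        qed
        then have less: "?cc (insert x P) d < M" if "d \<noteq> r" for d
          using e[of d] ccx[of r] Pr x that by auto
        obtain y where y: "y \<in> P" "g y = r" using M0 Pr color_count_posD[of g P r] by auto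
        have "\<not> yes plurality_ball g (insert \<rho> (P' y))"
          by (rule noQ) (use cc\<rho>'[OF y(1)] ccP'[OF y(1)] y in auto)
        moreover have "?cc (insert x (P' y)) d < ?cc (insert x (P' y)) t" if "d \<noteq> t" for d
          using ccx'[OF y(1), of d] ccx'[OF y(1), of t] ccP'[OF y(1), of d] ccP'[OF y(1), of t]
            ccx[of d] ccQ[of d] less[of d] y x t bt that M0 M_def by (cases "d = r") auto
        then have "yes plurality_ball g (insert x (P' y))" unfolding yes_plurality by blast
        ultimately show ?thesis using P'[OF y(1)] \<rho> by blast
      qed
    qed
  qed
qed

lemma distinguishes:
  assumes "A \<in> {majority_ball, plurality_ball}" "finite Z" "Q0 \<subseteq> Z" "card Q0 = q" "\<not> yes A g Q0"
    "q \<ge> 2" "R \<subseteq> Z" "card R \<ge> 2 * q" "\<forall>y\<in>R. g y = r" "g x \<noteq> r"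
  shows "\<exists>\<rho>\<in>R. \<exists>P. P \<subseteq> Z - {x, \<rho>} \<and> card P = q - 1 \<and>
    yes A g (insert x P) \<noteq> yes A g (insert \<rho> P)"
  using assms majority_distinguishes[of Z Q0 q g R r x] plurality_distinguishes[of Z Q0 q g R r x] by auto

section \<open>Settling which queries are answered\<close>

definition decided :: "ball_notion \<Rightarrow> (nat \<Rightarrow> nat) set \<Rightarrow> nat set \<Rightarrow> bool" where
  "decided A S Q \<longleftrightarrow> (\<forall>g\<in>S. \<forall>h\<in>S. yes A g Q = yes A h Q)"

lemma decided_subset: "decided A S Q \<Longrightarrow> S' \<subseteq> S \<Longrightarrow> decided A S' Q"
  unfolding decided_def by blast

text \<open>Filtering by the answer makes \<open>Q\<close> decided whatever the answer is, so only
  this bit has to reach the continuation.\<close>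

lemma win_decide:
  assumes "Q \<subseteq> X" "card Q = q" "\<And>S'. S' \<subseteq> S \<Longrightarrow> decided A S' Q \<Longrightarrow> win A X q G k S'"
  shows "win A X q G (Suc k) S"
proof (rule win_query[OF assms(1,2)])
  fix a
  have "decided A {g \<in> S. correct_report A g Q a} Q"
    by (cases a) (auto simp: decided_def yes_def)
  then show "win A X q G k {g \<in> S. correct_report A g Q a}" by (rule assms(3)[rotated]) auto
qed

lemma win_decide_all:
  assumes "finite \<Q>" "\<And>Q. Q \<in> \<Q> \<Longrightarrow> Q \<subseteq> X \<and> card Q = q"
    "\<And>S'. S' \<subseteq> S \<Longrightarrow> (\<And>Q. Q \<in> \<Q> \<Longrightarrow> decided A S' Q) \<Longrightarrow> win A X q G k S'"
  shows "win A X q G (k + card \<Q>) S"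
  using assms
proof (induction \<Q> arbitrary: S)
  case empty
  then show ?case by simp
next
  case (insert Q \<Q>)
  have "win A X q G (Suc (k + card \<Q>)) S"
  proof (rule win_decide[of Q])
    fix S1 assume S1: "S1 \<subseteq> S" "decided A S1 Q"
    show "win A X q G (k + card \<Q>) S1"
    proof (rule insert.IH)
      fix S' assume "S' \<subseteq> S1" "\<And>Q. Q \<in> \<Q> \<Longrightarrow> decided A S' Q"
      then show "win A X q G k S'" using S1 decided_subset[OF S1(2)] by (intro insert.prems(2)) auto
    qed (use insert.prems in auto)
  qed (use insert.prems in auto)
  then show ?case using insert.hyps by simp
qed

text \<open>\<open>Z\<close> is to be the sample and \<open>y\<close> a member of it, while
  \<open>x\<close> may lie outside. Balls of equal color satisfy this; conversely, if
  \<open>Z\<close> contains an unanswered query, being indistinguishable from \<open>2 * q\<close>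
  balls of one color in \<open>Z\<close> forces that color.\<close>

definition indist :: "ball_notion \<Rightarrow> nat \<Rightarrow> (nat \<Rightarrow> nat) \<Rightarrow> nat set \<Rightarrow> nat \<Rightarrow> nat \<Rightarrow> bool" where
  "indist A q g Z x y \<longleftrightarrow>
     (\<forall>P. P \<subseteq> Z - {x, y} \<longrightarrow> card P = q - 1 \<longrightarrow> yes A g (insert x P) = yes A g (insert y P))"

lemma indist_same_color:
  assumes "A \<in> {majority_ball, plurality_ball}" "finite Z" "g x = g y"
  shows "indist A q g Z x y"
  unfolding indist_def
proof (intro allI impI)
  fix P assume P: "P \<subseteq> Z - {x, y}"
  show "yes A g (insert x P) = yes A g (insert y P)"
  proof (rule yes_swap[OF assms(1)])
    show "finite P" using P assms(2) finite_subset by auto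
  qed (use P assms(3) in auto)
qed

text \<open>Once the queries in \<open>insert x Z\<close> are decided, the relation is the same for
  all colorings left. Only for this reason may the strategy branch on it.\<close>

lemma indist_cong:
  assumes "\<And>Q. Q \<subseteq> insert x Z \<Longrightarrow> card Q = q \<Longrightarrow> decided A S Q" "g \<in> S" "h \<in> S" "finite Z" "y \<in> Z" "q \<ge> 1"
    "indist A q g Z x y"
  shows "indist A q h Z x y"
  unfolding indist_def
proof (intro allI impI)
  fix P assume P: "P \<subseteq> Z - {x, y}" "card P = q - 1"
  then have "finite P" using assms(4) finite_subset by auto
  then have "insert x P \<subseteq> insert x Z" "card (insert x P) = q" "insert y P \<subseteq> insert x Z" "card (insert y P) = q"
    using P assms(5,6) by (auto simp: card_insert_if)
  then have "yes A g (insert x P) = yes A h (insert x P)" "yes A g (insert y P) = yes A h (insert y P)"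
    using assms(1-3) unfolding decided_def by blast+
  then show "yes A h (insert x P) = yes A h (insert y P)" using assms(7) P unfolding indist_def by blast
qed

section \<open>A bounded sample with many balls of every large color\<close>

lemma card_eq_sum_color_count:
  assumes "finite Y" "\<forall>y\<in>Y. g y < (c::nat)"
  shows "card Y = (\<Sum>d<c. color_count g Y d)"
proof -
  have "card Y = (\<Sum>y\<in>Y. 1)" by simp
  also have "\<dots> = (\<Sum>d<c. \<Sum>y\<in>{y \<in> Y. g y = d}. 1)"
    using assms by (intro sum.group[symmetric]) auto
  finally show ?thesis by (simp add: color_count_def)
qed

lemma ex_frequent_color:
  assumes "finite Y" "\<forall>y\<in>Y. g y < (c::nat)" "c * N \<le> card Y" "N > 0" "c > 0"
  shows "\<exists>d. N \<le> color_count g Y d"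
proof (rule ccontr)
  assume "\<not> ?thesis"
  then have "(\<Sum>d<c. color_count g Y d) < (\<Sum>d<c. N)"
    using assms(4,5) by (intro sum_strict_mono) (auto simp: not_le)
  then show False using card_eq_sum_color_count[OF assms(1,2)] assms(3) by simp
qed

text \<open>\<open>V\<close> holds the balls processed so far and \<open>Z\<close> is the sample.
  The upper bound on each color keeps \<open>Z\<close> bounded; the lower bound gives every ball
  left out enough balls of its own color in \<open>Z\<close> to be recognized by. Both are required
  for all colorings in \<open>S\<close>, since \<open>Z\<close> may depend on the answers
  only.\<close>

definition pool :: "nat \<Rightarrow> nat \<Rightarrow> nat set \<Rightarrow> (nat \<Rightarrow> nat) set \<Rightarrow> nat set \<Rightarrow> nat set \<Rightarrow> bool" where
  "pool c N Q0 S Z V \<longleftrightarrow> Q0 \<subseteq> Z \<and> Z \<subseteq> V \<and> (\<forall>g\<in>S. \<forall>d. color_count g (Z - Q0) d \<le> c * N) \<and>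
     (\<forall>g\<in>S. \<forall>x\<in>V - Z. N \<le> color_count g Z (g x))"

lemma pool_card:
  assumes "pool c N Q0 S Z V" "g \<in> S" "finite V" "\<forall>y\<in>V. g y < c"
  shows "card Z \<le> card Q0 + c * (c * N)"
proof -
  have fin: "finite Z" using assms unfolding pool_def by (meson finite_subset)
  have "card (Z - Q0) = (\<Sum>d<c. color_count g (Z - Q0) d)"
    using assms fin unfolding pool_def by (intro card_eq_sum_color_count) auto
  also have "\<dots> \<le> (\<Sum>d<c. c * N)" using assms unfolding pool_def by (intro sum_mono) auto
  finally have "card (Z - Q0) \<le> c * (c * N)" by simp
  moreover have "card Z \<le> card Q0 + card (Z - Q0)"
    using card_Un_le[of Q0 "Z - Q0"] assms(1) unfolding pool_def by (simp add: Un_absorb1)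
  ultimately show ?thesis by simp
qed

locale no_query =
  fixes A :: ball_notion and X Q0 :: "nat set" and q c :: nat and G :: "(nat \<Rightarrow> nat) set \<Rightarrow> bool"
  assumes A: "A \<in> {majority_ball, plurality_ball}" and X: "finite X" and q: "q \<ge> 2" and c: "c \<ge> 1"
    and Q0: "Q0 \<subseteq> X" "card Q0 = q" and G_empty: "G {}"
begin

text \<open>By the pigeonhole principle, \<open>N\<close> balls of one color under one coloring
  contain \<open>2 * q\<close> balls of one color under any other, the number that
  \<open>distinguishes\<close> demands. \<open>B\<close> is the bound on the sample from
  \<open>pool_card\<close>.\<close>

definition "N = c * (2 * q)"
definition "B = q + c * (c * N)"
definition "Col = {g. (\<forall>x\<in>X. g x < c) \<and> \<not> yes A g Q0}"

lemma same_color: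
  assumes "g \<in> Col" "Q0 \<subseteq> Z" "finite Z" "R \<subseteq> Z" "2 * q \<le> card R" "\<forall>y\<in>R. g y = r" "\<forall>y\<in>R. indist A q g Z x y"
  shows "g x = r"
proof (rule ccontr)
  assume "g x \<noteq> r"
  then obtain \<rho> P where "\<rho> \<in> R" "P \<subseteq> Z - {x, \<rho>}" "card P = q - 1"
    "yes A g (insert x P) \<noteq> yes A g (insert \<rho> P)"
    using distinguishes[OF A assms(3,2) Q0(2) _ q assms(4,5,6)] assms(1) unfolding Col_def by blast
  then show False using assms(7) unfolding indist_def by blast
qed

text \<open>\<open>T\<close>, the balls of \<open>Z\<close> that cannot be told from
  \<open>x\<close>, does not depend on the coloring and contains all balls of \<open>Z\<close> with
  the color of \<open>x\<close>. If \<open>T\<close> has \<open>c * N\<close> balls, then under each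
  coloring some \<open>N\<close> of them share a color, which must be the color of \<open>x\<close>,
  and \<open>x\<close> can stay outside. If not, the color of \<open>x\<close> has fewer than
  \<open>c * N\<close> balls in \<open>Z\<close>, and there is room for \<open>x\<close>.\<close>

lemma pool_step:
  assumes S: "S \<subseteq> Col" "S \<noteq> {}" and V: "insert x V \<subseteq> X" "x \<notin> V" and pool: "pool c N Q0 S Z V"
    and dec: "\<And>Q. Q \<subseteq> insert x Z \<Longrightarrow> card Q = q \<Longrightarrow> decided A S Q"
  shows "\<exists>Z'. pool c N Q0 S Z' (insert x V)"
proof -
  have Z: "finite Z" "Q0 \<subseteq> Z" "Z \<subseteq> V" "x \<notin> Z" using pool V X finite_subset[of Z X] unfolding pool_def by auto
  obtain g0 where g0: "g0 \<in> S" using S(2) by auto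
  define T where "T = {y \<in> Z. indist A q g0 Z x y}"
  have finT: "finite T" using Z by (simp add: T_def)
  have T: "indist A q g Z x y" if "g \<in> S" "y \<in> T" for g y
    by (rule indist_cong[OF _ g0 that(1) Z(1)]) (use dec that(2) q in \<open>auto simp: T_def\<close>)
  have T': "y \<in> T" if "g \<in> S" "y \<in> Z" "g y = g x" for g y
  proof -
    have "indist A q g0 Z x y"
      by (rule indist_cong[OF _ that(1) g0 Z(1) that(2)])
        (use dec q that indist_same_color[OF A Z(1)] in auto)
    then show ?thesis using that by (simp add: T_def)
  qed
  show ?thesis
  proof (cases "c * N \<le> card T")
    case True
    have "N \<le> color_count g Z (g x)" if g: "g \<in> S" for g
    proof -
      have "T \<subseteq> X" using V Z by (auto simp: T_def)
      then have "\<forall>y\<in>T. g y < c" using g S(1) unfolding Col_def by blast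
      then obtain d where d: "N \<le> color_count g T d"
        using ex_frequent_color[OF finT _ True] q c unfolding N_def by auto
      have "g x = d"
      proof (rule same_color[of g Z "{y \<in> T. g y = d}"])
        show "2 * q \<le> card {y \<in> T. g y = d}" using d c q unfolding color_count_def N_def
          by (elim order_trans[rotated]) simp
      qed (use g S Z T in \<open>auto simp: T_def\<close>)
      then show ?thesis using d color_count_mono[OF Z(1), of T g d] unfolding T_def by auto
    qed
    then have "pool c N Q0 S Z (insert x V)" using pool unfolding pool_def by blast
    then show ?thesis by blast
  next
    case False
    have "pool c N Q0 S (insert x Z) (insert x V)"
      unfolding pool_def
    proof (intro conjI ballI allI)
      fix g d assume g: "g \<in> S"
      have eq: "insert x Z - Q0 = insert x (Z - Q0)" using Z V by auto
      have cnt: "color_count g (insert x Z - Q0) d = color_count g (Z - Q0) d + (if g x = d then 1 else 0)"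
        unfolding eq using Z by (intro color_count_insert) auto
      show "color_count g (insert x Z - Q0) d \<le> c * N"
      proof (cases "g x = d")
        case True
        have "color_count g (Z - Q0) d \<le> card T" unfolding color_count_def
          using T'[OF g] True finT by (intro card_mono) auto
        then show ?thesis using cnt False by simp
      qed (use cnt pool g in \<open>auto simp: pool_def\<close>)
    next
      fix g y assume "g \<in> S" "y \<in> insert x V - insert x Z"
      then have "N \<le> color_count g Z (g y)" using pool unfolding pool_def by auto
      also have "\<dots> \<le> color_count g (insert x Z) (g y)" using Z by (intro color_count_mono) auto
      finally show "N \<le> color_count g (insert x Z) (g y)" .
    qed (use Z in auto)
    then show ?thesis by blast
  qed
qed

lemma card_queries:
  assumes "pool c N Q0 S Z V" "V \<subseteq> X" "S \<subseteq> Col" "S \<noteq> {}"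
  shows "card {Q. Q \<subseteq> insert x Z \<and> card Q = q} \<le> 2 ^ (B + 1)"
proof -
  have Z: "finite Z" using assms X unfolding pool_def by (meson finite_subset)
  obtain g where "g \<in> S" using assms(4) by auto
  then have "card Z \<le> B" using pool_card[OF assms(1), of g] assms finite_subset[OF assms(2) X] Q0
    unfolding B_def Col_def by auto
  have "card {Q. Q \<subseteq> insert x Z \<and> card Q = q} \<le> card (Pow (insert x Z))"
    using Z by (intro card_mono) auto
  also have "\<dots> = 2 ^ card (insert x Z)" using Z by (intro card_Pow) auto
  also have "\<dots> \<le> 2 ^ (B + 1)" using \<open>card Z \<le> B\<close> card_insert_le_m1 by (intro power_increasing) (auto simp: card_insert_if Z)
  finally show ?thesis .
qed

lemma win_pool:
  assumes "finite F" "S \<subseteq> Col" "V \<inter> F = {}" "V \<union> F = X" "pool c N Q0 S Z V"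
    "\<And>S' Z'. S' \<subseteq> S \<Longrightarrow> S' \<noteq> {} \<Longrightarrow> pool c N Q0 S' Z' X \<Longrightarrow> win A X q G k S'"
  shows "win A X q G (k + card F * 2 ^ (B + 1)) S"
  using assms
proof (induction F arbitrary: S V Z)
  case empty
  then show ?case using G_empty by (cases "S = {}") (auto intro: win_goal)
next
  case (insert x F)
  let ?\<Q> = "{Q. Q \<subseteq> insert x Z \<and> card Q = q}"
  show ?case
  proof (cases "S = {}")
    case True
    then show ?thesis using G_empty by (auto intro: win_goal)
  next
    case False
    have Z: "Z \<subseteq> X" "finite Z" using insert.prems(3,4) X finite_subset[of Z X] unfolding pool_def by auto
    have "win A X q G (k + card F * 2 ^ (B + 1) + card ?\<Q>) S"
    proof (rule win_decide_all)
      fix S' assume S': "S' \<subseteq> S" and dec: "\<And>Q. Q \<in> ?\<Q> \<Longrightarrow> decided A S' Q"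
      show "win A X q G (k + card F * 2 ^ (B + 1)) S'"
      proof (cases "S' = {}")
        case True
        then show ?thesis using G_empty by (auto intro: win_goal)
      next
        case False
        have "pool c N Q0 S' Z V" using insert.prems(4) S' unfolding pool_def by blast
        then obtain Z' where "pool c N Q0 S' Z' (insert x V)"
          using pool_step[of S' x V Z] dec insert.prems(1,2,3) insert.hyps(2) S' False by auto
        then show ?thesis
        proof (rule insert.IH[rotated 3])
          fix S'' Z'' assume "S'' \<subseteq> S'" "S'' \<noteq> {}" "pool c N Q0 S'' Z'' X"
          then show "win A X q G k S''" using insert.prems(5) S' by blast
        qed (use insert.prems insert.hyps S' in auto)
      qed
    next
      show "\<And>Q. Q \<in> ?\<Q> \<Longrightarrow> Q \<subseteq> X \<and> card Q = q" using Z insert.prems(3) by auto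
    qed (use Z in auto)
    moreover have "card ?\<Q> \<le> 2 ^ (B + 1)"
      using insert.prems False by (intro card_queries[of S Z V]) auto
    ultimately show ?thesis using insert.hyps by (elim win_mono) simp
  qed
qed

section \<open>Agreement on the large color classes\<close>

definition "same_classes S Z \<longleftrightarrow> (\<forall>f\<in>S. \<forall>g\<in>S. \<forall>x\<in>X - Z. {y\<in>X. f y = f x} = {y\<in>X. g y = g x})"

text \<open>For \<open>x\<close> outside \<open>Z\<close>, the at least \<open>N\<close> balls of
  \<open>Z\<close> with color \<open>f x\<close> include \<open>2 * q\<close> balls of one color
  \<open>d\<close> under \<open>g\<close>. A ball \<open>y\<close> with \<open>f y = f x\<close>
  cannot be told from these under \<open>f\<close>, hence not under \<open>g\<close> either, so
  \<open>g y = d\<close>. The roles of \<open>f\<close> and \<open>g\<close> can be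
  exchanged.\<close>

lemma same_classes:
  assumes S: "S \<subseteq> Col" and pool: "pool c N Q0 S Z X"
    and dec: "\<And>x Q. x \<in> X \<Longrightarrow> Q \<subseteq> insert x Z \<Longrightarrow> card Q = q \<Longrightarrow> decided A S Q"
  shows "same_classes S Z"
proof -
  have Z: "Q0 \<subseteq> Z" "Z \<subseteq> X" "finite Z" using pool X finite_subset[of Z X] unfolding pool_def by auto
  have "{y\<in>X. f y = f x} \<subseteq> {y\<in>X. g y = g x}" if f: "f \<in> S" and g: "g \<in> S" and x: "x \<in> X - Z" for f g x
  proof -
    define T where "T = {y \<in> Z. f y = f x}"
    have T: "c * (2 * q) \<le> card T" using pool f x unfolding pool_def N_def T_def color_count_def by auto
    have finT: "finite T" using Z by (simp add: T_def)
    have "\<forall>y\<in>T. g y < c" using g S Z unfolding Col_def T_def by auto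
    then obtain d where d: "2 * q \<le> color_count g T d" using ex_frequent_color[OF finT _ T] q c by auto
    have "g y = d" if y: "y \<in> X" "f y = f x" for y
    proof (rule same_color[of g Z "{y \<in> T. g y = d}"])
      show "2 * q \<le> card {y \<in> T. g y = d}" using d by (simp add: color_count_def)
      show "\<forall>w\<in>{y \<in> T. g y = d}. indist A q g Z y w"
      proof
        fix w assume w: "w \<in> {y \<in> T. g y = d}"
        then have "indist A q f Z y w" using y by (intro indist_same_color A Z) (auto simp: T_def)
        then show "indist A q g Z y w" using w q
          by (intro indist_cong[OF dec[OF y(1)] f g Z(3)]) (auto simp: T_def)
      qed
    qed (use g S Z in \<open>auto simp: T_def\<close>)
    then show ?thesis using x by auto
  qed
  then show ?thesis unfolding same_classes_def by blast
qed

text \<open>Half of the budget builds the sample. Each ball was compared only with the sample of its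
  time, so the other half compares all balls with the final one.\<close>

lemma win_same_classes:
  assumes "S \<subseteq> Col" "\<And>S' Z. S' \<subseteq> S \<Longrightarrow> same_classes S' Z \<Longrightarrow> Z \<subseteq> X \<Longrightarrow> card Z \<le> B \<Longrightarrow> G S'"
  shows "win A X q G (card X * 2 ^ (B + 1) + card X * 2 ^ (B + 1)) S"
proof -
  have "win A X q G (card X * 2 ^ (B + 1) + card (X - Q0) * 2 ^ (B + 1)) S"
  proof (rule win_pool[of _ _ Q0 Q0])
    show "pool c N Q0 S Q0 Q0" by (simp add: pool_def color_count_def)
    fix S' Z assume S': "S' \<subseteq> S" "S' \<noteq> {}" and pool: "pool c N Q0 S' Z X"
    let ?\<Q> = "\<Union>x\<in>X. {Q. Q \<subseteq> insert x Z \<and> card Q = q}"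
    have Z: "Z \<subseteq> X" "finite Z" using pool X finite_subset[of Z X] unfolding pool_def by auto
    obtain g where "g \<in> S'" using S' by auto
    then have B: "card Z \<le> B" using pool_card[OF pool, of g] S' assms X Q0
      unfolding B_def Col_def by auto
    have "card ?\<Q> \<le> (\<Sum>x\<in>X. card {Q. Q \<subseteq> insert x Z \<and> card Q = q})" using X by (rule card_UN_le)
    also have "\<dots> \<le> (\<Sum>x\<in>X. 2 ^ (B + 1))" using pool S' assms(1) by (intro sum_mono card_queries) auto
    finally have card: "card ?\<Q> \<le> card X * 2 ^ (B + 1)" by simp
    have "win A X q G (0 + card ?\<Q>) S'"
    proof (rule win_decide_all)
      fix S'' assume "S'' \<subseteq> S'" and dec: "\<And>Q. Q \<in> ?\<Q> \<Longrightarrow> decided A S'' Q"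
      then have "same_classes S'' Z"
        using pool S' assms(1) by (intro same_classes) (auto simp: pool_def)
      then have "G S''" using assms(2) \<open>S'' \<subseteq> S'\<close> S' Z B by blast
      then show "win A X q G 0 S''" by (rule win_goal)
    qed (use X Z in auto)
    then show "win A X q G (card X * 2 ^ (B + 1)) S'" using card by (elim win_mono) simp
  qed (use assms X Q0 in auto)
  moreover have "card (X - Q0) \<le> card X" using X by (intro card_mono) auto
  ultimately show ?thesis by (elim win_mono) simp
qed

text \<open>A color class inside \<open>Z\<close> has at most \<open>B\<close> balls, so a larger
  one contains a ball outside \<open>Z\<close> and is a class of every coloring in \<open>S\<close>.
  More than \<open>2 * B\<close> balls in \<open>X\<close> make the class of a non-minority ball
  that large, and more than \<open>c * B\<close> make a plurality class that large.\<close>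

lemma same_classes_transfer:
  assumes "same_classes S Z" "Z \<subseteq> X" "card Z \<le> B" "f \<in> S" "g \<in> S" "S \<subseteq> Col" "card X > (c + 2) * B"
  shows "non_minority_ball f X x \<Longrightarrow> non_minority_ball g X x"
    and "plurality_ball f X x \<Longrightarrow> plurality_ball g X x"
proof -
  have big: "color_count g X (g x) = color_count f X (f x) \<and> {y\<in>X. f y = f x} = {y\<in>X. g y = g x}"
    if x: "x \<in> X" "B < color_count f X (f x)"
  proof -
    have "\<not> {y\<in>X. f y = f x} \<subseteq> Z"
      using card_mono[of Z "{y\<in>X. f y = f x}"] assms(2,3) x X finite_subset[of Z X] unfolding color_count_def by force
    then obtain x' where x': "x' \<in> X - Z" "f x' = f x" by auto
    then have eq: "{y\<in>X. f y = f x} = {y\<in>X. g y = g x'}" using assms(1)[unfolded same_classes_def, rule_format, OF assms(4,5) x'(1)] x'(2) by simp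
    then have "g x = g x'" using x by blast
    then have "{y\<in>X. f y = f x} = {y\<in>X. g y = g x}" using eq by simp
    then show ?thesis unfolding color_count_def by (metis (no_types))
  qed
  {
    assume "non_minority_ball f X x"
    then have "x \<in> X" "card X \<le> 2 * color_count f X (f x)" by (auto simp: non_minority_ball_def)
    moreover have "2 * B \<le> (c + 2) * B" by simp
    then have "2 * B < card X" using assms(7) by linarith
    ultimately have "B < color_count f X (f x)" by linarith
    with big[OF \<open>x \<in> X\<close>] \<open>x \<in> X\<close> \<open>card X \<le> _\<close>
    show "non_minority_ball g X x" unfolding non_minority_ball_def by presburger
  }
  assume pl: "plurality_ball f X x"
  have x: "x \<in> X" using pl by (simp add: plurality_ball_def)
  have "\<exists>d. B < color_count f X d"
  proof (rule ccontr)
    assume "\<not> ?thesis"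
    then have "(\<Sum>d<c. color_count f X d) \<le> (\<Sum>d<c. B)" by (intro sum_mono) (auto simp: not_less)
    then show False using card_eq_sum_color_count[OF X, of f c] assms(4,6,7) unfolding Col_def by auto
  qed
  then obtain d0 where "B < color_count f X d0" by blast
  then have Bx: "B < color_count f X (f x)" using pl unfolding plurality_ball_def
    by (metis less_trans)
  note bigx = big[OF x Bx]
  show "plurality_ball g X x" unfolding plurality_ball_def
  proof (intro conjI allI impI x)
    fix d assume d: "d \<noteq> g x"
    show "color_count g X d < color_count g X (g x)"
    proof (cases "{y \<in> X. g y = d} \<subseteq> Z")
      case True
      then have "color_count g X d \<le> B" using card_mono[of Z "{y\<in>X. g y = d}"] assms(2,3) X finite_subset[of Z X]
        unfolding color_count_def by force
      then show ?thesis using Bx bigx by simp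
    next
      case False
      then obtain x' where x': "x' \<in> X - Z" "g x' = d" by auto
      then have eq: "{y\<in>X. f y = f x'} = {y\<in>X. g y = d}" using assms(1)[unfolded same_classes_def, rule_format, OF assms(4,5) x'(1)] x'(2) by simp
      have "f x' \<noteq> f x"
      proof
        assume "f x' = f x"
        then have "x' \<in> {y\<in>X. f y = f x}" using x'(1) by simp
        then have "x' \<in> {y\<in>X. g y = g x}" using bigx by simp
        then show False using d x'(2) by simp
      qed
      then have "color_count f X (f x') < color_count f X (f x)" using pl by (simp add: plurality_ball_def)
      moreover have "color_count f X (f x') = color_count g X d"
        unfolding color_count_def by (rule arg_cong[OF eq])
      ultimately show ?thesis using conjunct1[OF bigx] by simp
    qed
  qed
qed

end

definition report_goal :: "ball_notion \<Rightarrow> nat set \<Rightarrow> (nat \<Rightarrow> nat) set \<Rightarrow> bool" where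
  "report_goal P X S \<longleftrightarrow> (\<exists>r. \<forall>g\<in>S. correct_report P g X r)"

lemma report_goal_if_agree:
  assumes "\<And>f g x. f \<in> S \<Longrightarrow> g \<in> S \<Longrightarrow> x \<in> X \<Longrightarrow> P f X x \<Longrightarrow> P g X x"
  shows "report_goal P X S"
proof (cases "\<exists>f\<in>S. \<exists>x\<in>X. P f X x")
  case True
  then obtain f x where "f \<in> S" "x \<in> X" "P f X x" by blast
  then have "\<forall>g\<in>S. correct_report P g X (Some x)" using assms by simp
  then show ?thesis unfolding report_goal_def by blast
next
  case False
  then have "\<forall>g\<in>S. correct_report P g X None" by simp
  then show ?thesis unfolding report_goal_def by blast
qed

lemma win_after_no:
  fixes q c :: nat
  assumes "q \<ge> 2" "c \<ge> 1"
  shows "\<exists>K n0. \<forall>A P X S Q0. A \<in> {majority_ball, plurality_ball} \<longrightarrow> P \<in> {non_minority_ball, almost_plurality_ball} \<longrightarrow>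
    finite X \<longrightarrow> n0 \<le> card X \<longrightarrow> (\<forall>g\<in>S. \<forall>x\<in>X. g x < c) \<longrightarrow> Q0 \<subseteq> X \<longrightarrow> card Q0 = q \<longrightarrow> (\<forall>g\<in>S. \<not> yes A g Q0) \<longrightarrow>
    win A X q (report_goal P X) (K * card X) S"
proof -
  \<comment> \<open>The value of \<open>B\<close>, spelled out because the constants must be fixed
    before \<open>X\<close> and \<open>Q0\<close> are given and the locale is interpreted.\<close>
  define C where "C = q + c * (c * (c * (2 * q)))"
  have "win A X q (report_goal P X) (2 * 2 ^ (C + 1) * card X) S"
    if A: "A \<in> {majority_ball, plurality_ball}" and P: "P \<in> {non_minority_ball, almost_plurality_ball}"
      and X: "finite X" and n: "Suc ((c + 2) * C) \<le> card X" and S: "\<forall>g\<in>S. \<forall>x\<in>X. g x < c" "\<forall>g\<in>S. \<not> yes A g Q0"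
      and Q0: "Q0 \<subseteq> X" "card Q0 = q" for A P X S Q0
  proof -
    interpret no_query A X Q0 q c "report_goal P X"
      using A X assms Q0 by unfold_locales (auto simp: report_goal_def)
    have B': "B = C" by (simp add: B_def N_def C_def)
    have col: "S \<subseteq> Col" using S by (auto simp: Col_def)
    have "win A X q (report_goal P X) (card X * 2 ^ (B + 1) + card X * 2 ^ (B + 1)) S"
    proof (rule win_same_classes[OF col])
      fix S' Z assume S': "S' \<subseteq> S" "same_classes S' Z" "Z \<subseteq> X" "card Z \<le> B"
      show "report_goal P X S'"
      proof (rule report_goal_if_agree)
        fix f g x assume fg: "f \<in> S'" "g \<in> S'" and Pf: "P f X x"
        have "card X > (c + 2) * B" using n unfolding B' by simp
        note tr = same_classes_transfer[OF S'(2,3,4) fg order_trans[OF S'(1) col] this]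
        show "P g X x" using P Pf tr[of x] by (auto simp: almost_plurality_ball_def)
      qed
    qed
    then show ?thesis unfolding B' by (simp add: mult.commute mult.left_commute)
  qed
  then show ?thesis by blast
qed

section \<open>Queries that are always answered\<close>

definition top_color :: "(nat \<Rightarrow> nat) \<Rightarrow> nat set \<Rightarrow> nat \<Rightarrow> bool" where
  "top_color g W d \<longleftrightarrow> (\<forall>e. color_count g W e \<le> color_count g W d)"

text \<open>Dropping the plurality ball \<open>a\<close> takes one ball from a lead of at least one,
  so its color stays on top. A different color that was on top of \<open>W\<close> can have been
  overtaken only because \<open>x\<close> has the color of \<open>a\<close>; then trading
  \<open>x\<close> for \<open>a\<close> leaves all counts unchanged.\<close>

lemma top_color_swap:
  assumes "finite W" "x \<notin> W" "plurality_ball g (insert x W) a" "y = a \<or> top_color g W (g y)"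
  shows "top_color g (insert x W - {a}) (g y)"
proof -
  let ?V = "insert x W"
  have a: "a \<in> ?V" "\<And>d. d \<noteq> g a \<Longrightarrow> color_count g ?V d < color_count g ?V (g a)"
    using assms(3) by (auto simp: plurality_ball_def)
  have V: "color_count g (?V - {a}) d + (if g a = d then 1 else 0) = color_count g ?V d" for d
    using color_count_remove[of ?V a] assms(1) a(1) by simp
  have W: "color_count g ?V d = color_count g W d + (if g x = d then 1 else 0)" for d
    using color_count_insert assms(1,2) by simp
  have top_a: "color_count g (?V - {a}) d \<le> color_count g (?V - {a}) (g a)" for d
    using V[of d] V[of "g a"] a(2)[of d] by (cases "d = g a") auto
  show ?thesis
  proof (cases "g y = g a")
    case True
    then show ?thesis using top_a by (simp add: top_color_def)
  next
    case False
    then have top: "color_count g W d \<le> color_count g W (g y)" for d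
      using assms(4) by (auto simp: top_color_def)
    have "g a = g x" using a(2)[OF False] W[of "g y"] W[of "g a"] top[of "g a"] by (auto split: if_splits)
    then have "color_count g (?V - {a}) d = color_count g W d" for d using V[of d] W[of d] by auto
    then show ?thesis using top by (simp add: top_color_def)
  qed
qed

text \<open>What one round of queries establishes about the set \<open>W\<close> it leaves behind
  and the remaining balls \<open>I\<close>. Equal counts force \<open>W\<close>, which has
  \<open>q - 1\<close> balls in use, to be of even size; so the second alternative arises for odd
  \<open>q\<close> only.\<close>

definition staged :: "(nat \<Rightarrow> nat) \<Rightarrow> nat set \<Rightarrow> nat set \<Rightarrow> bool" where
  "staged g W I \<longleftrightarrow> (\<forall>x\<in>I. top_color g W (g x)) \<and>
     ((\<forall>x\<in>I. \<forall>y\<in>I. g x = g y) \<or>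
      (\<exists>s t. s \<noteq> t \<and> (\<forall>x\<in>W \<union> I. g x \<in> {s, t}) \<and> color_count g W s = color_count g W t))"

text \<open>The game in which every query returns a plurality ball. Abstracting from
  \<open>win\<close> allows the budget for an unanswered query to be reserved once and for all, and
  allows \<open>Y\<close> to differ from the set of all balls.\<close>

locale plurality_game =
  fixes Y :: "nat set" and q :: nat and wins :: "nat \<Rightarrow> (nat \<Rightarrow> nat) set \<Rightarrow> bool"
  assumes fin: "finite Y" and q: "q \<ge> 2"
    and ask: "Q \<subseteq> Y \<Longrightarrow> card Q = q \<Longrightarrow>
      (\<And>a S'. a \<in> Q \<Longrightarrow> S' \<subseteq> S \<Longrightarrow> \<forall>g\<in>S'. plurality_ball g Q a \<Longrightarrow> wins k S') \<Longrightarrow> wins (Suc k) S"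
    and mono: "wins k S \<Longrightarrow> k \<le> k' \<Longrightarrow> wins k' S"
    and goal: "x \<in> Y \<Longrightarrow> \<forall>g\<in>S. majority_ball g Y x \<Longrightarrow> wins k S"
begin

lemma ask_all:
  assumes "finite \<Q>" "\<And>Q. Q \<in> \<Q> \<Longrightarrow> Q \<subseteq> Y \<and> card Q = q"
    "\<And>S'. S' \<subseteq> S \<Longrightarrow> (\<And>Q. Q \<in> \<Q> \<Longrightarrow> \<exists>a\<in>Q. \<forall>g\<in>S'. plurality_ball g Q a) \<Longrightarrow> wins k S'"
  shows "wins (k + card \<Q>) S"
  using assms
proof (induction \<Q> arbitrary: S)
  case empty
  then show ?case by simp
next
  case (insert Q \<Q>)
  have "wins (Suc (k + card \<Q>)) S"
  proof (rule ask[of Q])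
    fix a S1 assume S1: "a \<in> Q" "S1 \<subseteq> S" "\<forall>g\<in>S1. plurality_ball g Q a"
    show "wins (k + card \<Q>) S1"
    proof (rule insert.IH)
      fix S' assume S': "S' \<subseteq> S1" and *: "\<And>Q. Q \<in> \<Q> \<Longrightarrow> \<exists>a\<in>Q. \<forall>g\<in>S'. plurality_ball g Q a"
      show "wins k S'"
      proof (rule insert.prems(2))
        fix Q' assume "Q' \<in> insert Q \<Q>"
        then show "\<exists>a\<in>Q'. \<forall>g\<in>S'. plurality_ball g Q' a" using * S1 S' by blast
      qed (use S' S1 in auto)
    qed (use insert.prems in auto)
  qed (use insert.prems in auto)
  then show ?case using insert.hyps by simp
qed

text \<open>\<open>F\<close> consists of the balls still to be offered to \<open>W\<close>. It
  starts as all of \<open>Z - W\<close>, where the condition on \<open>Z - W - F\<close> is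
  vacuous.\<close>

lemma swap_phase:
  assumes "finite F" "Z \<subseteq> Y" "W \<subseteq> Z" "F \<subseteq> Z - W" "card W = q - 1"
    "\<forall>g\<in>S. \<forall>y\<in>Z - W - F. top_color g W (g y)"
    "\<And>S' W'. S' \<subseteq> S \<Longrightarrow> W' \<subseteq> Z \<Longrightarrow> card W' = q - 1 \<Longrightarrow> \<forall>g\<in>S'. \<forall>y\<in>Z - W'. top_color g W' (g y) \<Longrightarrow> wins k S'"
  shows "wins (k + card F) S"
  using assms
proof (induction F arbitrary: S W)
  case empty
  then show ?case by auto
next
  case (insert x F)
  have W: "finite W" using insert.prems(1,2) fin by (meson finite_subset)
  have x: "x \<in> Z" "x \<notin> W" using insert.prems by auto
  have "wins (Suc (k + card F)) S"
  proof (rule ask[of "insert x W"])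
    fix a S' assume a: "a \<in> insert x W" "S' \<subseteq> S" "\<forall>g\<in>S'. plurality_ball g (insert x W) a"
    let ?W = "insert x W - {a}"
    show "wins (k + card F) S'"
    proof (rule insert.IH[where W = ?W])
      show "?W \<subseteq> Z" using insert.prems x by auto
      show "F \<subseteq> Z - ?W" using insert.prems insert.hyps by auto
      show "card ?W = q - 1" using W x a(1) insert.prems(4) by simp
      show "\<forall>g\<in>S'. \<forall>y\<in>Z - ?W - F. top_color g ?W (g y)"
      proof (intro ballI)
        fix g y assume g: "g \<in> S'" and y: "y \<in> Z - ?W - F"
        then have "y = a \<or> top_color g W (g y)" using insert.prems(5) a(2) by auto
        then show "top_color g ?W (g y)" using a g W x by (intro top_color_swap) auto
      qed
    qed (use insert.prems a in auto)
  qed (use insert.prems x W q in auto)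
  then show ?case using insert.hyps by simp
qed

text \<open>Balls \<open>x0\<close> and \<open>y\<close> of different colors in \<open>I\<close>
  have tied top colors of \<open>W\<close>. If some \<open>w\<close> in \<open>W\<close> had a third
  color, exchanging it for both of them would raise the two colors to a shared maximum, and the
  query would have no plurality ball. Any other ball of \<open>I\<close> has a top color of
  \<open>W\<close>, which occurs in \<open>W\<close> and so is one of the two.\<close>

lemma stagedI:
  assumes "finite W" "W \<inter> I = {}" "x0 \<in> I" and top: "\<forall>y\<in>I. top_color g W (g y)"
    and pl: "\<And>w y. w \<in> W \<Longrightarrow> y \<in> I - {x0} \<Longrightarrow> \<exists>a. plurality_ball g (insert x0 (insert y (W - {w}))) a"
    and "W \<noteq> {}"
  shows "staged g W I"
proof (cases "\<forall>y\<in>I. g y = g x0")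
  case True
  then show ?thesis using top by (simp add: staged_def)
next
  case False
  then obtain y where y: "y \<in> I" "g y \<noteq> g x0" by auto
  have W: "g w \<in> {g x0, g y}" if w: "w \<in> W" for w
  proof (rule ccontr)
    assume n: "g w \<notin> {g x0, g y}"
    let ?Q = "insert x0 (insert y (W - {w}))"
    have "y \<in> I - {x0}" using y by auto
    then obtain a where a: "plurality_ball g ?Q a" using pl[OF w] by blast
    have Q: "color_count g ?Q d = color_count g (W - {w}) d + (if g x0 = d then 1 else 0) + (if g y = d then 1 else 0)" for d
    proof -
      have "x0 \<notin> insert y (W - {w})" "y \<notin> W - {w}" using assms(2,3) y by auto
      then show ?thesis using color_count_insert[of "insert y (W - {w})" x0 g d]
        color_count_insert[of "W - {w}" y g d] assms(1) by simp
    qed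
    have w': "color_count g (W - {w}) d \<le> color_count g W d" for d using color_count_mono[OF assms(1)] by auto
    have w0: "color_count g (W - {w}) d = color_count g W d" if "d \<noteq> g w" for d
      using color_count_remove[OF assms(1) w, of g d] that by auto
    let ?M = "color_count g W (g x0)"
    have M: "color_count g W (g y) = ?M" "color_count g W d \<le> ?M" for d
      using top y assms(3) unfolding top_color_def by (auto intro: antisym)
    have 1: "color_count g ?Q (g x0) = ?M + 1" using Q[of "g x0"] w0[of "g x0"] n y by auto
    have 2: "color_count g ?Q (g y) = ?M + 1" using Q[of "g y"] w0[of "g y"] n y M by auto
    have 3: "color_count g ?Q d \<le> ?M + 1" for d
    proof (cases "d \<in> {g x0, g y}")
      case True
      then show ?thesis using 1 2 by auto
    next
      case False
      then show ?thesis using Q[of d] w'[of d] M(2)[of d] by auto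
    qed
    have "\<exists>e\<in>{g x0, g y}. e \<noteq> g a" using y by auto
    then obtain e where "e \<in> {g x0, g y}" "e \<noteq> g a" by blast
    then have "?M + 1 < color_count g ?Q (g a)" using a 1 2 unfolding plurality_ball_def by auto
    then show False using 3[of "g a"] by simp
  qed
  have "color_count g W (g x0) = color_count g W (g y)"
    using top y assms(3) unfolding top_color_def by (auto intro: antisym)
  moreover have "g v \<in> {g x0, g y}" if "v \<in> I" for v
  proof -
    obtain w where "w \<in> W" using assms(1,6) by auto
    then have "0 < color_count g W (g w)" using assms(1) by (intro color_count_pos)
    also have "\<dots> \<le> color_count g W (g v)" using top that by (simp add: top_color_def)
    finally obtain w' where "w' \<in> W" "g w' = g v" using color_count_posD[of g W "g v"] by auto
    then show ?thesis using W[of w'] by simp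
  qed
  ultimately show ?thesis unfolding staged_def using top y W
    by (intro conjI disjI2 exI[of _ "g x0"] exI[of _ "g y"]) auto
qed

text \<open>At most \<open>card Z\<close> exchanges, followed by the test queries of
  \<open>stagedI\<close> for all \<open>w\<close> in \<open>W\<close> and all \<open>y\<close>, at
  most \<open>q * card Z\<close> of them.\<close>

lemma stage:
  assumes Z: "Z \<subseteq> Y" "q \<le> card Z"
    and cont: "\<And>S' W. S' \<subseteq> S \<Longrightarrow> W \<subseteq> Z \<Longrightarrow> card W = q - 1 \<Longrightarrow> \<forall>g\<in>S'. staged g W (Z - W) \<Longrightarrow> wins k S'"
  shows "wins (k + (q + 1) * card Z) S"
proof -
  have finZ: "finite Z" using Z(1) fin by (rule finite_subset)
  obtain W0 where W0: "W0 \<subseteq> Z" "card W0 = q - 1" "finite W0"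
    using obtain_subset_with_card_n[of "q - 1" Z] Z(2) by (metis diff_le_self le_trans)
  have "wins (k + q * card Z + card (Z - W0)) S"
  proof (rule swap_phase[of _ Z W0])
    fix S1 W assume S1: "S1 \<subseteq> S" and W: "W \<subseteq> Z" "card W = q - 1"
      and top: "\<forall>g\<in>S1. \<forall>y\<in>Z - W. top_color g W (g y)"
    have finW: "finite W" using W(1) finZ by (rule finite_subset)
    have "Z - W \<noteq> {}" using card_mono[OF finW, of Z] W(2) Z(2) q by auto
    then obtain x0 where x0: "x0 \<in> Z - W" by auto
    define \<Q> where "\<Q> = (\<lambda>(w, y). insert x0 (insert y (W - {w}))) ` (W \<times> (Z - W - {x0}))"
    have "card \<Q> \<le> card (W \<times> (Z - W - {x0}))" unfolding \<Q>_def by (rule card_image_le) (use finW finZ in auto)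
    also have "\<dots> \<le> q * card Z" unfolding card_cartesian_product W(2)
      using finZ by (intro mult_le_mono card_mono) auto
    finally have card: "card \<Q> \<le> q * card Z" .
    have "wins (k + card \<Q>) S1"
    proof (rule ask_all)
      show "finite \<Q>" using finW finZ by (simp add: \<Q>_def)
      fix Q assume "Q \<in> \<Q>"
      then obtain w y where "w \<in> W" "y \<in> Z - W - {x0}" "Q = insert x0 (insert y (W - {w}))"
        by (auto simp: \<Q>_def)
      then show "Q \<subseteq> Y \<and> card Q = q" using x0 W Z finW q by auto
    next
      fix S' assume S': "S' \<subseteq> S1" and pl: "\<And>Q. Q \<in> \<Q> \<Longrightarrow> \<exists>a\<in>Q. \<forall>g\<in>S'. plurality_ball g Q a"
      show "wins k S'"
      proof (rule cont[OF _ W])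
        show "\<forall>g\<in>S'. staged g W (Z - W)"
        proof
          fix g assume g: "g \<in> S'"
          show "staged g W (Z - W)"
          proof (rule stagedI[OF finW _ x0])
            show "\<forall>y\<in>Z - W. top_color g W (g y)" using top g S' by auto
            fix w y assume "w \<in> W" "y \<in> Z - W - {x0}"
            then have "insert x0 (insert y (W - {w})) \<in> \<Q>" by (auto simp: \<Q>_def)
            then show "\<exists>a. plurality_ball g (insert x0 (insert y (W - {w}))) a" using pl g by blast
          qed (use W q in auto)
        qed
      qed (use S' S1 in auto)
    qed
    then show "wins (k + q * card Z) S1" using card by (elim mono) simp
  qed (use W0 finZ Z in auto)
  moreover have "card (Z - W0) \<le> card Z" using finZ by (intro card_mono) auto
  ultimately show ?thesis by (elim mono) (simp add: algebra_simps)
qed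

end

section \<open>Hitting sets and minimal families without a common ball\<close>

lemma hitting_pair:
  assumes "finite W" "card W = 2 * k" "k \<ge> 1" "B1 \<subseteq> W" "B2 \<subseteq> W" "B3 \<subseteq> W"
    "k \<le> card B1" "k \<le> card B2" "k \<le> card B3"
  shows "\<exists>w\<in>W. \<exists>w'\<in>W. w \<noteq> w' \<and> {w, w'} \<inter> B1 \<noteq> {} \<and> {w, w'} \<inter> B2 \<noteq> {} \<and> {w, w'} \<inter> B3 \<noteq> {}"
proof -
  \<comment> \<open>One ball \<open>w\<close> serves two of the sets, and the second ball comes from
    the third set.\<close>
  have hit: "\<exists>w\<in>W. \<exists>w'\<in>W. w \<noteq> w' \<and> {w, w'} \<inter> B \<noteq> {} \<and> {w, w'} \<inter> B' \<noteq> {} \<and> {w, w'} \<inter> B'' \<noteq> {}"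
    if w: "w \<in> B \<inter> B'" "B \<subseteq> W" "B'' \<subseteq> W" "k \<le> card B''" for w B B' B''
  proof -
    have "B'' \<noteq> {}" using w assms(3) by auto
    then obtain v where v: "v \<in> B''" by auto
    show ?thesis
    proof (cases "v = w")
      case True
      have "\<not> W \<subseteq> {w}" using card_mono[of "{w}" W] assms(2,3) by auto
      then obtain w' where "w' \<in> W" "w' \<noteq> w" by auto
      then show ?thesis using w v True by (intro bexI[of _ w] bexI[of _ w']) auto
    next
      case False
      then show ?thesis using w v by (intro bexI[of _ w] bexI[of _ v]) auto
    qed
  qed
  have fin: "finite B1" "finite B2" "finite B3" using assms finite_subset by auto
  \<comment> \<open>Three disjoint sets of \<open>k\<close> balls do not fit into
    \<open>2 * k\<close> balls.\<close>
  have "\<not> (B1 \<inter> B2 = {} \<and> B1 \<inter> B3 = {} \<and> B2 \<inter> B3 = {})"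
  proof
    assume d: "B1 \<inter> B2 = {} \<and> B1 \<inter> B3 = {} \<and> B2 \<inter> B3 = {}"
    have "card (B1 \<union> B2 \<union> B3) = card B1 + card B2 + card B3"
      using fin d by (subst card_Un_disjoint | auto)+
    moreover have "card (B1 \<union> B2 \<union> B3) \<le> card W" using assms by (intro card_mono) auto
    ultimately show False using assms by linarith
  qed
  then consider w where "w \<in> B1 \<inter> B2" | w where "w \<in> B1 \<inter> B3" | w where "w \<in> B2 \<inter> B3" by blast
  then show ?thesis
  proof cases
    case 1
    show ?thesis using hit[OF 1 assms(4,6,9)] by blast
  next
    case 2
    show ?thesis using hit[OF 2 assms(4,5,8)] by blast
  next
    case 3
    show ?thesis using hit[OF 3 assms(5,4,7)] by blast
  qed
qed

text \<open>By minimality, the members other than \<open>A\<close> have a common ball in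
  \<open>Y\<close>, and this ball must be missing from \<open>A\<close>.\<close>

lemma minimal_empty_Inter:
  fixes R :: "'i \<Rightarrow> 'b set"
  assumes "finite \<A>" "Y \<inter> (\<Inter>A\<in>\<A>. R A) = {}"
  obtains \<B> where "\<B> \<subseteq> \<A>" "Y \<inter> (\<Inter>A\<in>\<B>. R A) = {}"
    "\<And>A. A \<in> \<B> \<Longrightarrow> \<exists>p\<in>Y. p \<notin> R A \<and> (\<forall>A'\<in>\<B> - {A}. p \<in> R A')"
proof -
  define E where "E \<B> \<longleftrightarrow> Y \<inter> (\<Inter>A\<in>\<B>. R A) = {}" for \<B>
  have "\<exists>\<B>. \<B> \<subseteq> \<A> \<and> E \<B> \<and> (\<forall>\<C>. \<C> \<subset> \<B> \<longrightarrow> \<not> E \<C>)" if "E \<A>"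
    using assms(1) that
  proof (induction \<A> rule: finite_psubset_induct)
    case (psubset \<A>)
    show ?case
    proof (cases "\<exists>\<C>. \<C> \<subset> \<A> \<and> E \<C>")
      case True
      then obtain \<C> where C: "\<C> \<subset> \<A>" "E \<C>" by auto
      then obtain \<B> where "\<B> \<subseteq> \<C>" "E \<B>" "\<forall>\<C>. \<C> \<subset> \<B> \<longrightarrow> \<not> E \<C>" using psubset.IH[OF C] by (elim exE conjE)
      moreover from this(1) have "\<B> \<subseteq> \<A>" using C(1) by (meson psubset_imp_subset subset_trans)
      ultimately show ?thesis by (intro exI[of _ \<B>] conjI)
    qed (use psubset.prems in auto)
  qed
  then obtain \<B> where B: "\<B> \<subseteq> \<A>" "Y \<inter> (\<Inter>A\<in>\<B>. R A) = {}"
    "\<And>\<C>. \<C> \<subset> \<B> \<Longrightarrow> Y \<inter> (\<Inter>A\<in>\<C>. R A) \<noteq> {}" using assms(2) unfolding E_def by auto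
  have "\<exists>p\<in>Y. p \<notin> R A \<and> (\<forall>A'\<in>\<B> - {A}. p \<in> R A')" if "A \<in> \<B>" for A
  proof -
    have "\<B> - {A} \<subset> \<B>" using that by auto
    from B(3)[OF this] obtain p where "p \<in> Y \<inter> (\<Inter>A\<in>\<B> - {A}. R A)" by (auto simp only: ex_in_conv[symmetric])
    then have p: "p \<in> Y" "\<forall>A'\<in>\<B> - {A}. p \<in> R A'" by auto
    have "p \<notin> R A"
    proof
      assume "p \<in> R A"
      with p have "p \<in> Y \<inter> (\<Inter>A\<in>\<B>. R A)" by auto
      then show False using B(2) by simp
    qed
    with p show ?thesis by auto
  qed
  then show ?thesis by (rule that[OF B(1,2)])
qed

section \<open>The game between families of colorings\<close>

definition majority_class :: "nat set \<Rightarrow> (nat \<Rightarrow> nat) \<Rightarrow> nat set" where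
  "majority_class Y g = {x \<in> Y. majority_ball g Y x}"

text \<open>A subset \<open>A\<close> of the bounded set \<open>C\<close> names the family of
  colorings whose majority class has the trace \<open>A\<close> on \<open>C\<close>; the set is what
  is certain about the majority class within that family. A family that has died out has all of
  \<open>Y\<close> as its common part.\<close>

definition common :: "nat set \<Rightarrow> nat set \<Rightarrow> (nat \<Rightarrow> nat) set \<Rightarrow> nat set \<Rightarrow> nat set" where
  "common Y C S A = {x \<in> Y. \<forall>g\<in>S. majority_class Y g \<inter> C = A \<longrightarrow> x \<in> majority_class Y g}"

lemma common_subset: "common Y C S A \<subseteq> Y"
  by (auto simp: common_def)

lemma common_antimono: "S' \<subseteq> S \<Longrightarrow> common Y C S A \<subseteq> common Y C S' A"
  by (auto simp: common_def)

lemma majority_class_color: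
  assumes "finite Y" "x \<in> majority_class Y g"
  shows "majority_class Y g = {y \<in> Y. g y = g x}"
proof -
  have x: "majority_ball g Y x" using assms(2) by (simp add: majority_class_def)
  have "g y = g x" if "majority_ball g Y y" for y
    using color_count_add_le[OF assms(1), of "g y" "g x" g] x that unfolding majority_ball_def by fastforce
  moreover have "majority_ball g Y y" if "y \<in> Y" "g y = g x" for y
    using x that by (simp add: majority_ball_def)
  ultimately show ?thesis unfolding majority_class_def by blast
qed

text \<open>Three balls, each excluded by only one of the classes, tip an almost balanced set.\<close>
lemma tipping_query:
  assumes W: "finite W" "card W = 2 * k" "k \<ge> 1"
    and A: "k \<le> card (A1 \<inter> W)" "k \<le> card (A2 \<inter> W)" "k \<le> card (A3 \<inter> W)"
    and p: "p1 \<notin> W" "p2 \<notin> W" "p3 \<notin> W" "p1 \<noteq> p2" "p1 \<noteq> p3" "p2 \<noteq> p3"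
  obtains Q where "Q \<subseteq> W \<union> {p1, p2, p3}" "card Q = 2 * k + 1"
    "\<forall>R. k \<le> card (R \<inter> W) \<longrightarrow> p1 \<in> R \<longrightarrow> p2 \<in> R \<longrightarrow> p3 \<in> R \<longrightarrow> k + 1 \<le> card (R \<inter> Q)"
    "\<forall>R. R \<inter> W = A1 \<inter> W \<longrightarrow> p2 \<in> R \<longrightarrow> p3 \<in> R \<longrightarrow> k + 1 \<le> card (R \<inter> Q)"
    "\<forall>R. R \<inter> W = A2 \<inter> W \<longrightarrow> p1 \<in> R \<longrightarrow> p3 \<in> R \<longrightarrow> k + 1 \<le> card (R \<inter> Q)"
    "\<forall>R. R \<inter> W = A3 \<inter> W \<longrightarrow> p1 \<in> R \<longrightarrow> p2 \<in> R \<longrightarrow> k + 1 \<le> card (R \<inter> Q)"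
proof -
  \<comment> \<open>Two balls leave \<open>W\<close>, and at least two of the new balls count for
    the class; the result must be \<open>k + 1\<close>. If the class has exactly \<open>k\<close>
    balls in \<open>W\<close>, one of the two leaving has to be outside it; if it has more, any two
    may leave.\<close>
  define B where "B A = (if card (A \<inter> W) = k then W - A else W)" for A
  have B: "B A \<subseteq> W" "k \<le> card (B A)" for A
  proof -
    have "card (W - A) = card W - card (A \<inter> W)" using W(1) by (simp add: card_Diff_subset_Int Int_commute)
    then show "B A \<subseteq> W" "k \<le> card (B A)" using W(2) by (auto simp: B_def)
  qed
  obtain w w' where w: "w \<in> W" "w' \<in> W" "w \<noteq> w'" "{w, w'} \<inter> B A1 \<noteq> {}" "{w, w'} \<inter> B A2 \<noteq> {}" "{w, w'} \<inter> B A3 \<noteq> {}"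
    using hitting_pair[OF W B(1) B(1) B(1) B(2) B(2) B(2), of A1 A2 A3] by blast
  define D where "D = W - {w, w'}"
  define Q where "Q = D \<union> {p1, p2, p3}"
  have D: "finite D" "card D = 2 * k - 2" using W w by (auto simp: D_def card_Diff_subset)
  have lose: "card (R \<inter> W) \<le> card (R \<inter> D) + card (R \<inter> {w, w'})" for R
  proof -
    have "R \<inter> W = (R \<inter> D) \<union> (R \<inter> {w, w'})" using w by (auto simp: D_def)
    then show ?thesis using card_Un_le by metis
  qed
  have lose2: "card (R \<inter> {w, w'}) \<le> 2" for R
    using card_mono[of "{w, w'}" "R \<inter> {w, w'}"] w(3) by auto
  have tight: "k + 1 \<le> card (R \<inter> D) + 2" if "R \<inter> W = A \<inter> W" "k \<le> card (A \<inter> W)" "{w, w'} \<inter> B A \<noteq> {}" for R A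
  proof (cases "card (A \<inter> W) = k")
    case True
    then have "{w, w'} \<inter> (W - A) \<noteq> {}" using that by (simp add: B_def)
    then have "R \<inter> {w, w'} \<subseteq> {w} \<or> R \<inter> {w, w'} \<subseteq> {w'}" using that(1) by blast
    then have "card (R \<inter> {w, w'}) \<le> 1"
      using card_mono[of "{w}" "R \<inter> {w, w'}"] card_mono[of "{w'}" "R \<inter> {w, w'}"] by auto
    then show ?thesis using lose[of R] that by simp
  next
    case False
    then show ?thesis using lose[of R] lose2[of R] that by simp
  qed
  have add: "card (R \<inter> D) + card P \<le> card (R \<inter> Q)" if "P \<subseteq> {p1, p2, p3}" "P \<subseteq> R" for R P
  proof -
    have "card (R \<inter> D \<union> P) = card (R \<inter> D) + card P"
      using D p that finite_subset[OF that(1)] by (intro card_Un_disjoint) (auto simp: D_def)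
    moreover have "card (R \<inter> D \<union> P) \<le> card (R \<inter> Q)"
      using that D by (intro card_mono) (auto simp: Q_def)
    ultimately show ?thesis by simp
  qed
  show ?thesis
  proof (rule that[of Q])
    show "Q \<subseteq> W \<union> {p1, p2, p3}" by (auto simp: Q_def D_def)
    have "D \<inter> {p1, p2, p3} = {}" using p by (auto simp: D_def)
    then show "card Q = 2 * k + 1" using D p W(3) unfolding Q_def by (simp add: card_Un_disjoint)
    \<comment> \<open>Here three balls enter and at most two leave, so \<open>k\<close> balls
      suffice without any condition on the pair.\<close>
    show "\<forall>R. k \<le> card (R \<inter> W) \<longrightarrow> p1 \<in> R \<longrightarrow> p2 \<in> R \<longrightarrow> p3 \<in> R \<longrightarrow> k + 1 \<le> card (R \<inter> Q)"
    proof (intro allI impI)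
      fix R assume "k \<le> card (R \<inter> W)" "p1 \<in> R" "p2 \<in> R" "p3 \<in> R"
      then show "k + 1 \<le> card (R \<inter> Q)" using add[of "{p1, p2, p3}" R] lose[of R] lose2[of R] p by auto
    qed
    show "\<forall>R. R \<inter> W = A1 \<inter> W \<longrightarrow> p2 \<in> R \<longrightarrow> p3 \<in> R \<longrightarrow> k + 1 \<le> card (R \<inter> Q)"
    proof (intro allI impI)
      fix R assume "R \<inter> W = A1 \<inter> W" "p2 \<in> R" "p3 \<in> R"
      then show "k + 1 \<le> card (R \<inter> Q)" using add[of "{p2, p3}" R] tight[of R A1] A w p by auto
    qed
    show "\<forall>R. R \<inter> W = A2 \<inter> W \<longrightarrow> p1 \<in> R \<longrightarrow> p3 \<in> R \<longrightarrow> k + 1 \<le> card (R \<inter> Q)"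
    proof (intro allI impI)
      fix R assume "R \<inter> W = A2 \<inter> W" "p1 \<in> R" "p3 \<in> R"
      then show "k + 1 \<le> card (R \<inter> Q)" using add[of "{p1, p3}" R] tight[of R A2] A w p by auto
    qed
    show "\<forall>R. R \<inter> W = A3 \<inter> W \<longrightarrow> p1 \<in> R \<longrightarrow> p2 \<in> R \<longrightarrow> k + 1 \<le> card (R \<inter> Q)"
    proof (intro allI impI)
      fix R assume "R \<inter> W = A3 \<inter> W" "p1 \<in> R" "p2 \<in> R"
      then show "k + 1 \<le> card (R \<inter> Q)" using add[of "{p1, p2}" R] tight[of R A3] A w p by auto
    qed
  qed
qed

text \<open>The sum counts the balls missing from the common parts; every query of the strategy lowers it.\<close>
lemma (in plurality_game) wins_if_common_large:
  fixes W :: "nat \<Rightarrow> nat set"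
  assumes k: "q = 2 * k + 1" "k \<ge> 1"
    and W: "\<And>i. i < 4 \<Longrightarrow> W i \<subseteq> C" "\<And>i. i < 4 \<Longrightarrow> card (W i) = 2 * k"
      "\<And>i j. i < 4 \<Longrightarrow> j < 4 \<Longrightarrow> i \<noteq> j \<Longrightarrow> W i \<inter> W j = {}"
    and C: "C \<subseteq> Y"
    and S: "\<And>g i. g \<in> S \<Longrightarrow> i < 4 \<Longrightarrow> k \<le> card (majority_class Y g \<inter> W i)"
    and large: "\<And>A. A \<subseteq> C \<Longrightarrow> card Y < 2 * card (common Y C S A)"
  shows "wins (\<Sum>A\<in>Pow C. card (Y - common Y C S A)) S"
  using S large
proof (induction "\<Sum>A\<in>Pow C. card (Y - common Y C S A)" arbitrary: S rule: less_induct)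
  case less
  note S = less.prems(1) and large = less.prems(2)
  have finC: "finite C" using C fin by (rule finite_subset)
  show ?case
  proof (cases "Y \<inter> (\<Inter>A\<in>Pow C. common Y C S A) = {}")
    case False
    then obtain x where x: "x \<in> Y" "\<And>A. A \<subseteq> C \<Longrightarrow> x \<in> common Y C S A" by auto
    have "majority_ball g Y x" if "g \<in> S" for g
      using x(2)[of "majority_class Y g \<inter> C"] that by (auto simp: common_def majority_class_def)
    then show ?thesis using x(1) by (intro goal) auto
  next
    case True
    obtain \<B> where B: "\<B> \<subseteq> Pow C" "Y \<inter> (\<Inter>A\<in>\<B>. common Y C S A) = {}"
      "\<And>A. A \<in> \<B> \<Longrightarrow> \<exists>p\<in>Y. p \<notin> common Y C S A \<and> (\<forall>A'\<in>\<B> - {A}. p \<in> common Y C S A')"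
      using minimal_empty_Inter[OF _ True] finC by auto
    have meet: "\<exists>x\<in>Y. x \<in> common Y C S A \<and> x \<in> common Y C S A'" if "A \<in> \<B>" "A' \<in> \<B>" for A A'
    proof (rule ccontr)
      assume "\<not> ?thesis"
      then have "common Y C S A \<inter> common Y C S A' = {}" using common_subset by blast
      then have "card (common Y C S A) + card (common Y C S A') = card (common Y C S A \<union> common Y C S A')"
        using fin common_subset finite_subset by (metis card_Un_disjoint)
      also have "\<dots> \<le> card Y" using fin common_subset by (intro card_mono) auto
      finally show False using large[of A] large[of A'] that B(1) by fastforce
    qed
    have "Y \<noteq> {}" using large[of "{}"] by (auto simp: common_def)
    then have "\<B> \<noteq> {}" using B(2) by auto
    then obtain A1 where A1: "A1 \<in> \<B>" by auto
    have "\<not> \<B> \<subseteq> {A1}" using meet[OF A1 A1] B(2) A1 by blast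
    then obtain A2 where A2: "A2 \<in> \<B>" "A2 \<noteq> A1" by auto
    have "\<not> \<B> \<subseteq> {A1, A2}" using meet[OF A1 A2(1)] B(2) by blast
    then obtain A3 where A3: "A3 \<in> \<B>" "A3 \<noteq> A1" "A3 \<noteq> A2" by auto
    obtain p1 where p1: "p1 \<in> Y" "p1 \<notin> common Y C S A1" "\<And>A. A \<in> \<B> \<Longrightarrow> A \<noteq> A1 \<Longrightarrow> p1 \<in> common Y C S A"
      using B(3)[OF A1] by auto
    obtain p2 where p2: "p2 \<in> Y" "p2 \<notin> common Y C S A2" "\<And>A. A \<in> \<B> \<Longrightarrow> A \<noteq> A2 \<Longrightarrow> p2 \<in> common Y C S A"
      using B(3)[OF A2(1)] by auto
    obtain p3 where p3: "p3 \<in> Y" "p3 \<notin> common Y C S A3" "\<And>A. A \<in> \<B> \<Longrightarrow> A \<noteq> A3 \<Longrightarrow> p3 \<in> common Y C S A"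
      using B(3)[OF A3(1)] by auto
    have distinct: "p1 \<noteq> p2" "p1 \<noteq> p3" "p2 \<noteq> p3"
      using p1 p2 p3 A1 A2 A3 by metis+
    \<comment> \<open>Three balls cannot meet four disjoint sets.\<close>
    obtain i where i: "i < 4" "p1 \<notin> W i" "p2 \<notin> W i" "p3 \<notin> W i"
    proof (rule ccontr)
      note pick = that
      assume n: "\<not> thesis"
      have "\<exists>x\<in>{p1, p2, p3}. x \<in> W i" if "i < 4" for i using n pick[of i] that by blast
      then obtain h where h: "\<And>i. i < 4 \<Longrightarrow> h i \<in> {p1, p2, p3} \<and> h i \<in> W i" by metis
      have "inj_on h {..<4}"
      proof (rule inj_onI, rule ccontr)
        fix i j assume ij: "i \<in> {..<4}" "j \<in> {..<4}" "h i = h j" "i \<noteq> j"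
        then have "h i \<in> W i \<inter> W j" using h[of i] h[of j] by simp
        then show False using W(3)[of i j] ij by (metis empty_iff lessThan_iff)
      qed
      then have "card {..<4::nat} \<le> card {p1, p2, p3}" using h by (intro card_inj_on_le[of h]) auto
      moreover have "card {p1, p2, p3} = 3" using distinct by simp
      ultimately show False by simp
    qed
    \<comment> \<open>A common part that misses a ball belongs to a family that still has a
      coloring, and the trace of this coloring is \<open>A\<close>.\<close>
    have key: "k \<le> card (A \<inter> W i)" if AB: "A \<in> \<B>" for A
    proof -
      obtain p where "p \<in> Y" "p \<notin> common Y C S A" using B(3)[OF AB] by blast
      then obtain g where "g \<in> S" "majority_class Y g \<inter> C = A" by (auto simp: common_def)
      then have "k \<le> card (majority_class Y g \<inter> W i)" "majority_class Y g \<inter> W i = A \<inter> W i"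
        using S i W(1)[OF i(1)] by auto
      then show ?thesis by simp
    qed
    have Wi: "finite (W i)" using W(1)[OF i(1)] finC by (rule finite_subset)
    obtain Q where Q: "Q \<subseteq> W i \<union> {p1, p2, p3}" "card Q = 2 * k + 1"
      "\<forall>R. k \<le> card (R \<inter> W i) \<longrightarrow> p1 \<in> R \<longrightarrow> p2 \<in> R \<longrightarrow> p3 \<in> R \<longrightarrow> k + 1 \<le> card (R \<inter> Q)"
      "\<forall>R. R \<inter> W i = A1 \<inter> W i \<longrightarrow> p2 \<in> R \<longrightarrow> p3 \<in> R \<longrightarrow> k + 1 \<le> card (R \<inter> Q)"
      "\<forall>R. R \<inter> W i = A2 \<inter> W i \<longrightarrow> p1 \<in> R \<longrightarrow> p3 \<in> R \<longrightarrow> k + 1 \<le> card (R \<inter> Q)"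
      "\<forall>R. R \<inter> W i = A3 \<inter> W i \<longrightarrow> p1 \<in> R \<longrightarrow> p2 \<in> R \<longrightarrow> k + 1 \<le> card (R \<inter> Q)"
      by (rule tipping_query[OF Wi W(2)[OF i(1)] k(2) key[OF A1] key[OF A2(1)] key[OF A3(1)] i(2-4) distinct])
    have QY: "Q \<subseteq> Y" using Q(1) W(1)[OF i(1)] C p1(1) p2(1) p3(1) by blast
    have maj: "k + 1 \<le> card (majority_class Y g \<inter> Q)" if g: "g \<in> S" "majority_class Y g \<inter> C \<in> \<B>" for g
    proof -
      let ?R = "majority_class Y g"
      let ?A = "?R \<inter> C"
      have RA: "common Y C S ?A \<subseteq> ?R" using g(1) by (auto simp: common_def)
      have RW: "?R \<inter> W i = ?A \<inter> W i" using W(1)[OF i(1)] by auto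
      consider "?A = A1" | "?A = A2" | "?A = A3" | "?A \<noteq> A1" "?A \<noteq> A2" "?A \<noteq> A3" by blast
      then show ?thesis
      proof cases
        case 1
        then show ?thesis using Q(4)[rule_format, of ?R] RW RA p2(3)[OF g(2)] p3(3)[OF g(2)] A2 A3 by auto
      next
        case 2
        then show ?thesis using Q(5)[rule_format, of ?R] RW RA p1(3)[OF g(2)] p3(3)[OF g(2)] A2 A3 by auto
      next
        case 3
        then show ?thesis using Q(6)[rule_format, of ?R] RW RA p1(3)[OF g(2)] p2(3)[OF g(2)] A2 A3 by auto
      next
        case 4
        then show ?thesis using Q(3)[rule_format, of ?R] S[OF g(1) i(1)] RA p1(3)[OF g(2)] p2(3)[OF g(2)] p3(3)[OF g(2)] by auto
      qed
    qed
    let ?\<mu> = "\<lambda>S. \<Sum>A\<in>Pow C. card (Y - common Y C S A)"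
    \<comment> \<open>The answer \<open>a\<close> is in the majority class for every family in
      \<open>\<B>\<close>. As these have no common ball, the common part of at least one of them did
      not contain \<open>a\<close> yet.\<close>
    have step: "?\<mu> S' < ?\<mu> S \<and> wins (?\<mu> S') S'"
      if a: "a \<in> Q" "S' \<subseteq> S" "\<forall>g\<in>S'. plurality_ball g Q a" for a S'
    proof
      have aR: "a \<in> majority_class Y g" if g: "g \<in> S'" "majority_class Y g \<inter> C \<in> \<B>" for g
      proof -
        have m: "k + 1 \<le> card (majority_class Y g \<inter> Q)" using maj g a(2) by blast
        then have "majority_class Y g \<inter> Q \<noteq> {}" by auto
        then obtain x where x: "x \<in> majority_class Y g" by auto
        note R = majority_class_color[OF fin x]
        have "majority_class Y g \<inter> Q = {y \<in> Q. g y = g x}" using R QY by auto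
        then have "card Q < 2 * color_count g Q (g x)" using m Q(2) by (simp add: color_count_def)
        moreover have "color_count g Q (g x) + color_count g Q (g a) \<le> card Q" if "g a \<noteq> g x"
          using QY fin finite_subset that by (intro color_count_add_le) auto
        moreover have "color_count g Q (g x) < color_count g Q (g a)" if "g a \<noteq> g x"
          using a(3) g(1) that unfolding plurality_ball_def by (metis)
        ultimately have "g a = g x" by linarith
        then show ?thesis using R a(1) QY by auto
      qed
      have sub: "Y - common Y C S' A \<subseteq> Y - common Y C S A" for A using common_antimono[OF a(2)] by auto
      have "a \<in> Y" using a(1) QY by auto
      then obtain A where A: "A \<in> \<B>" "a \<notin> common Y C S A" using B(2) by auto
      have "a \<in> common Y C S' A" using aR A(1) \<open>a \<in> Y\<close> by (auto simp: common_def)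
      then have "Y - common Y C S' A \<subset> Y - common Y C S A" using sub[of A] A(2) \<open>a \<in> Y\<close> by auto
      then have "card (Y - common Y C S' A) < card (Y - common Y C S A)" using fin by (intro psubset_card_mono) auto
      then show less: "?\<mu> S' < ?\<mu> S"
        using finC A(1) B(1) sub fin by (intro sum_strict_mono_ex1) (auto intro!: card_mono)
      show "wins (?\<mu> S') S'"
      proof (rule less.hyps[OF less])
        fix A assume "A \<subseteq> C"
        then have "card Y < 2 * card (common Y C S A)" by (rule large)
        also have "card (common Y C S A) \<le> card (common Y C S' A)"
          using common_antimono[OF a(2)] finite_subset[OF common_subset fin] by (intro card_mono)
        finally show "card Y < 2 * card (common Y C S' A)" by simp
      qed (use S a(2) in auto)
    qed
    have "Q \<noteq> {}" using Q(2) by auto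
    show ?thesis
    proof (cases "?\<mu> S")
      \<comment> \<open>Impossible, since even passing to the empty set of colorings would lower the
        sum.\<close>
      case 0
      obtain a where "a \<in> Q" using \<open>Q \<noteq> {}\<close> by auto
      then show ?thesis using step[of a "{}"] 0 by auto
    next
      case (Suc m)
      have "wins (Suc m) S"
      proof (rule ask[OF QY])
        show "card Q = q" using Q(2) k by simp
        fix a S' assume "a \<in> Q" "S' \<subseteq> S" "\<forall>g\<in>S'. plurality_ball g Q a"
        then have "?\<mu> S' < Suc m" "wins (?\<mu> S') S'" using step[of a S'] Suc by auto
        then show "wins m S'" by (elim mono) simp
      qed
      then show ?thesis using Suc by simp
    qed
  qed
qed

section \<open>Selection by comparisons\<close>

text \<open>\<open>le S x y\<close> is the order as far as it is known when \<open>S\<close> is the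
  set of possibilities. A comparison costs 6 units: in the interpretation below, 2 queries and a
  reserve of 4 for the case that they leave the order open.\<close>

locale comparisons =
  fixes I :: "'e set" and le :: "'s set \<Rightarrow> 'e \<Rightarrow> 'e \<Rightarrow> bool" and wins :: "nat \<Rightarrow> 's set \<Rightarrow> bool"
  assumes finite_I: "finite I"
    and le_trans: "le S x y \<Longrightarrow> le S y z \<Longrightarrow> le S x z"
    and le_subset: "le S x y \<Longrightarrow> S' \<subseteq> S \<Longrightarrow> le S' x y"
    and budget_mono: "wins k S \<Longrightarrow> k \<le> k' \<Longrightarrow> wins k' S"
    and compare: "x \<in> I \<Longrightarrow> y \<in> I \<Longrightarrow> (\<And>S'. S' \<subseteq> S \<Longrightarrow> le S' x y \<or> le S' y x \<Longrightarrow> wins k S') \<Longrightarrow> wins (k + 6) S"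
begin

lemma partition:
  assumes "finite F" "F \<subseteq> I" "z \<in> I"
    "\<And>S' L H. S' \<subseteq> S \<Longrightarrow> L \<union> H = F \<Longrightarrow> L \<inter> H = {} \<Longrightarrow> \<forall>y\<in>L. le S' y z \<Longrightarrow> \<forall>y\<in>H. le S' z y \<Longrightarrow> wins k S'"
  shows "wins (k + 6 * card F) S"
  using assms
proof (induction F arbitrary: S)
  case empty
  show ?case using empty.prems(3)[of S "{}" "{}"] by simp
next
  case (insert x F)
  have "wins (k + 6 * card F + 6) S"
  proof (rule compare[of x z])
    fix S1 assume S1: "S1 \<subseteq> S" "le S1 x z \<or> le S1 z x"
    show "wins (k + 6 * card F) S1"
    proof (rule insert.IH)
      fix S' L H
      assume *: "S' \<subseteq> S1" "L \<union> H = F" "L \<inter> H = {}" "\<forall>y\<in>L. le S' y z" "\<forall>y\<in>H. le S' z y"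
      from S1(2) show "wins k S'"
      proof
        assume "le S1 x z"
        then have "le S' x z" using le_subset *(1) by blast
        then show ?thesis using * S1(1) insert.hyps by (intro insert.prems(3)[of S' "insert x L" H]) auto
      next
        assume "le S1 z x"
        then have "le S' z x" using le_subset *(1) by blast
        then show ?thesis using * S1(1) insert.hyps by (intro insert.prems(3)[of S' L "insert x H"]) auto
      qed
    qed (use insert.prems in auto)
  qed (use insert.prems in auto)
  then show ?case using insert.hyps by (simp add: algebra_simps)
qed

definition split :: "'s set \<Rightarrow> 'e set \<Rightarrow> 'e \<Rightarrow> 'e set \<Rightarrow> 'e set \<Rightarrow> bool" where
  "split S J z L H \<longleftrightarrow> J = insert z (L \<union> H) \<and> z \<notin> L \<union> H \<and> L \<inter> H = {} \<and>
     (\<forall>y\<in>L. le S y z) \<and> (\<forall>y\<in>H. le S z y)"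

text \<open>Stated with a continuation, since the element selected depends on the answers. Ranks
  start at 0.\<close>

definition selects :: "nat \<Rightarrow> 'e set \<Rightarrow> bool" where
  "selects K J \<longleftrightarrow> (\<forall>r<card J. \<forall>k S. (\<forall>S' z L H. S' \<subseteq> S \<longrightarrow> split S' J z L H \<longrightarrow> card L = r \<longrightarrow> wins k S') \<longrightarrow>
     wins (k + K * card J) S)"

lemma selectsD:
  assumes "selects K J" "r < card J"
    "\<And>S' z L H. S' \<subseteq> S \<Longrightarrow> split S' J z L H \<Longrightarrow> card L = r \<Longrightarrow> wins k S'"
  shows "wins (k + K * card J) S"
  by (rule assms(1)[unfolded selects_def, rule_format, OF assms(2)]) (rule assms(3))

lemma split_lower:
  assumes "split S J z L H" "S' \<subseteq> S" "split S' L z' L' H'"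
  shows "split S' J z' L' (H' \<union> insert z H)"
proof -
  have le: "\<forall>y\<in>L. le S' y z" "\<forall>y\<in>H. le S' z y" using assms(1,2) le_subset unfolding split_def by blast+
  have "z' \<in> L" using assms(3) unfolding split_def by auto
  then have "le S' z' z" using le by auto
  then have "\<forall>y\<in>H. le S' z' y" using le le_trans by blast
  then show ?thesis using assms(1,3) \<open>le S' z' z\<close> unfolding split_def by auto
qed

lemma split_upper:
  assumes "split S J z L H" "S' \<subseteq> S" "split S' H z' L' H'"
  shows "split S' J z' (L' \<union> insert z L) H'"
proof -
  have le: "\<forall>y\<in>L. le S' y z" "\<forall>y\<in>H. le S' z y" using assms(1,2) le_subset unfolding split_def by blast+
  have "z' \<in> H" using assms(3) unfolding split_def by auto
  then have "le S' z z'" using le by auto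
  then have "\<forall>y\<in>L. le S' y z'" using le le_trans by blast
  then show ?thesis using assms(1,3) \<open>le S' z z'\<close> unfolding split_def by auto
qed

text \<open>Quickselect with part of the order relative to the pivot known in advance. Since
  \<open>PL\<close> and \<open>PH\<close> already lie on their sides, at most \<open>M\<close>
  elements can end up on either side.\<close>

lemma pivot_step:
  assumes J: "J \<subseteq> I" "z \<in> J" and r: "r < card J"
    and PL: "PL \<subseteq> J - {z}" "\<forall>y\<in>PL. le S y z" and PH: "PH \<subseteq> J - {z}" "\<forall>y\<in>PH. le S z y" and disj: "PL \<inter> PH = {}"
    and M: "card J \<le> M + 1 + card PL" "card J \<le> M + 1 + card PH"
    and rec: "\<And>J'. J' \<subset> J \<Longrightarrow> card J' \<le> M \<Longrightarrow> selects K J'"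
    and cont: "\<And>S' z L H. S' \<subseteq> S \<Longrightarrow> split S' J z L H \<Longrightarrow> card L = r \<Longrightarrow> wins k S'"
  shows "wins (k + 6 * card J + K * M) S"
proof -
  have finJ: "finite J" using J finite_I finite_subset by auto
  have "wins (k + K * M + 6 * card (J - {z} - PL - PH)) S"
  proof (rule partition[of _ z])
    fix S1 L' H'
    assume *: "S1 \<subseteq> S" "L' \<union> H' = J - {z} - PL - PH" "L' \<inter> H' = {}" "\<forall>y\<in>L'. le S1 y z" "\<forall>y\<in>H'. le S1 z y"
    define L where "L = PL \<union> L'"
    define H where "H = PH \<union> H'"
    have "\<forall>y\<in>PL. le S1 y z" "\<forall>y\<in>PH. le S1 z y" using PL PH *(1) le_subset by blast+
    moreover have "L \<union> H = J - {z}"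
    proof -
      have "L \<union> H = PL \<union> PH \<union> (L' \<union> H')" by (auto simp: L_def H_def)
      also have "\<dots> = J - {z}" unfolding *(2) using PL(1) PH(1) by auto
      finally show ?thesis .
    qed
    then have "J = insert z (L \<union> H)" "z \<notin> L \<union> H" using J(2) by auto
    moreover have "L \<inter> H = {}"
    proof -
      have "L' \<subseteq> J - {z} - PL - PH" "H' \<subseteq> J - {z} - PL - PH" using *(2) by auto
      then show ?thesis using disj *(3) by (auto simp: L_def H_def)
    qed
    ultimately have sp: "split S1 J z L H" using *(4,5) unfolding split_def L_def H_def by auto
    then have JLH: "J = insert z (L \<union> H)" "z \<notin> L \<union> H" "L \<inter> H = {}" by (auto simp: split_def)
    have fin: "finite L" "finite H" using JLH finJ by auto
    have cJ: "card J = 1 + card L + card H" using JLH fin by (simp add: card_Un_disjoint)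
    have "card PL \<le> card L" "card PH \<le> card H" using fin by (auto simp: L_def H_def intro!: card_mono)
    then have cM: "card L \<le> M" "card H \<le> M" using M cJ by auto
    consider "r = card L" | "r < card L" | "card L < r" by linarith
    then show "wins (k + K * M) S1"
    proof cases
      case 1
      then have "wins k S1" using cont sp *(1) by blast
      then show ?thesis by (rule budget_mono) simp
    next
      case 2
      have "wins (k + K * card L) S1"
      proof (rule selectsD[OF _ 2])
        show "selects K L" using JLH cM by (intro rec) auto
        fix S' z' L1 H1 assume "S' \<subseteq> S1" "split S' L z' L1 H1" "card L1 = r"
        then show "wins k S'" using split_lower[OF sp] *(1) by (intro cont) auto
      qed
      then show ?thesis using cM by (elim budget_mono) simp
    next
      case 3
      have "wins (k + K * card H) S1"
      proof (rule selectsD)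
        show "selects K H" using JLH cM by (intro rec) auto
        \<comment> \<open>All of \<open>L\<close> and the pivot precede the elements of
          \<open>H\<close> and are subtracted from the rank.\<close>
        show "r - card L - 1 < card H" using 3 r cJ by simp
        fix S' z' L1 H1 assume a: "S' \<subseteq> S1" "split S' H z' L1 H1" "card L1 = r - card L - 1"
        have "L1 \<subseteq> H" "finite L1" using a(2) fin(2) by (auto simp: split_def)
        then have "card (L1 \<union> insert z L) = card L1 + card (insert z L)"
          using JLH fin by (intro card_Un_disjoint) auto
        also have "\<dots> = r" using a(3) 3 JLH fin by simp
        finally show "wins k S'" using split_upper[OF sp] a *(1) by (intro cont) auto
      qed
      then show ?thesis using cM by (elim budget_mono) simp
    qed
  qed (use finJ J in auto)
  moreover have "card (J - {z} - PL - PH) \<le> card J" using finJ by (intro card_mono) auto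
  ultimately show ?thesis by (elim budget_mono) simp
qed

text \<open>Any pivot will do: the set shrinks by at least one element each time, at a cost of at
  most \<open>6 * m\<close>.\<close>

lemma selects_small:
  assumes "J \<subseteq> I" "card J \<le> m" shows "selects (6 * m) J"
  using assms
proof (induction "card J" arbitrary: J rule: less_induct)
  case less
  have finJ: "finite J" using less.prems finite_I finite_subset by auto
  show ?case unfolding selects_def
  proof (intro allI impI)
    fix r k S assume r: "r < card J"
      and cont: "\<forall>S' z L H. S' \<subseteq> S \<longrightarrow> split S' J z L H \<longrightarrow> card L = r \<longrightarrow> wins k S'"
    then obtain z where z: "z \<in> J" by fastforce
    have "wins (k + 6 * card J + 6 * m * (card J - 1)) S"
    proof (rule pivot_step[of J z r "{}" S "{}"])
      fix J' assume J': "J' \<subset> J"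
      then have "card J' < card J" using finJ by (rule psubset_card_mono[rotated])
      then show "selects (6 * m) J'" using J' less.prems by (intro less.hyps) auto
    next
      fix S' z L H assume "S' \<subseteq> S" "split S' J z L H" "card L = r"
      then show "wins k S'" using cont by blast
    qed (use less.prems z r in auto)
    moreover have "6 * card J + 6 * m * (card J - 1) \<le> 6 * m * card J"
    proof -
      obtain j where "card J = Suc j" using r by (cases "card J") auto
      then show ?thesis using less.prems(2) by (simp add: algebra_simps)
    qed
    ultimately show "wins (k + 6 * m * card J) S" by (elim budget_mono) simp
  qed
qed

text \<open>In use, \<open>m\<close> is the median of a group of five, \<open>dn m\<close> consists
  of \<open>m\<close> and the two elements below it, and \<open>up m\<close> of \<open>m\<close> and
  the two above it.\<close>

definition grouped :: "'s set \<Rightarrow> 'e set \<Rightarrow> 'e set \<Rightarrow> ('e \<Rightarrow> 'e set) \<Rightarrow> ('e \<Rightarrow> 'e set) \<Rightarrow> bool" where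
  "grouped S J M dn up \<longleftrightarrow> M \<subseteq> J \<and>
     (\<forall>m\<in>M. m \<in> dn m \<and> dn m \<union> up m \<subseteq> J \<and> card (dn m) = 3 \<and> card (up m) = 3 \<and>
        (\<forall>y\<in>dn m. y \<noteq> m \<longrightarrow> le S y m) \<and> (\<forall>y\<in>up m. y \<noteq> m \<longrightarrow> le S m y)) \<and>
     (\<forall>m\<in>M. \<forall>m'\<in>M. m \<noteq> m' \<longrightarrow> (dn m \<union> up m) \<inter> (dn m' \<union> up m') = {})"

text \<open>By \<open>selects_small\<close>, the median of five elements costs
  \<open>30 * 5\<close>.\<close>

lemma groups:
  assumes "J \<subseteq> I" "5 * s \<le> card J"
    "\<And>S' M dn up. S' \<subseteq> S \<Longrightarrow> grouped S' J M dn up \<Longrightarrow> card M = s \<Longrightarrow> wins k S'"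
  shows "wins (k + 150 * s) S"
  using assms
proof (induction s arbitrary: J S k)
  case 0
  show ?case using 0(3)[of S "{}"] by (simp add: grouped_def)
next
  case (Suc s)
  have finJ: "finite J" using Suc.prems finite_I finite_subset by auto
  have "5 \<le> card J" using Suc.prems(2) by simp
  then obtain G where G: "G \<subseteq> J" "card G = 5" "finite G" using obtain_subset_with_card_n[of 5 J] by metis
  have "wins (k + 30 * card G + 150 * s) S"
  proof (rule Suc.IH[of "J - G"])
    show "J - G \<subseteq> I" using Suc.prems by auto
    show "5 * s \<le> card (J - G)" using Suc.prems(2) G by (simp add: card_Diff_subset)
    fix S1 M dn up assume S1: "S1 \<subseteq> S" and gr: "grouped S1 (J - G) M dn up" and s: "card M = s"
    show "wins (k + 30 * card G) S1"
    proof (rule selectsD[of _ _ 2])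
      show "selects 30 G" using selects_small[of G 5] G Suc.prems(1) by auto
      show "2 < card G" using G by simp
      fix S' z L H assume S': "S' \<subseteq> S1" and sp: "split S' G z L H" and L: "card L = 2"
      have GLH: "G = insert z (L \<union> H)" "z \<notin> L \<union> H" "L \<inter> H = {}" using sp by (auto simp: split_def)
      then have fin: "finite L" "finite H" using G by auto
      have "card G = 1 + card L + card H" using GLH fin by (simp add: card_Un_disjoint)
      then have H: "card H = 2" using G L by simp
      have zM: "z \<notin> M" using gr GLH by (auto simp: grouped_def)
      have finM: "finite M" using gr finJ finite_subset by (auto simp: grouped_def)
      let ?dn = "dn(z := insert z L)" and ?up = "up(z := insert z H)"
      show "wins k S'"
      proof (rule Suc.prems(3)[of S' "insert z M" ?dn ?up])
        show "card (insert z M) = Suc s" using zM finM s by simp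
        have z: "insert z L \<union> insert z H = G" using GLH by auto
        have old: "m \<in> dn m" "dn m \<union> up m \<subseteq> J - G" "card (dn m) = 3" "card (up m) = 3"
          "\<forall>y\<in>dn m. y \<noteq> m \<longrightarrow> le S' y m" "\<forall>y\<in>up m. y \<noteq> m \<longrightarrow> le S' m y" if "m \<in> M" for m
          using gr that le_subset[OF _ S'] by (auto simp: grouped_def)
        have pair: "(dn m \<union> up m) \<inter> (dn m' \<union> up m') = {}" if "m \<in> M" "m' \<in> M" "m \<noteq> m'" for m m'
          using gr that by (auto simp: grouped_def)
        show "grouped S' J (insert z M) ?dn ?up" unfolding grouped_def
        proof (intro conjI ballI impI)
          show "insert z M \<subseteq> J" using gr GLH G by (auto simp: grouped_def)
        next
          fix m m' assume m: "m \<in> insert z M" "m' \<in> insert z M" "m \<noteq> m'"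
          consider "m = z" "m' \<in> M" "m' \<noteq> z" | "m' = z" "m \<in> M" "m \<noteq> z" | "m \<in> M" "m' \<in> M" "m \<noteq> z" "m' \<noteq> z"
            using m by auto
          then show "(?dn m \<union> ?up m) \<inter> (?dn m' \<union> ?up m') = {}"
          proof cases
            case 1
            then have "(insert z L \<union> insert z H) \<inter> (dn m' \<union> up m') = {}" unfolding z using old(2) by blast
            then show ?thesis using 1 by simp
          next
            case 2
            then have "(dn m \<union> up m) \<inter> (insert z L \<union> insert z H) = {}" unfolding z using old(2) by blast
            then show ?thesis using 2 by simp
          next
            case 3
            then show ?thesis using pair m(3) by simp
          qed
        next
          fix m assume m: "m \<in> insert z M"
          show "m \<in> ?dn m" using m old(1) by auto
          show "?dn m \<union> ?up m \<subseteq> J" using m old(2) z G(1) by (cases "m = z") (auto simp: subset_iff)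
          show "card (?dn m) = 3" "card (?up m) = 3" using m old(3,4) L H fin GLH by auto
          fix y
          { assume "y \<in> ?dn m" "y \<noteq> m" then show "le S' y m" using m old(5) sp by (auto simp: split_def split: if_splits) }
          { assume "y \<in> ?up m" "y \<noteq> m" then show "le S' m y" using m old(6) sp by (auto simp: split_def split: if_splits) }
        qed
      qed (use S' S1 in auto)
    qed
  qed
  then show ?case using G by (simp add: algebra_simps)
qed

text \<open>Median of medians.\<close>
lemma selects_linear:
  assumes "J \<subseteq> I" shows "selects 720 J"
  using assms
proof (induction "card J" arbitrary: J rule: less_induct)
  case less
  have finJ: "finite J" using less.prems finite_I finite_subset by auto
  show ?case
  proof (cases "card J \<le> 120")
    case True
    \<comment> \<open>The factor 720 is \<open>6 * 120\<close>.\<close>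
    then show ?thesis using selects_small[OF less.prems True] by simp
  next
    case False
    define s where "s = card J div 5"
    have s: "5 * s \<le> card J" "card J < 5 * s + 5" "s < card J" "24 \<le> s" using False by (auto simp: s_def)
    \<comment> \<open>The median of the \<open>s\<close> group medians has at least
      \<open>s - 1 - s div 2\<close> group medians on either side, and each of them brings three
      elements of its group to that side.\<close>
    define M where "M = card J - 1 - 3 * (s - 1 - s div 2)"
    show ?thesis unfolding selects_def
    proof (intro allI impI)
      fix r k S assume r: "r < card J"
        and cont: "\<forall>S' z L H. S' \<subseteq> S \<longrightarrow> split S' J z L H \<longrightarrow> card L = r \<longrightarrow> wins k S'"
      have "wins (k + 6 * card J + 720 * M + 720 * s + 150 * s) S"
      proof (rule groups[OF less.prems s(1)])
        fix S1 N dn up assume S1: "S1 \<subseteq> S" and gr: "grouped S1 J N dn up" and N: "card N = s"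
        have NJ: "N \<subseteq> J" using gr by (simp add: grouped_def)
        have "wins (k + 6 * card J + 720 * M + 720 * card N) S1"
        proof (rule selectsD[of _ _ "s div 2"])
          show "selects 720 N" using NJ N s less.prems by (intro less.hyps) auto
          show "s div 2 < card N" using N s by simp
          fix S2 z L H assume S2: "S2 \<subseteq> S1" and sp: "split S2 N z L H" and L: "card L = s div 2"
          have NLH: "N = insert z (L \<union> H)" "z \<notin> L \<union> H" "L \<inter> H = {}" using sp by (auto simp: split_def)
          have fin: "finite L" "finite H" using NLH NJ finJ finite_subset by auto
          have "card N = 1 + card L + card H" using NLH fin by (simp add: card_Un_disjoint)
          then have H: "card H = s - 1 - s div 2" using N L by simp
          have old: "m \<in> dn m" "dn m \<union> up m \<subseteq> J" "card (dn m) = 3" "card (up m) = 3"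
            "\<forall>y\<in>dn m. y \<noteq> m \<longrightarrow> le S2 y m" "\<forall>y\<in>up m. y \<noteq> m \<longrightarrow> le S2 m y" if "m \<in> N" for m
            using gr that le_subset[OF _ S2] by (auto simp: grouped_def)
          have pair: "(dn m \<union> up m) \<inter> (dn m' \<union> up m') = {}" if "m \<in> N" "m' \<in> N" "m \<noteq> m'" for m m'
            using gr that unfolding grouped_def by blast
          have zdn: "z \<in> dn z" "z \<in> N" using old(1) NLH by auto
          define PL where "PL = (\<Union>m\<in>L. dn m)"
          define PH where "PH = (\<Union>m\<in>H. up m)"
          have fin3: "finite (dn m)" "finite (up m)" if "m \<in> N" for m using old(3,4)[OF that] by (auto intro: card_ge_0_finite)
          have "card PL = (\<Sum>m\<in>L. card (dn m))" unfolding PL_def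
            using fin fin3 NLH pair by (intro card_UN_disjoint) blast+
          also have "\<dots> = 3 * card L" using old(3) NLH by simp
          finally have cPL: "card PL = 3 * card L" .
          have "card PH = (\<Sum>m\<in>H. card (up m))" unfolding PH_def
            using fin fin3 NLH pair by (intro card_UN_disjoint) blast+
          also have "\<dots> = 3 * card H" using old(4) NLH by simp
          finally have cPH: "card PH = 3 * card H" .
          show "wins (k + 6 * card J + 720 * M) S2"
          proof (rule pivot_step[of J z r PL S2 PH])
            show "PL \<subseteq> J - {z}"
            proof -
              have "z \<notin> dn m" if "m \<in> L" for m using pair[of z m] zdn that NLH by blast
              then show ?thesis using old(2) NLH unfolding PL_def by blast
            qed
            show "PH \<subseteq> J - {z}"
            proof -
              have "z \<notin> up m" if "m \<in> H" for m using pair[of z m] zdn that NLH by blast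
              then show ?thesis using old(2) NLH unfolding PH_def by blast
            qed
            show "\<forall>y\<in>PL. le S2 y z"
            proof
              fix y assume "y \<in> PL"
              then obtain m where m: "m \<in> L" "y \<in> dn m" by (auto simp: PL_def)
              then have "le S2 m z" "m \<in> N" using sp by (auto simp: split_def)
              then show "le S2 y z" using old(5) m(2) le_trans by (cases "y = m") blast+
            qed
            show "\<forall>y\<in>PH. le S2 z y"
            proof
              fix y assume "y \<in> PH"
              then obtain m where m: "m \<in> H" "y \<in> up m" by (auto simp: PH_def)
              then have "le S2 z m" "m \<in> N" using sp by (auto simp: split_def)
              then show "le S2 z y" using old(6) m(2) le_trans by (cases "y = m") blast+
            qed
            show "PL \<inter> PH = {}" unfolding PL_def PH_def using pair NLH by blast
            have bounds: "card J \<le> M + 1 + card PL" "card J \<le> M + 1 + card PH"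
            proof -
              have "card J \<le> M + 1 + 3 * (s - 1 - s div 2)" by (simp add: M_def)
              moreover have "s - 1 - s div 2 \<le> s div 2" by linarith
              ultimately show "card J \<le> M + 1 + card PL" "card J \<le> M + 1 + card PH"
                using cPL cPH L H by linarith+
            qed
            show "card J \<le> M + 1 + card PL" "card J \<le> M + 1 + card PH" by (fact bounds)+
            fix J' assume "J' \<subset> J"
            then show "selects 720 J'" using less.prems finJ by (intro less.hyps psubset_card_mono) auto
          next
            fix S' z L H assume "S' \<subseteq> S2" "split S' J z L H" "card L = r"
            then show "wins k S'" using cont S1 S2 by blast
          qed (use NJ zdn less.prems r in auto)
        qed
        then show "wins (k + 6 * card J + 720 * M + 720 * s) S1" using N by simp
      qed
      moreover have "6 * card J + 720 * M + 720 * s + 150 * s \<le> 720 * card J"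
      proof -
        have "s \<le> 2 * (s - s div 2)" by simp
        \<comment> \<open>So \<open>M\<close> is about 7/10 and \<open>s\<close> about 1/5 of
          \<open>card J\<close>. The total is near \<open>(6 + 504 + 144 + 30) * card J\<close>, and
          \<open>card J > 120\<close> leaves enough room for the rounding.\<close>
        then have "10 * M + 3 * card J \<le> 10 * card J + 32" using s unfolding M_def by linarith
        then show ?thesis using s False by linarith
      qed
      ultimately show "wins (k + 720 * card J) S" by (elim budget_mono) simp
    qed
  qed
qed

end

section \<open>Opposite pairs\<close>

text \<open>In the application, \<open>v s x\<close> says that \<open>x\<close> is in the majority
  class of the coloring \<open>s\<close>, and \<open>D\<close> consists of the colorings with one
  fixed split of \<open>W\<close>. A comparison is informative within \<open>D\<close> only; nothing
  is claimed about the other colorings in \<open>S\<close>.\<close>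

definition le_on :: "('s \<Rightarrow> 'e \<Rightarrow> bool) \<Rightarrow> 's set \<Rightarrow> 's set \<Rightarrow> 'e \<Rightarrow> 'e \<Rightarrow> bool" where
  "le_on v D S x y \<longleftrightarrow> (\<forall>s\<in>S \<inter> D. v s x \<longrightarrow> v s y)"

definition opposite_on :: "('s \<Rightarrow> 'e \<Rightarrow> bool) \<Rightarrow> 's set \<Rightarrow> 's set \<Rightarrow> 'e \<Rightarrow> 'e \<Rightarrow> bool" where
  "opposite_on v D S x y \<longleftrightarrow> (\<forall>s\<in>S \<inter> D. v s x \<noteq> v s y)"

definition undetermined :: "('s \<Rightarrow> 'e \<Rightarrow> bool) \<Rightarrow> 's set \<Rightarrow> 'e set \<Rightarrow> 's set \<Rightarrow> 'e set" where
  "undetermined v D I S = {x \<in> I. (\<exists>s\<in>S \<inter> D. v s x) \<and> (\<exists>s\<in>S \<inter> D. \<not> v s x)}"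

definition tied_on :: "('s \<Rightarrow> 'e \<Rightarrow> bool) \<Rightarrow> 's set \<Rightarrow> 's set \<Rightarrow> 'e \<Rightarrow> 'e \<Rightarrow> bool" where
  "tied_on v D S x y \<longleftrightarrow> (\<forall>s\<in>S \<inter> D. v s x = v s y) \<or> opposite_on v D S x y"

text \<open>Comparing two balls takes two queries and may reveal no more than that exactly one of
  them is in the class. The assumption \<open>collapsed\<close> is the exit: if every undetermined
  ball is tied to \<open>x\<close>, the single bit of \<open>x\<close> fixes the class on
  \<open>I\<close>.\<close>

locale boolean_game =
  fixes I :: "'e set" and v :: "'s \<Rightarrow> 'e \<Rightarrow> bool" and D :: "'s set" and wins :: "nat \<Rightarrow> 's set \<Rightarrow> bool"
  assumes finite_I: "finite I"
    and wins_mono: "wins k S \<Longrightarrow> k \<le> k' \<Longrightarrow> wins k' S"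
    and compare: "x \<in> I \<Longrightarrow> y \<in> I \<Longrightarrow> x \<noteq> y \<Longrightarrow>
      (\<And>S'. S' \<subseteq> S \<Longrightarrow> le_on v D S' x y \<or> le_on v D S' y x \<or> opposite_on v D S' x y \<Longrightarrow> wins k S') \<Longrightarrow>
      wins (k + 2) S"
    and collapsed: "x \<in> I \<Longrightarrow> \<forall>y\<in>undetermined v D I S. tied_on v D S x y \<Longrightarrow> wins k S"
begin

abbreviation "und \<equiv> undetermined v D I"
abbreviation "lt \<equiv> le_on v D"
abbreviation "opp \<equiv> opposite_on v D"
abbreviation "tied \<equiv> tied_on v D"

lemma und_subset: "S' \<subseteq> S \<Longrightarrow> und S' \<subseteq> und S"
  unfolding undetermined_def by blast

lemma finite_und: "finite (und S)"
  using finite_I by (simp add: undetermined_def)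

lemma opp_subset: "opp S x y \<Longrightarrow> S' \<subseteq> S \<Longrightarrow> opp S' x y"
  unfolding opposite_on_def by blast

lemma tied_subset: "tied S x y \<Longrightarrow> S' \<subseteq> S \<Longrightarrow> tied S' x y"
  unfolding tied_on_def opposite_on_def by blast

lemma tied_und: "tied S x y \<Longrightarrow> x \<in> I \<Longrightarrow> y \<in> I \<Longrightarrow> x \<in> und S \<longleftrightarrow> y \<in> und S"
  unfolding tied_on_def opposite_on_def undetermined_def by blast

lemma comparable_if_determined:
  assumes "opp S x y" "x \<in> I" "x \<notin> und S" shows "lt S x y \<or> lt S y x"
  using assms unfolding opposite_on_def undetermined_def le_on_def by blast

text \<open>Exactly one of \<open>x\<close> and \<open>y\<close> holds. A ball below both is never
  in the class, a ball above both always is, and a ball between them determines \<open>x\<close> and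
  \<open>y\<close>. What remains is that \<open>p\<close> is opposite to one of them, and hence tied
  to \<open>x\<close>.\<close>

lemma tied_if_undetermined:
  assumes "opp S x y" "x \<in> und S" "p \<in> und S"
    "lt S p x \<or> lt S x p \<or> opp S p x" "lt S p y \<or> lt S y p \<or> opp S p y"
  shows "tied S x p"
proof (rule ccontr)
  assume n: "\<not> tied S x p"
  have "\<not> opp S p x" using n unfolding tied_on_def opposite_on_def by blast
  moreover have "\<not> opp S p y" using n assms(1) unfolding tied_on_def opposite_on_def by blast
  ultimately consider "lt S p x" "lt S p y" | "lt S x p" "lt S y p" | "lt S p x" "lt S y p" | "lt S x p" "lt S p y"
    using assms(4,5) by blast
  then show False
  proof cases
    case 1
    then have "\<forall>s\<in>S \<inter> D. \<not> v s p" using assms(1) unfolding opposite_on_def le_on_def by blast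
    then show False using assms(3) by (simp add: undetermined_def)
  next
    case 2
    then have "\<forall>s\<in>S \<inter> D. v s p" using assms(1) unfolding opposite_on_def le_on_def by blast
    then show False using assms(3) by (simp add: undetermined_def)
  next
    case 3
    then have "\<forall>s\<in>S \<inter> D. v s x" using assms(1) unfolding opposite_on_def le_on_def by blast
    then show False using assms(2) by (simp add: undetermined_def)
  next
    case 4
    then have "\<forall>s\<in>S \<inter> D. \<not> v s x" using assms(1) unfolding opposite_on_def le_on_def by blast
    then show False using assms(2) by (simp add: undetermined_def)
  qed
qed

text \<open>An opposite pair \<open>x, y\<close> is compared with one ball \<open>p\<close> after another, until \<open>x\<close> and \<open>y\<close> are determined.
  Each \<open>p\<close> becomes determined at once, or is tied to \<open>x\<close> and becomes determined together with \<open>x\<close>; so the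
  number of undetermined balls pays for these queries.\<close>
lemma resolve:
  assumes "x \<in> I" "y \<in> I" "x \<noteq> y" "opp S x y" "F \<subseteq> und S - {x, y}" "\<forall>p\<in>F. tied S x p"
    "e + 4 + 8 * card (und S) \<le> b + 4 * card F"
    "\<And>S'. S' \<subseteq> S \<Longrightarrow> lt S' x y \<or> lt S' y x \<Longrightarrow> wins (e + 8 * card (und S')) S'"
  shows "wins b S"
  using assms
\<comment> \<open>In the budget inequality each ball of \<open>F\<close> stands for 4 units already
  spent on it. A ball that becomes determined releases 8 units. If \<open>p\<close> does so alone,
  this covers the 4 units just spent; if \<open>x\<close> does, then \<open>y\<close> and
  \<open>F\<close> follow, and \<open>8 * (card F + 2)\<close> covers everything spent.\<close>
proof (induction "card (und S - F)" arbitrary: S F b rule: less_induct)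
  case less
  note xy = less.prems(1-3) and opp = less.prems(4) and F = less.prems(5,6) and b = less.prems(7) and cont = less.prems(8)
  have finF: "finite F" using F(1) finite_und finite_subset by (metis Diff_subset subset_trans)
  show ?case
  proof (cases "x \<in> und S")
    case False
    have "F = {}"
    proof (rule ccontr)
      assume "F \<noteq> {}"
      then obtain p where "p \<in> F" by auto
      then show False using F False tied_und[of S x p] xy(1) by (auto simp: undetermined_def)
    qed
    then show ?thesis using cont[OF order_refl comparable_if_determined[OF opp xy(1) False]] b
      by (elim wins_mono) simp
  next
    case x: True
    have tied_xy: "tied S x y" using opp by (simp add: tied_on_def)
    then have y: "y \<in> und S" using tied_und xy x by blast
    show ?thesis
    proof (cases "und S \<subseteq> F \<union> {x, y}")
      case True
      have "tied S x x" by (simp add: tied_on_def)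
      then have "\<forall>p\<in>und S. tied S x p" using True F(2) tied_xy by auto
      then show ?thesis using collapsed xy(1) by blast
    next
      case False
      then obtain p where p: "p \<in> und S" "p \<notin> F" "p \<noteq> x" "p \<noteq> y" by auto
      have pI: "p \<in> I" using p by (simp add: undetermined_def)
      have "card (F \<union> {x, y}) \<le> card (und S)" using F x y finite_und by (intro card_mono) auto
      moreover have "card (F \<union> {x, y}) = card F + 2" using F(1) finF xy by (subst card_Un_disjoint) auto
      ultimately have cF: "card F + 2 \<le> card (und S)" by simp
      then have "4 \<le> b" using b by linarith
      \<comment> \<open>Two comparisons, of \<open>p\<close> with \<open>x\<close> and with
        \<open>y\<close>, at 2 units each.\<close>
      define b' where "b' = b - 4"
      have b': "b = b' + 2 + 2" using \<open>4 \<le> b\<close> by (simp add: b'_def)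
      have "wins (b' + 2 + 2) S"
      proof (rule compare[OF pI xy(1) p(3)])
        fix S1 assume S1: "S1 \<subseteq> S" and c1: "lt S1 p x \<or> lt S1 x p \<or> opp S1 p x"
        show "wins (b' + 2) S1"
        proof (rule compare[OF pI xy(2) p(4)])
          fix S2 assume S2: "S2 \<subseteq> S1" and c2: "lt S2 p y \<or> lt S2 y p \<or> opp S2 p y"
          have S2S: "S2 \<subseteq> S" using S1 S2 by simp
          have c1': "lt S2 p x \<or> lt S2 x p \<or> opp S2 p x"
            using c1 S2 unfolding le_on_def opposite_on_def by blast
          have opp2: "opp S2 x y" using opp S2S by (rule opp_subset)
          have tied2: "\<forall>p\<in>F. tied S2 x p" using F(2) tied_subset S2S by blast
          have sub: "und S2 \<subseteq> und S" using S2S by (rule und_subset)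
          have FI: "F \<subseteq> I" using F(1) by (auto simp: undetermined_def)
          have cont2: "wins (e + 8 * card (und S')) S'" if "S' \<subseteq> S2" "lt S' x y \<or> lt S' y x" for S'
            using cont that S2S by blast
          show "wins b' S2"
          proof (cases "x \<in> und S2")
            case False
            have "y \<notin> und S2" using False opp2 xy(1,2) tied_und[of S2 x y] by (simp add: tied_on_def)
            moreover have "\<forall>p\<in>F. p \<notin> und S2" using False tied2 tied_und xy(1) FI by blast
            ultimately have "und S2 \<subseteq> und S - (F \<union> {x, y})" using False sub by blast
            then have "card (und S2) \<le> card (und S - (F \<union> {x, y}))" using finite_und by (intro card_mono) auto
            also have "\<dots> = card (und S) - (card F + 2)"
              using F x y finite_und finF \<open>card (F \<union> {x, y}) = _\<close> by (subst card_Diff_subset) auto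
            finally have "e + 8 * card (und S2) \<le> b'" using b b' cF by simp
            then show ?thesis
              using cont2[OF order_refl comparable_if_determined[OF opp2 xy(1) False]] by (elim wins_mono)
          next
            case x2: True
            have F2: "F \<subseteq> und S2 - {x, y}" using F(1) tied2 tied_und x2 xy(1) FI by blast
            show ?thesis
            proof (cases "p \<in> und S2")
              case False
              have "und S2 - F \<subset> und S - F" using sub False p by blast
              then have lt: "card (und S2 - F) < card (und S - F)" using finite_und by (intro psubset_card_mono) auto
              have "und S2 \<subset> und S" using sub False p by blast
              then have "card (und S2) < card (und S)" using finite_und by (intro psubset_card_mono)
              then have "e + 4 + 8 * card (und S2) \<le> b' + 4 * card F" using b b' by simp
              then show ?thesis using less.hyps[OF lt xy opp2 F2 tied2 _ cont2] by blast
            next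
              case p2: True
              have "tied S2 x p" using tied_if_undetermined[OF opp2 x2 p2 c1' c2] .
              then have tied3: "\<forall>q\<in>insert p F. tied S2 x q" using tied2 by simp
              have F3: "insert p F \<subseteq> und S2 - {x, y}" using F2 p2 p by blast
              have "und S2 - insert p F \<subset> und S - F" using sub p by blast
              then have lt: "card (und S2 - insert p F) < card (und S - F)" using finite_und by (intro psubset_card_mono) auto
              have "card (und S2) \<le> card (und S)" using sub finite_und by (intro card_mono)
              moreover have "card (insert p F) = card F + 1" using p(2) finF by simp
              ultimately have "e + 4 + 8 * card (und S2) \<le> b' + 4 * card (insert p F)" using b b' by simp
              then show ?thesis using less.hyps[OF lt xy opp2 F3 tied3 _ cont2] by blast
            qed
          qed
        qed
      qed
      then show ?thesis using b' by simp
    qed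
  qed
qed

text \<open>The budget is supplemented by 8 units for each undetermined ball. An opposite pair is
  then resolved at the expense of the balls that become determined, and comparisons have constant
  amortized cost.\<close>

sublocale comparisons I "le_on v D" "\<lambda>e S. wins (e + 8 * card (undetermined v D I S)) S"
proof
  show "finite I" by (rule finite_I)
  show "lt S x y \<Longrightarrow> lt S y z \<Longrightarrow> lt S x z" for S x y z unfolding le_on_def by blast
  show "lt S x y \<Longrightarrow> S' \<subseteq> S \<Longrightarrow> lt S' x y" for S S' x y unfolding le_on_def by blast
  show "wins (k + 8 * card (und S)) S \<Longrightarrow> k \<le> k' \<Longrightarrow> wins (k' + 8 * card (und S)) S" for k k' S
    by (elim wins_mono) simp
next
  fix x y S k
  assume xy: "x \<in> I" "y \<in> I"
    and cont: "\<And>S'. S' \<subseteq> S \<Longrightarrow> lt S' x y \<or> lt S' y x \<Longrightarrow> wins (k + 8 * card (und S')) S'"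
  show "wins (k + 6 + 8 * card (und S)) S"
  proof (cases "x = y")
    case True
    then have "lt S x y" by (simp add: le_on_def)
    then show ?thesis using cont[of S] by (auto elim!: wins_mono)
  next
    case False
    have "wins (k + 4 + 8 * card (und S) + 2) S"
    proof (rule compare[OF xy False])
      fix S' assume S': "S' \<subseteq> S" and c: "lt S' x y \<or> lt S' y x \<or> opp S' x y"
      have le: "card (und S') \<le> card (und S)" using und_subset[OF S'] finite_und by (intro card_mono)
      show "wins (k + 4 + 8 * card (und S)) S'"
      proof (cases "lt S' x y \<or> lt S' y x")
        case True
        then show ?thesis using cont[OF S' True] le by (elim wins_mono) simp
      next
        case False
        then have opp: "opp S' x y" using c by blast
        have cont': "wins (k + 8 * card (und S'')) S''" if "S'' \<subseteq> S'" "lt S'' x y \<or> lt S'' y x" for S''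
          using cont that S' by blast
        show ?thesis
          by (rule resolve[OF xy \<open>x \<noteq> y\<close> opp _ _ _ cont', of "{}"]) (use le in auto)
      qed
    qed
    then show ?thesis by (simp add: algebra_simps)
  qed
qed

text \<open>Of the factor 728, selection takes 720 and the initial potential 8.\<close>

lemma median:
  assumes card: "card I = 2 * h + 1"
    and cont: "\<And>S' z H. S' \<subseteq> S \<Longrightarrow> z \<in> H \<Longrightarrow> H \<subseteq> I \<Longrightarrow> card H = h + 1 \<Longrightarrow>
      \<forall>y\<in>H. le_on v D S' z y \<Longrightarrow> \<forall>y\<in>insert z (I - H). le_on v D S' y z \<Longrightarrow> wins k S'"
  shows "wins (k + 728 * card I) S"
proof -
  have "wins (k + 720 * card I + 8 * card (und S)) S"
  proof (rule selectsD[OF selects_linear[OF order_refl]])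
    show "h < card I" using card by simp
    fix S' z L H assume S': "S' \<subseteq> S" and sp: "split S' I z L H" and L: "card L = h"
    have IL: "I = insert z (L \<union> H)" "z \<notin> L \<union> H" "L \<inter> H = {}" using sp by (auto simp: split_def)
    then have fin: "finite L" "finite H" using finite_I by auto
    have "card I = 1 + card L + card H" using IL fin by (simp add: card_Un_disjoint)
    then have H: "card (insert z H) = h + 1" using IL fin L card by simp
    have "I - insert z H = L" using IL by auto
    have "lt S' z z" by (simp add: le_on_def)
    have "wins k S'"
      using cont[OF S' _ _ H] IL sp \<open>lt S' z z\<close> \<open>I - insert z H = L\<close> by (auto simp: split_def)
    then show "wins (k + 8 * card (und S')) S'" by (rule wins_mono) simp
  qed
  moreover have "card (und S) \<le> card I" using finite_I by (intro card_mono) (auto simp: undetermined_def)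
  ultimately show ?thesis by (elim wins_mono) simp
qed

end

section \<open>Solving the search problems\<close>

definition rest :: "nat set \<Rightarrow> (nat \<Rightarrow> nat set) \<Rightarrow> nat \<Rightarrow> nat set" where
  "rest Y W i = Y - (\<Union>j<i. W j)"

definition stages :: "nat set \<Rightarrow> nat \<Rightarrow> nat \<Rightarrow> (nat \<Rightarrow> nat set) \<Rightarrow> (nat \<Rightarrow> nat) set \<Rightarrow> bool" where
  "stages Y w m W S \<longleftrightarrow>
     (\<forall>i<m. W i \<subseteq> rest Y W i \<and> card (W i) = w \<and> (\<forall>g\<in>S. staged g (W i) (rest Y W (Suc i))))"

lemma rest_Suc: "rest Y W (Suc i) = rest Y W i - W i"
  by (auto simp: rest_def lessThan_Suc)

lemma rest_antimono: "i \<le> j \<Longrightarrow> rest Y W j \<subseteq> rest Y W i"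
  by (auto simp: rest_def)

lemma card_rest:
  assumes "finite Y" "\<forall>i<m. W i \<subseteq> rest Y W i \<and> card (W i) = w"
  shows "card (rest Y W m) = card Y - m * w"
  using assms(2)
proof (induction m)
  case (Suc m)
  have "card (rest Y W (Suc m)) = card (rest Y W m) - card (W m)" unfolding rest_Suc
    using Suc.prems assms(1) by (intro card_Diff_subset) (auto simp: rest_def intro: finite_subset)
  then show ?case using Suc by simp
qed (simp add: rest_def)

lemma stages_disjoint:
  assumes "stages Y w m W S" "i < m" "j < m" "i \<noteq> j" shows "W i \<inter> W j = {}"
proof -
  have "W i \<inter> W j = {}" if "i < j" "j < m" for i j
  proof -
    have "W j \<subseteq> rest Y W j" using assms(1) that by (auto simp: stages_def)
    then show ?thesis using that unfolding rest_def by blast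
  qed
  then show ?thesis using assms by (metis Int_commute linorder_neqE_nat)
qed

lemma (in plurality_game) wins_stages:
  assumes "m * q \<le> card Y" "\<And>S' W. S' \<subseteq> S \<Longrightarrow> stages Y (q - 1) m W S' \<Longrightarrow> wins k S'"
  shows "wins (k + m * ((q + 1) * card Y)) S"
  using assms
proof (induction m arbitrary: k)
  case 0
  show ?case using 0(2)[of S] by (simp add: stages_def)
next
  case (Suc m)
  have "wins (k + (q + 1) * card Y + m * ((q + 1) * card Y)) S"
  proof (rule Suc.IH)
    fix S1 W assume S1: "S1 \<subseteq> S" and W: "stages Y (q - 1) m W S1"
    have "m * (q - 1) \<le> m * q" by simp
    moreover have "q + m * q \<le> card Y" using Suc.prems(1) by simp
    moreover have "card (rest Y W m) = card Y - m * (q - 1)"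
      using card_rest[OF fin, of m W "q - 1"] W unfolding stages_def by simp
    ultimately have c: "q \<le> card (rest Y W m)" by linarith
    have "wins (k + (q + 1) * card (rest Y W m)) S1"
    proof (rule stage[OF _ c])
      show "rest Y W m \<subseteq> Y" by (auto simp: rest_def)
      fix S' V assume S': "S' \<subseteq> S1" and V: "V \<subseteq> rest Y W m" "card V = q - 1"
        and st: "\<forall>g\<in>S'. staged g V (rest Y W m - V)"
      have r: "rest Y (W(m := V)) i = rest Y W i" if "i \<le> m" for i
        using that by (auto simp: rest_def)
      have "stages Y (q - 1) (Suc m) (W(m := V)) S'" unfolding stages_def
      proof (intro allI impI)
        fix i assume "i < Suc m"
        then consider "i < m" | "i = m" by linarith
        then show "(W(m := V)) i \<subseteq> rest Y (W(m := V)) i \<and> card ((W(m := V)) i) = q - 1 \<and>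
          (\<forall>g\<in>S'. staged g ((W(m := V)) i) (rest Y (W(m := V)) (Suc i)))"
        proof cases
          case 1
          then show ?thesis using W S' r[of i] r[of "Suc i"] unfolding stages_def by auto
        next
          case 2
          then show ?thesis using V st r[of m] by (simp add: rest_Suc)
        qed
      qed
      then show "wins k S'" using S' S1 by (intro Suc.prems(2)) auto
    qed
    moreover have "card (rest Y W m) \<le> card Y" using fin by (intro card_mono) (auto simp: rest_def)
    then have "(q + 1) * card (rest Y W m) \<le> (q + 1) * card Y" by (rule mult_le_mono2)
    ultimately show "wins (k + (q + 1) * card Y) S1" by (elim mono) simp
  qed (use Suc.prems in simp)
  then show ?case by (simp add: algebra_simps)
qed

lemma majority_class_if_large:
  assumes "finite Y" "T \<subseteq> Y" "card Y < 2 * card T" "\<forall>x\<in>T. g x = d"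
  shows "majority_class Y g = {x \<in> Y. g x = d}"
proof -
  have "T \<noteq> {}" using assms(3) by auto
  then obtain x where x: "x \<in> T" by auto
  have "card T \<le> color_count g Y d" unfolding color_count_def using assms by (intro card_mono) auto
  then have "x \<in> majority_class Y g" using x assms by (auto simp: majority_class_def majority_ball_def)
  from majority_class_color[OF assms(1) this] show ?thesis using x assms(4) by simp
qed

lemma two_colors_sum:
  assumes "finite Y" "\<forall>x\<in>Y. g x \<in> {s, t}" "s \<noteq> t"
  shows "color_count g Y s + color_count g Y t = card Y"
proof -
  have "Y = {y \<in> Y. g y = s} \<union> {y \<in> Y. g y = t}" using assms(2) by auto
  moreover have "card ({y \<in> Y. g y = s} \<union> {y \<in> Y. g y = t}) = color_count g Y s + color_count g Y t"
    unfolding color_count_def using assms by (intro card_Un_disjoint) auto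
  ultimately show ?thesis by metis
qed

text \<open>The stage of \<open>W 0\<close> sees all of \<open>Y\<close>: if the balls after it
  differ in color, then \<open>Y\<close> has only two colors and, being odd, a majority color.
  Otherwise the balls after \<open>W 0\<close> are all in the majority class, and with them
  \<open>W 1\<close> to \<open>W 4\<close>, while \<open>W 0\<close> may contain none of it; hence
  \<open>1 \<le> i\<close>. The bound \<open>20 * k\<close> makes the balls after all five stages
  more than half of \<open>Y\<close>.\<close>

lemma stages_majority_class:
  assumes fin: "finite Y" and odd: "odd (card Y)" and large: "20 * k < card Y" and k: "k \<ge> 1"
    and st: "stages Y (2 * k) 5 W S" and g: "g \<in> S"
  shows "\<And>i. 1 \<le> i \<Longrightarrow> i < 5 \<Longrightarrow> k \<le> card (majority_class Y g \<inter> W i)"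
    and "rest Y W 5 \<subseteq> majority_class Y g \<or>
      (\<forall>i<5. card (majority_class Y g \<inter> W i) = k) \<and> (\<exists>t. \<forall>x\<in>Y - majority_class Y g. g x = t) \<and>
      majority_class Y g \<noteq> {}"
proof -
  let ?R = "majority_class Y g"
  have W: "W i \<subseteq> rest Y W i" "card (W i) = 2 * k" "staged g (W i) (rest Y W (Suc i))" if "i < 5" for i
    using st g that by (auto simp: stages_def)
  have WY: "W i \<subseteq> Y" "finite (W i)" if "i < 5" for i
    using W(1)[OF that] finite_subset[OF _ fin, of "W i"] by (auto simp: rest_def)
  have c5: "card (rest Y W 5) = card Y - 10 * k" using card_rest[OF fin, of 5 W "2 * k"] W by simp
  have big: "card Y < 2 * card (rest Y W i)" if "i \<le> 5" for i
  proof -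
    have "card (rest Y W 5) \<le> card (rest Y W i)"
      using fin rest_antimono[OF that] by (intro card_mono) (auto simp: rest_def)
    then show ?thesis using c5 large by linarith
  qed
  have mono_rest: "rest Y W i \<subseteq> ?R" if "i \<le> 5" "\<forall>x\<in>rest Y W i. \<forall>y\<in>rest Y W i. g x = g y" for i
  proof -
    have "rest Y W i \<noteq> {}" using big[OF that(1)] by auto
    then obtain x where "x \<in> rest Y W i" by auto
    then have "\<forall>y\<in>rest Y W i. g y = g x" using that(2) by blast
    moreover from majority_class_if_large[OF fin _ big[OF that(1)] this]
    have "?R = {y \<in> Y. g y = g x}" by (simp add: rest_def)
    ultimately show ?thesis by (auto simp: rest_def)
  qed
  have "(\<forall>i. 1 \<le> i \<longrightarrow> i < 5 \<longrightarrow> k \<le> card (?R \<inter> W i)) \<and> (rest Y W 5 \<subseteq> ?R \<or>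
      (\<forall>i<5. card (?R \<inter> W i) = k) \<and> (\<exists>t. \<forall>x\<in>Y - ?R. g x = t) \<and> ?R \<noteq> {})"
  proof (cases "\<forall>x\<in>rest Y W 1. \<forall>y\<in>rest Y W 1. g x = g y")
    case True
    have R: "rest Y W 1 \<subseteq> ?R" by (rule mono_rest[OF _ True]) simp
    have "k \<le> card (?R \<inter> W i)" if "1 \<le> i" "i < 5" for i
    proof -
      have "W i \<subseteq> ?R" using W(1)[OF that(2)] rest_antimono[OF that(1)] R by blast
      then have "?R \<inter> W i = W i" by auto
      then show ?thesis using W(2)[OF that(2)] by simp
    qed
    moreover have "rest Y W 5 \<subseteq> ?R" using R rest_antimono[of 1 5 Y W] by auto
    ultimately show ?thesis by blast
  next
    case False
    have 0: "W 0 \<subseteq> rest Y W 0" "rest Y W 0 = Y" "rest Y W (Suc 0) = Y - W 0"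
      using W(1)[of 0] by (auto simp: rest_def)
    then have Y: "W 0 \<union> rest Y W (Suc 0) = Y" by auto
    have "\<exists>s t. s \<noteq> t \<and> (\<forall>x\<in>W 0 \<union> rest Y W (Suc 0). g x \<in> {s, t}) \<and>
        color_count g (W 0) s = color_count g (W 0) t"
      using W(3)[of 0] False unfolding staged_def One_nat_def by simp
    then obtain s t where s: "s \<noteq> t" "\<forall>x\<in>Y. g x \<in> {s, t}" unfolding Y by (elim exE conjE)
    have sum: "color_count g Y s + color_count g Y t = card Y" using s fin by (intro two_colors_sum) auto
    have "\<exists>\<gamma> \<delta>. {s, t} = {\<gamma>, \<delta>} \<and> \<gamma> \<noteq> \<delta> \<and> card Y < 2 * color_count g Y \<gamma>"
    proof (cases "color_count g Y s < color_count g Y t")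
      case True
      then show ?thesis using sum s by (intro exI[of _ t] exI[of _ s]) auto
    next
      case False
      then have "color_count g Y t < color_count g Y s" using sum odd by (metis even_add linorder_neqE_nat)
      then show ?thesis using sum s by (intro exI[of _ s] exI[of _ t]) auto
    qed
    then obtain \<gamma> \<delta> where \<gamma>: "{s, t} = {\<gamma>, \<delta>}" "\<gamma> \<noteq> \<delta>" "card Y < 2 * color_count g Y \<gamma>" by blast
    have R: "?R = {x \<in> Y. g x = \<gamma>}"
      using \<gamma>(3) fin by (intro majority_class_if_large[of Y "{x \<in> Y. g x = \<gamma>}"]) (auto simp: color_count_def)
    have two: "g x = \<gamma> \<or> g x = \<delta>" if "x \<in> Y" for x using s(2) \<gamma>(1) that by auto
    have RW: "card (?R \<inter> W i) = color_count g (W i) \<gamma>" if "i < 5" for i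
      unfolding color_count_def R using WY[OF that] by (intro arg_cong[of _ _ card]) auto
    have sumW: "color_count g (W i) \<gamma> + color_count g (W i) \<delta> = 2 * k" if "i < 5" for i
      using two_colors_sum[of "W i" g \<gamma> \<delta>] two \<gamma>(2) WY[OF that] W(2)[OF that] by auto
    \<comment> \<open>If the balls after stage \<open>i\<close> have one color, it is the majority
      color and a top color of \<open>W i\<close>; if not, \<open>W i\<close> is balanced.\<close>
    have Wi: "k \<le> card (?R \<inter> W i) \<and> rest Y W 5 \<subseteq> ?R \<or> card (?R \<inter> W i) = k" if i: "i < 5" for i
    proof (cases "\<forall>x\<in>rest Y W (Suc i). \<forall>y\<in>rest Y W (Suc i). g x = g y")
      case True
      have sub: "rest Y W (Suc i) \<subseteq> ?R" by (rule mono_rest[OF _ True]) (use i in simp)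
      have "rest Y W (Suc i) \<noteq> {}" using big[of "Suc i"] i by auto
      then obtain x where x: "x \<in> rest Y W (Suc i)" by auto
      then have "top_color g (W i) \<gamma>" using W(3)[OF i] sub R unfolding staged_def by auto
      then have "color_count g (W i) \<delta> \<le> color_count g (W i) \<gamma>" by (simp add: top_color_def)
      then have "k \<le> card (?R \<inter> W i)" using sumW[OF i] RW[OF i] by simp
      moreover have "rest Y W 5 \<subseteq> ?R" using sub rest_antimono[of "Suc i" 5 Y W] i by auto
      ultimately show ?thesis by blast
    next
      case False
      have "\<exists>s t. s \<noteq> t \<and> (\<forall>x\<in>W i \<union> rest Y W (Suc i). g x \<in> {s, t}) \<and>
          color_count g (W i) s = color_count g (W i) t"
        by (rule disjE[OF conjunct2[OF W(3)[OF i, unfolded staged_def]]]) (erule notE[OF False], assumption)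
      then obtain s' t' where s': "s' \<noteq> t'" "\<forall>x\<in>W i. g x \<in> {s', t'}" "color_count g (W i) s' = color_count g (W i) t'"
        by (elim exE conjE) (simp add: ball_Un)
      then have eq: "color_count g (W i) s' = k" "color_count g (W i) t' = k"
        using two_colors_sum[of "W i" g s' t'] WY[OF i] W(2)[OF i] by auto
      then obtain x y where "x \<in> W i" "g x = s'" "y \<in> W i" "g y = t'"
        using color_count_posD[of g "W i" s'] color_count_posD[of g "W i" t'] k by auto
      moreover from this have "x \<in> Y" "y \<in> Y" using WY(1)[OF i] by auto
      ultimately have "\<gamma> = s' \<or> \<gamma> = t'" using two[of x] two[of y] s'(1) by metis
      then show ?thesis using eq RW[OF i] by auto
    qed
    have "?R \<noteq> {}" using \<gamma>(3) color_count_posD[of g Y \<gamma>] R by auto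
    moreover have "\<forall>x\<in>Y - ?R. g x = \<delta>" using two R by auto
    ultimately show ?thesis using Wi by (metis order_refl)
  qed
  then show "\<And>i. 1 \<le> i \<Longrightarrow> i < 5 \<Longrightarrow> k \<le> card (?R \<inter> W i)"
    and "rest Y W 5 \<subseteq> ?R \<or> (\<forall>i<5. card (?R \<inter> W i) = k) \<and> (\<exists>t. \<forall>x\<in>Y - ?R. g x = t) \<and> ?R \<noteq> {}"
    by blast+
qed

section \<open>A median for each split of a balanced set\<close>

definition balanced_on :: "nat set \<Rightarrow> nat set \<Rightarrow> nat set \<Rightarrow> nat set \<Rightarrow> (nat \<Rightarrow> nat) set" where
  "balanced_on Y V I \<tau> = {g. majority_class Y g \<inter> V = \<tau> \<and> card I < 2 * card (majority_class Y g \<inter> I) \<and>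
     (\<exists>t. \<forall>x\<in>Y - majority_class Y g. g x = t)}"

text \<open>The bit \<open>b\<close> is there for the collapsed game, in which everything
  undetermined is tied to \<open>x\<close>: which balls form the known half then depends on
  \<open>x\<close>.\<close>

definition half_known :: "nat set \<Rightarrow> nat set \<Rightarrow> (nat \<Rightarrow> nat) set \<Rightarrow> (nat \<Rightarrow> nat) set \<Rightarrow> nat \<Rightarrow> bool" where
  "half_known Y I D S x \<longleftrightarrow> x \<in> I \<and> (\<forall>b. \<exists>H\<subseteq>I. card I < 2 * card H \<and>
     (\<forall>g\<in>S \<inter> D. (x \<in> majority_class Y g) = b \<longrightarrow> H \<subseteq> majority_class Y g))"

lemma half_known_subset:
  assumes "half_known Y I D S x" "S' \<subseteq> S" shows "half_known Y I D S' x"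
  unfolding half_known_def
proof (intro conjI allI)
  show "x \<in> I" using assms(1) by (simp add: half_known_def)
  fix b
  obtain H where H: "H \<subseteq> I" "card I < 2 * card H"
    "\<And>g. g \<in> S \<inter> D \<Longrightarrow> (x \<in> majority_class Y g) = b \<Longrightarrow> H \<subseteq> majority_class Y g"
    using conjunct2[OF assms(1)[unfolded half_known_def], rule_format, of b] by auto
  show "\<exists>H\<subseteq>I. card I < 2 * card H \<and>
      (\<forall>g\<in>S' \<inter> D. (x \<in> majority_class Y g) = b \<longrightarrow> H \<subseteq> majority_class Y g)"
  proof (intro exI[of _ H] conjI ballI impI)
    fix g assume "g \<in> S' \<inter> D" "(x \<in> majority_class Y g) = b"
    then show "H \<subseteq> majority_class Y g" using assms(2) by (intro H(3)) auto
  qed (use H in auto)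
qed

text \<open>With only two colors, the plurality color of a query of odd size is its majority
  color.\<close>

lemma plurality_in_majority_class:
  assumes fin: "finite Y" and Q: "Q \<subseteq> Y" "card Q = 2 * k + 1" and a: "plurality_ball g Q a"
    and ne: "majority_class Y g \<noteq> {}" and t: "\<forall>x\<in>Y - majority_class Y g. g x = t"
  shows "a \<in> majority_class Y g \<longleftrightarrow> k < card (majority_class Y g \<inter> Q)"
proof -
  obtain x where "x \<in> majority_class Y g" using ne by auto
  note R = majority_class_color[OF fin this]
  have aQ: "a \<in> Q" using a by (simp add: plurality_ball_def)
  have finQ: "finite Q" using Q(1) fin by (rule finite_subset)
  have RQ: "card (majority_class Y g \<inter> Q) = color_count g Q (g x)"
    unfolding color_count_def R using Q(1) by (intro arg_cong[of _ _ card]) auto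
  show ?thesis
  proof (cases "a \<in> majority_class Y g")
    case True
    then have ga: "g a = g x" using R by simp
    have "k < color_count g Q (g x)"
    \<comment> \<open>If the majority class is all of \<open>Y\<close>, then \<open>t\<close> is
      arbitrary and may be the majority color itself.\<close>
    proof (cases "t = g x")
      case True
      have "g y = g x" if "y \<in> Q" for y
      proof (cases "y \<in> majority_class Y g")
        case True
        then show ?thesis using R by simp
      next
        case False
        then show ?thesis using t that Q(1) \<open>t = g x\<close> by auto
      qed
      then have "{y \<in> Q. g y = g x} = Q" by auto
      then show ?thesis using Q(2) by (simp add: color_count_def)
    next
      case False
      have "color_count g Q t < color_count g Q (g x)" using a False ga by (simp add: plurality_ball_def)
      moreover have "\<forall>y\<in>Q. g y \<in> {g x, t}" using R t Q(1) by blast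
      then have "color_count g Q (g x) + color_count g Q t = card Q"
        using False finQ by (intro two_colors_sum) auto
      ultimately show ?thesis using Q(2) by linarith
    qed
    then show ?thesis using True RQ by simp
  next
    case False
    have neq: "g a \<noteq> g x" using False R aQ Q(1) by auto
    then have "color_count g Q (g x) < color_count g Q (g a)" using a by (simp add: plurality_ball_def)
    moreover have "color_count g Q (g x) + color_count g Q (g a) \<le> card Q"
      using neq finQ by (intro color_count_add_le) auto
    ultimately have "\<not> k < color_count g Q (g x)" using Q(2) by linarith
    then show ?thesis using False RQ by simp
  qed
qed

text \<open>The query \<open>V - {w} \<union> {x, y}\<close> has \<open>2 * k + 1\<close> balls, and
  its part in \<open>V\<close> contains \<open>k\<close> or \<open>k - 1\<close> balls of the
  majority class. For \<open>w\<close> outside \<open>\<tau>\<close> the answer is in the class iff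
  \<open>x\<close> or \<open>y\<close> is; for \<open>w\<close> in \<open>\<tau>\<close> iff both
  are. An answer in \<open>V\<close> reveals the value of this disjunction or conjunction, and an
  answer \<open>x\<close> or \<open>y\<close> equates it with one of its arguments, which gives an
  order.\<close>

lemma (in plurality_game) wins_compare:
  assumes q: "q = 2 * k + 1" "k \<ge> 1" and V: "V \<subseteq> Y" "I \<subseteq> Y" "V \<inter> I = {}" "card V = 2 * k"
    and \<tau>: "\<tau> \<subseteq> V" "card \<tau> = k" and xy: "x \<in> I" "y \<in> I" "x \<noteq> y"
  defines "v \<equiv> \<lambda>g x. x \<in> majority_class Y g" and "D \<equiv> balanced_on Y V I \<tau>"
  assumes cont: "\<And>S'. S' \<subseteq> S \<Longrightarrow> le_on v D S' x y \<or> le_on v D S' y x \<or> opposite_on v D S' x y \<Longrightarrow> wins j S'"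
  shows "wins (j + 2) S"
proof -
  have "finite V" using V(1) fin by (rule finite_subset)
  moreover then have "finite \<tau>" by (rule finite_subset[OF \<tau>(1)])
  ultimately have finV: "finite V" "finite \<tau>" by simp_all
  have "card (V - \<tau>) = k" using \<tau> finV V(4) by (simp add: card_Diff_subset)
  then have "card (V - \<tau>) \<noteq> 0" "card \<tau> \<noteq> 0" using \<tau>(2) q(2) by simp_all
  then have "V - \<tau> \<noteq> {}" "\<tau> \<noteq> {}" by (metis card.empty)+
  then obtain \<alpha> \<beta> where \<alpha>: "\<alpha> \<in> V" "\<alpha> \<notin> \<tau>" and \<beta>: "\<beta> \<in> \<tau>" by blast
  define Q where "Q w = insert x (insert y (V - {w}))" for w
  have notV: "x \<notin> V" "y \<notin> V" using xy V(3) by auto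
  have Q: "Q w \<subseteq> Y" "card (Q w) = q" if "w \<in> V" for w
    using that notV xy V finV q by (auto simp: Q_def)
  have vote: "v g a \<longleftrightarrow> k < card (\<tau> - {w}) + (if v g x then 1 else 0) + (if v g y then 1 else 0)"
    if a: "plurality_ball g (Q w) a" and g: "g \<in> D" and w: "w \<in> V" for g a w
  proof -
    let ?R = "majority_class Y g"
    have R: "?R \<inter> V = \<tau>" "?R \<noteq> {}" using g by (auto simp: D_def balanced_on_def)
    obtain t where "\<forall>x\<in>Y - ?R. g x = t" using g by (auto simp: D_def balanced_on_def)
    note vg = plurality_in_majority_class[OF fin Q(1)[OF w] _ a R(2) this, of k]
    have "?R \<inter> Q w = (\<tau> - {w}) \<union> (if v g x then {x} else {}) \<union> (if v g y then {y} else {})"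
      using R(1) by (auto simp: Q_def v_def)
    moreover have "x \<notin> \<tau>" "y \<notin> \<tau>" using notV \<tau>(1) by auto
    ultimately have "card (?R \<inter> Q w) = card (\<tau> - {w}) + (if v g x then 1 else 0) + (if v g y then 1 else 0)"
      using finV(2) xy(3) by auto
    then show ?thesis using vg Q(2)[OF w] q(1) by (simp add: v_def)
  qed
  have \<tau>\<alpha>: "card (\<tau> - {\<alpha>}) = k" using \<alpha> \<tau> by simp
  have \<tau>\<beta>: "card (\<tau> - {\<beta>}) = k - 1" using \<beta> \<tau> finV by simp
  have "wins (Suc (Suc j)) S"
  proof (rule ask[OF Q[OF \<alpha>(1)]])
    fix a S1 assume a: "a \<in> Q \<alpha>" "S1 \<subseteq> S" "\<forall>g\<in>S1. plurality_ball g (Q \<alpha>) a"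
    have \<beta>V: "\<beta> \<in> V" using \<beta> \<tau> by auto
    show "wins (Suc j) S1"
    proof (rule ask[OF Q[OF \<beta>V]])
      fix b S2 assume b: "b \<in> Q \<beta>" "S2 \<subseteq> S1" "\<forall>g\<in>S2. plurality_ball g (Q \<beta>) b"
      have max: "v g a \<longleftrightarrow> v g x \<or> v g y" if "g \<in> S2 \<inter> D" for g
        using vote[of g \<alpha> a] a(3) b(2) that \<alpha> \<tau>\<alpha> by (auto split: if_splits)
      have min: "v g b \<longleftrightarrow> v g x \<and> v g y" if "g \<in> S2 \<inter> D" for g
        using vote[of g \<beta> b] b(3) that \<beta>V \<tau>\<beta> q(2) by (auto split: if_splits)
      have onV: "v g w \<longleftrightarrow> w \<in> \<tau>" if "g \<in> S2 \<inter> D" "w \<in> V" for g w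
        using that by (auto simp: v_def D_def balanced_on_def)
      have "le_on v D S2 x y \<or> le_on v D S2 y x \<or> opposite_on v D S2 x y"
      proof (cases "a \<in> V \<and> b \<in> V")
        case True
        show ?thesis
        \<comment> \<open>A true disjunction with a false conjunction means that exactly one of
          \<open>x\<close> and \<open>y\<close> is in the class. Otherwise the two values
          agree.\<close>
        proof (cases "a \<in> \<tau> \<and> b \<notin> \<tau>")
          case T: True
          have "v g x \<noteq> v g y" if "g \<in> S2 \<inter> D" for g
            using max[OF that] min[OF that] onV[OF that] True T by blast
          then show ?thesis by (simp add: opposite_on_def)
        next
          case F: False
          have "v g x \<longrightarrow> v g y" if "g \<in> S2 \<inter> D" for g
            using max[OF that] min[OF that] onV[OF that] True F by blast
          then show ?thesis by (simp add: le_on_def)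
        qed
      next
        case False
        then consider "a = x" | "a = y" | "b = x" | "b = y" using a(1) b(1) by (auto simp: Q_def)
        then show ?thesis
        proof cases
          case 1
          then have "v g y \<longrightarrow> v g x" if "g \<in> S2 \<inter> D" for g using max[OF that] by blast
          then show ?thesis by (simp add: le_on_def)
        next
          case 2
          then have "v g x \<longrightarrow> v g y" if "g \<in> S2 \<inter> D" for g using max[OF that] by blast
          then show ?thesis by (simp add: le_on_def)
        next
          case 3
          then have "v g x \<longrightarrow> v g y" if "g \<in> S2 \<inter> D" for g using min[OF that] by blast
          then show ?thesis by (simp add: le_on_def)
        next
          case 4
          then have "v g y \<longrightarrow> v g x" if "g \<in> S2 \<inter> D" for g using min[OF that] by blast
          then show ?thesis by (simp add: le_on_def)
        qed
      qed
      then show "wins j S2" using cont a(2) b(2) by (meson subset_trans)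
    qed
  qed
  then show ?thesis by simp
qed

text \<open>A \<open>boolean_game\<close> on membership in the majority class. A median
  \<open>z\<close> of \<open>I\<close> must be in the class, as otherwise at most \<open>h\<close>
  balls of \<open>I\<close> would be; and with \<open>z\<close> all \<open>h + 1\<close> balls of
  \<open>H\<close> are.\<close>

lemma (in plurality_game) wins_half_known:
  assumes q: "q = 2 * k + 1" "k \<ge> 1" and V: "V \<subseteq> Y" "I \<subseteq> Y" "V \<inter> I = {}" "card V = 2 * k"
    and I: "card I = 2 * h + 1" and \<tau>: "\<tau> \<subseteq> V" "card \<tau> = k"
    and cont: "\<And>S' x. S' \<subseteq> S \<Longrightarrow> half_known Y I (balanced_on Y V I \<tau>) S' x \<Longrightarrow> wins j S'"
  shows "wins (j + 728 * card I) S"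
proof -
  define v where "v = (\<lambda>g x. x \<in> majority_class Y g)"
  define D where "D = balanced_on Y V I \<tau>"
  have finI: "finite I" using V(2) fin by (rule finite_subset)
  have half: "card I < 2 * card {x \<in> I. v g x}" if "g \<in> D" for g
  proof -
    have "{x \<in> I. v g x} = majority_class Y g \<inter> I" by (auto simp: v_def)
    then show ?thesis using that by (simp add: D_def balanced_on_def)
  qed
  have cont': "wins j S'" if "S' \<subseteq> S" "x \<in> I"
    "\<And>b. \<exists>H\<subseteq>I. card I < 2 * card H \<and> (\<forall>g\<in>S' \<inter> D. v g x = b \<longrightarrow> (\<forall>y\<in>H. v g y))" for S' x
  proof (rule cont[OF that(1), of x])
    have "\<exists>H\<subseteq>I. card I < 2 * card H \<and> (\<forall>g\<in>S' \<inter> D. (x \<in> majority_class Y g) = b \<longrightarrow> H \<subseteq> majority_class Y g)" for b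
      using that(3)[of b] unfolding v_def subset_eq[of _ "majority_class _ _"] .
    then show "half_known Y I (balanced_on Y V I \<tau>) S' x" using that(2) by (simp add: half_known_def D_def)
  qed
  \<comment> \<open>The continuation, with its budget \<open>j\<close>, is available for subsets of
    \<open>S\<close> only; hence the guard.\<close>
  interpret boolean_game I v D "\<lambda>e S'. S' \<subseteq> S \<longrightarrow> wins (j + e) S'"
  proof
    show "finite I" by (rule finI)
  next
    fix e e' S' assume "S' \<subseteq> S \<longrightarrow> wins (j + e) S'" "e \<le> e'"
    then show "S' \<subseteq> S \<longrightarrow> wins (j + e') S'" using mono[of "j + e" S' "j + e'"] by simp
  next
    fix x y S1 e assume xy: "x \<in> I" "y \<in> I" "x \<noteq> y"
      and c: "\<And>S'. S' \<subseteq> S1 \<Longrightarrow> le_on v D S' x y \<or> le_on v D S' y x \<or> opposite_on v D S' x y \<Longrightarrow>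
        S' \<subseteq> S \<longrightarrow> wins (j + e) S'"
    show "S1 \<subseteq> S \<longrightarrow> wins (j + (e + 2)) S1"
    proof
      assume S1: "S1 \<subseteq> S"
      have "wins (j + e + 2) S1"
      proof (rule wins_compare[OF q V \<tau> xy])
        fix S' assume "S' \<subseteq> S1" "le_on (\<lambda>g x. x \<in> majority_class Y g) (balanced_on Y V I \<tau>) S' x y \<or>
          le_on (\<lambda>g x. x \<in> majority_class Y g) (balanced_on Y V I \<tau>) S' y x \<or>
          opposite_on (\<lambda>g x. x \<in> majority_class Y g) (balanced_on Y V I \<tau>) S' x y"
        then show "wins (j + e) S'" using c[of S'] S1 unfolding v_def D_def by auto
      qed
      then show "wins (j + (e + 2)) S1" by (simp add: algebra_simps)
    qed
  next
    fix x S1 e assume x: "x \<in> I" and t: "\<forall>y\<in>undetermined v D I S1. tied_on v D S1 x y"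
    show "S1 \<subseteq> S \<longrightarrow> wins (j + e) S1"
    proof
      assume S1: "S1 \<subseteq> S"
      have "wins j S1"
      proof (rule cont'[OF S1 x])
        fix b
        show "\<exists>H\<subseteq>I. card I < 2 * card H \<and> (\<forall>g\<in>S1 \<inter> D. v g x = b \<longrightarrow> (\<forall>y\<in>H. v g y))"
        \<comment> \<open>A coloring \<open>g0\<close> with the bit \<open>b\<close> serves as a
          template: determined balls always agree with it, and undetermined ones do because of their
          tie to \<open>x\<close>.\<close>
        proof (cases "\<exists>g0\<in>S1 \<inter> D. v g0 x = b")
          case True
          then obtain g0 where g0: "g0 \<in> S1 \<inter> D" "v g0 x = b" by blast
          have "v g y" if g: "g \<in> S1 \<inter> D" "v g x = b" and y: "y \<in> I" "v g0 y" for g y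
          proof (cases "y \<in> undetermined v D I S1")
            case True
            then have "tied_on v D S1 x y" using t by blast
            then have "(v g x = v g y) = (v g0 x = v g0 y)"
              using g(1) g0(1) unfolding tied_on_def opposite_on_def by blast
            then show ?thesis using g g0 y by auto
          next
            case False
            then show ?thesis using g(1) g0(1) y unfolding undetermined_def by blast
          qed
          then show ?thesis using half[of g0] g0 by (intro exI[of _ "{y \<in> I. v g0 y}"]) auto
        next
          case False
          then show ?thesis using I by (intro exI[of _ I]) auto
        qed
      qed
      then show "wins (j + e) S1" by (rule mono) simp
    qed
  qed
  have "S \<subseteq> S \<longrightarrow> wins (j + (0 + 728 * card I)) S"
  proof (rule median[OF I])
    fix S' z H assume S': "S' \<subseteq> S" and H: "z \<in> H" "H \<subseteq> I" "card H = h + 1"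
      and le: "\<forall>y\<in>H. le_on v D S' z y" "\<forall>y\<in>insert z (I - H). le_on v D S' y z"
    have "v g y" if g: "g \<in> S' \<inter> D" and y: "y \<in> H" for g y
    proof -
      have "v g z"
      proof (rule ccontr)
        assume n: "\<not> v g z"
        then have "{x \<in> I. v g x} \<subseteq> H - {z}" using le(2) g H unfolding le_on_def by blast
        then have "card {x \<in> I. v g x} \<le> card (H - {z})" using H finI finite_subset by (intro card_mono) auto
        also have "\<dots> = h" using H finI finite_subset by auto
        finally show False using half[of g] g I by auto
      qed
      then show ?thesis using le(1) g y unfolding le_on_def by blast
    qed
    then have "wins j S'" using H I
      by (intro cont'[OF S', of z]) (auto intro!: exI[of _ H])
    then show "S' \<subseteq> S \<longrightarrow> wins (j + 0) S'" by simp
  qed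
  then show ?thesis by simp
qed

section \<open>Combining the medians of all splits\<close>

lemma (in plurality_game) wins_all_half_known:
  assumes q: "q = 2 * k + 1" "k \<ge> 1" and V: "V \<subseteq> Y" "I \<subseteq> Y" "V \<inter> I = {}" "card V = 2 * k"
    and I: "card I = 2 * h + 1" and T: "finite T" "\<forall>\<tau>\<in>T. \<tau> \<subseteq> V \<and> card \<tau> = k"
    and cont: "\<And>S'. S' \<subseteq> S \<Longrightarrow> \<forall>\<tau>\<in>T. \<exists>x. half_known Y I (balanced_on Y V I \<tau>) S' x \<Longrightarrow> wins j S'"
  shows "wins (j + card T * (728 * card I)) S"
  using T cont
proof (induction T arbitrary: S)
  case empty
  then show ?case by simp
next
  case (insert \<tau> T)
  have "wins (j + card T * (728 * card I) + 728 * card I) S"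
  proof (rule wins_half_known[OF q V I])
    show "\<tau> \<subseteq> V" "card \<tau> = k" using insert.prems(1) by auto
    fix S1 x assume S1: "S1 \<subseteq> S" "half_known Y I (balanced_on Y V I \<tau>) S1 x"
    show "wins (j + card T * (728 * card I)) S1"
    proof (rule insert.IH)
      fix S' assume S': "S' \<subseteq> S1" and hk: "\<forall>\<tau>\<in>T. \<exists>x. half_known Y I (balanced_on Y V I \<tau>) S' x"
      have "half_known Y I (balanced_on Y V I \<tau>) S' x" using S1(2) S' by (rule half_known_subset)
      then have "\<forall>\<tau>\<in>insert \<tau> T. \<exists>x. half_known Y I (balanced_on Y V I \<tau>) S' x" using hk by blast
      then show "wins j S'" using S' S1(1) by (intro insert.prems(2)) auto
    qed (use insert.prems(1) in simp)
  qed
  then show ?case using insert.hyps by (simp add: algebra_simps)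
qed

text \<open>If all colorings with trace \<open>A\<close> have \<open>rest Y W 5\<close> in their
  majority class, this set is large enough. Otherwise \<open>A\<close> has \<open>k\<close> balls in
  each \<open>W i\<close>, exactly half of it, and tells both the split of \<open>W 4\<close> and
  the bit of \<open>xs \<tau>\<close>. By \<open>half_known\<close> these two fix more than half of
  the rest.\<close>

lemma (in plurality_game) common_large:
  assumes k: "k \<ge> 1" "20 * k < card Y" "odd (card Y)" and st: "stages Y (2 * k) 5 W S"
    and xs: "\<And>\<tau>. \<tau> \<subseteq> W 4 \<Longrightarrow> card \<tau> = k \<Longrightarrow>
      half_known Y (rest Y W 5) (balanced_on Y (W 4) (rest Y W 5) \<tau>) S (xs \<tau>)"
    and C: "(\<Union>i<5. W i) \<subseteq> C" "\<And>\<tau>. \<tau> \<subseteq> W 4 \<Longrightarrow> card \<tau> = k \<Longrightarrow> xs \<tau> \<in> C"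
    and A: "A \<subseteq> C"
  shows "card Y < 2 * card (common Y C S A)"
proof -
  let ?I = "rest Y W 5" and ?R = "majority_class Y"
  have W: "W i \<subseteq> rest Y W i" "card (W i) = 2 * k" if "i < 5" for i
    using st that by (auto simp: stages_def)
  have WY: "W i \<subseteq> Y" if "i < 5" for i using W(1)[OF that] by (auto simp: rest_def)
  have IY: "?I \<subseteq> Y" by (auto simp: rest_def)
  have fins: "finite ?I" "finite (common Y C S A)"
    using finite_subset[OF IY fin] finite_subset[OF common_subset fin] by auto
  have c5: "card ?I = card Y - 10 * k" using card_rest[OF fin, of 5 W "2 * k"] W by simp
  have split_card: "card (B \<inter> (\<Union>i<5. W i)) = (\<Sum>i<5. card (B \<inter> W i))" for B
  proof -
    have "card (\<Union>i<5. B \<inter> W i) = (\<Sum>i<5. card (B \<inter> W i))"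
    proof (rule card_UN_disjoint)
      show "\<forall>i\<in>{..<5}. finite (B \<inter> W i)" using finite_subset[OF WY fin] by simp
      show "\<forall>i\<in>{..<5}. \<forall>j\<in>{..<5}. i \<noteq> j \<longrightarrow> B \<inter> W i \<inter> (B \<inter> W j) = {}"
      proof (intro ballI impI)
        fix i j :: nat assume "i \<in> {..<5}" "j \<in> {..<5}" "i \<noteq> j"
        then have "W i \<inter> W j = {}" using stages_disjoint[OF st, of i j] by simp
        then show "B \<inter> W i \<inter> (B \<inter> W j) = {}" by blast
      qed
    qed simp
    then show ?thesis unfolding Int_UN_distrib .
  qed
  have Y: "Y = ?I \<union> (\<Union>i<5. W i)" "?I \<inter> (\<Union>i<5. W i) = {}" using WY by (auto simp: rest_def)
  show ?thesis
  proof (cases "\<forall>g\<in>S. ?R g \<inter> C = A \<longrightarrow> ?I \<subseteq> ?R g")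
    case True
    then have "?I \<subseteq> common Y C S A" using IY by (auto simp: common_def)
    then have "card ?I \<le> card (common Y C S A)" using fins by (intro card_mono)
    then show ?thesis using c5 k(2) by linarith
  next
    case False
    then obtain g0 where g0: "g0 \<in> S" "?R g0 \<inter> C = A" "\<not> ?I \<subseteq> ?R g0" by auto
    note N = stages_majority_class(2)[OF fin k(3,2,1) st]
    have AW: "card (A \<inter> W i) = k" if "i < 5" for i
    proof -
      have "A \<inter> W i = ?R g0 \<inter> W i" using g0(2) C(1) that by auto
      then show ?thesis using N[OF g0(1)] g0(3) that by auto
    qed
    define \<tau> where "\<tau> = A \<inter> W 4"
    have \<tau>: "\<tau> \<subseteq> W 4" "card \<tau> = k" using AW[of 4] by (auto simp: \<tau>_def)
    obtain H where H: "H \<subseteq> ?I" "card ?I < 2 * card H"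
      "\<And>g. g \<in> S \<inter> balanced_on Y (W 4) ?I \<tau> \<Longrightarrow> (xs \<tau> \<in> ?R g) = (xs \<tau> \<in> A) \<Longrightarrow> H \<subseteq> ?R g"
      using conjunct2[OF xs[OF \<tau>, unfolded half_known_def], rule_format, of "xs \<tau> \<in> A"] by auto
    have HR: "H \<subseteq> ?R g" if g: "g \<in> S" "?R g \<inter> C = A" for g
    proof (cases "?I \<subseteq> ?R g")
      case True
      then show ?thesis using H(1) by auto
    next
      case False
      then have n: "\<forall>i<5. card (?R g \<inter> W i) = k" "\<exists>t. \<forall>x\<in>Y - ?R g. g x = t" "?R g \<noteq> {}"
        using N[OF g(1)] by auto
      obtain x where x: "x \<in> ?R g" using n(3) by auto
      have "card Y < 2 * card (?R g)"
        using x majority_class_color[OF fin x] by (auto simp: majority_class_def majority_ball_def color_count_def)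
      moreover have "?R g = (?R g \<inter> ?I) \<union> (?R g \<inter> (\<Union>i<5. W i))"
        using Y(1) by (auto simp: majority_class_def)
      then have "card (?R g) \<le> card (?R g \<inter> ?I) + card (?R g \<inter> (\<Union>i<5. W i))" by (metis card_Un_le)
      moreover have "card (?R g \<inter> (\<Union>i<5. W i)) = 5 * k" using split_card n(1) by simp
      \<comment> \<open>The class has more than half of \<open>Y\<close> but just half of the five
        sets, so it has more than half of the rest.\<close>
      ultimately have "card ?I < 2 * card (?R g \<inter> ?I)" using c5 k(2) by linarith
      moreover have "W 4 \<subseteq> C" by (rule order_trans[OF UN_upper C(1)]) simp
      then have "?R g \<inter> W 4 = \<tau>" using g(2) by (auto simp: \<tau>_def)
      ultimately have "g \<in> balanced_on Y (W 4) ?I \<tau>" using n(2) by (simp add: balanced_on_def)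
      then show ?thesis using H(3)[of g] g C(2)[OF \<tau>] by auto
    qed
    have "A \<inter> (\<Union>i<5. W i) \<subseteq> Y" "H \<subseteq> Y" using Y(1) H(1) IY by blast+
    then have "H \<union> (A \<inter> (\<Union>i<5. W i)) \<subseteq> common Y C S A"
      using HR unfolding common_def by blast
    then have "card (H \<union> (A \<inter> (\<Union>i<5. W i))) \<le> card (common Y C S A)" using fins by (intro card_mono)
    moreover have "card (H \<union> (A \<inter> (\<Union>i<5. W i))) = card H + card (A \<inter> (\<Union>i<5. W i))"
    proof (rule card_Un_disjoint)
      show "finite H" using H(1) fins(1) by (rule finite_subset)
      show "finite (A \<inter> (\<Union>i<5. W i))" using WY fin by (intro finite_subset[OF _ fin]) auto
      show "H \<inter> (A \<inter> (\<Union>i<5. W i)) = {}" using H(1) Y(2) by auto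
    qed
    moreover have "card (A \<inter> (\<Union>i<5. W i)) = 5 * k" using split_card AW by simp
    ultimately show ?thesis using H(2) c5 k(2) by linarith
  qed
qed

text \<open>\<open>C\<close> consists of the five sets, \<open>10 * k\<close> balls, and of one ball
  \<open>xs \<tau>\<close> for each split of \<open>W 4\<close>, at most \<open>2 ^ (2 * k)\<close>
  balls. Each of the \<open>2 ^ card C\<close> families can be enlarged at most
  \<open>card Y\<close> times. The other terms pay for one median per split and for five
  stages.\<close>

lemma (in plurality_game) wins_odd:
  assumes k: "q = 2 * k + 1" "k \<ge> 1" "20 * k + 5 < card Y" "odd (card Y)"
  shows "wins ((2 ^ (10 * k + 2 ^ (2 * k)) + 728 * 2 ^ (2 * k) + 5 * (q + 1)) * card Y) S"
proof -
  let ?B = "10 * k + 2 ^ (2 * k) :: nat"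
  have "wins (2 ^ ?B * card Y + 2 ^ (2 * k) * (728 * card Y) + 5 * ((q + 1) * card Y)) S"
  proof (rule wins_stages)
    show "5 * q \<le> card Y" using k by simp
    fix S1 W assume S1: "S1 \<subseteq> S" and st: "stages Y (q - 1) 5 W S1"
    have st: "stages Y (2 * k) 5 W S1" using st k(1) by simp
    let ?I = "rest Y W 5"
    let ?T = "{\<tau>. \<tau> \<subseteq> W 4 \<and> card \<tau> = k}"
    have W: "W i \<subseteq> rest Y W i" "card (W i) = 2 * k" if "i < 5" for i
      using st that by (auto simp: stages_def)
    have WY: "W i \<subseteq> Y" if "i < 5" for i using W(1)[OF that] by (auto simp: rest_def)
    have finW: "finite (W i)" if "i < 5" for i using WY[OF that] fin by (rule finite_subset)
    have cI: "card ?I = card Y - 10 * k" using card_rest[OF fin, of 5 W "2 * k"] W by simp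
    then have "odd (card ?I)" using k(3,4) by simp
    then obtain h where h: "card ?I = 2 * h + 1" by (elim oddE)
    have T: "finite ?T" "card ?T \<le> 2 ^ (2 * k)"
    proof -
      have sub: "?T \<subseteq> Pow (W 4)" by auto
      have finP: "finite (Pow (W 4))" using finW by simp
      show "finite ?T" using sub finP by (rule finite_subset)
      have "card ?T \<le> card (Pow (W 4))" using finP sub by (rule card_mono)
      also have "\<dots> = 2 ^ (2 * k)" using W(2)[of 4] finW[of 4] by (simp add: card_Pow)
      finally show "card ?T \<le> 2 ^ (2 * k)" .
    qed
    have "wins (2 ^ ?B * card Y + card ?T * (728 * card ?I)) S1"
    proof (rule wins_all_half_known[OF k(1,2)])
      show "W 4 \<subseteq> Y" "card (W 4) = 2 * k" using WY W(2) by auto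
      show "?I \<subseteq> Y" "W 4 \<inter> ?I = {}" by (auto simp: rest_def)
      show "card ?I = 2 * h + 1" by (rule h)
      show "finite ?T" by (rule T(1))
      show "\<forall>\<tau>\<in>?T. \<tau> \<subseteq> W 4 \<and> card \<tau> = k" by simp
      fix S2 assume S2: "S2 \<subseteq> S1" and hk: "\<forall>\<tau>\<in>?T. \<exists>x. half_known Y ?I (balanced_on Y (W 4) ?I \<tau>) S2 x"
      from bchoice[OF hk] obtain xs where
        xs: "\<And>\<tau>. \<tau> \<in> ?T \<Longrightarrow> half_known Y ?I (balanced_on Y (W 4) ?I \<tau>) S2 (xs \<tau>)" by blast
      have st2: "stages Y (2 * k) 5 W S2" using st S2 unfolding stages_def by blast
      define C where "C = (\<Union>i<5. W i) \<union> xs ` ?T"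
      have "xs \<tau> \<in> Y" if "\<tau> \<in> ?T" for \<tau> using xs[OF that] by (auto simp: half_known_def rest_def)
      then have CY: "C \<subseteq> Y" using WY unfolding C_def by auto
      have "card (\<Union>i<5. W i) \<le> (\<Sum>i<5. card (W i))" by (rule card_UN_le) simp
      also have "\<dots> = 10 * k" using W(2) by simp
      finally have cC: "card C \<le> ?B"
        using card_Un_le[of "\<Union>i<5. W i" "xs ` ?T"] card_image_le[OF T(1), of xs] T(2) unfolding C_def by linarith
      have "wins (\<Sum>A\<in>Pow C. card (Y - common Y C S2 A)) S2"
      \<comment> \<open>\<open>W 0\<close> is not among the four sets, since it need not contain
        \<open>k\<close> majority balls.\<close>
      proof (rule wins_if_common_large[OF k(1,2), of "\<lambda>i. W (Suc i)"])
        fix i :: nat assume i: "i < 4"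
        show "W (Suc i) \<subseteq> C" using i by (auto simp: C_def)
        show "card (W (Suc i)) = 2 * k" using W(2) i by simp
        show "W (Suc i) \<inter> W (Suc j) = {}" if "j < 4" "i \<noteq> j" for j
          using stages_disjoint[OF st] i that by simp
        show "k \<le> card (majority_class Y g \<inter> W (Suc i))" if "g \<in> S2" for g
          using stages_majority_class(1)[OF fin k(4) _ k(2) st2 that, of "Suc i"] k(3) i by simp
      next
        show "C \<subseteq> Y" by (rule CY)
        fix A assume A: "A \<subseteq> C"
        show "card Y < 2 * card (common Y C S2 A)"
        proof (rule common_large[OF k(2) _ k(4) st2 _ _ _ A])
          show "20 * k < card Y" using k(3) by simp
          show "(\<Union>i<5. W i) \<subseteq> C" by (simp add: C_def)
          fix \<tau> assume "\<tau> \<subseteq> W 4" "card \<tau> = k"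
          then have "\<tau> \<in> ?T" by simp
          then show "half_known Y ?I (balanced_on Y (W 4) ?I \<tau>) S2 (xs \<tau>)" "xs \<tau> \<in> C"
            using xs by (auto simp: C_def)
        qed
      qed
      moreover have "(\<Sum>A\<in>Pow C. card (Y - common Y C S2 A)) \<le> (\<Sum>A\<in>Pow C. card Y)"
        using fin by (intro sum_mono card_mono) auto
      moreover have "(\<Sum>A\<in>Pow C. card Y) = 2 ^ card C * card Y"
        using finite_subset[OF CY fin] by (simp add: card_Pow)
      moreover have "2 ^ card C * card Y \<le> 2 ^ ?B * card Y" using cC by (intro mult_le_mono1 power_increasing) auto
      ultimately show "wins (2 ^ ?B * card Y) S2" by (elim mono) linarith
    qed
    moreover have "card ?T * (728 * card ?I) \<le> 2 ^ (2 * k) * (728 * card Y)"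
      using T(2) cI by (intro mult_le_mono) auto
    ultimately show "wins (2 ^ ?B * card Y + 2 ^ (2 * k) * (728 * card Y)) S1" by (elim mono) simp
  qed
  then show ?thesis by (simp add: algebra_simps)
qed

text \<open>Here \<open>W\<close> has the odd size \<open>q - 1\<close> and cannot be balanced, so a
  single stage leaves balls of one color, more than half of \<open>Y\<close>.\<close>

lemma (in plurality_game) wins_even:
  assumes "even q" "2 * q < card Y"
  shows "wins ((q + 1) * card Y) S"
proof -
  have "wins (0 + (q + 1) * card Y) S"
  proof (rule stage)
    show "q \<le> card Y" using assms(2) by simp
    fix S' W assume W: "W \<subseteq> Y" "card W = q - 1" and st: "\<forall>g\<in>S'. staged g W (Y - W)"
    have finW: "finite W" using W(1) fin by (rule finite_subset)
    have c: "card (Y - W) = card Y - (q - 1)" using W finW by (simp add: card_Diff_subset)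
    then have big: "card Y < 2 * card (Y - W)" using assms(2) by simp
    then have "Y - W \<noteq> {}" by (metis card.empty mult_0_right not_less_zero)
    then obtain x where x: "x \<in> Y - W" by blast
    have "majority_ball g Y x" if g: "g \<in> S'" for g
    proof -
      have "\<not> (\<exists>s t. s \<noteq> t \<and> (\<forall>x\<in>W \<union> (Y - W). g x \<in> {s, t}) \<and> color_count g W s = color_count g W t)"
      proof
        assume "\<exists>s t. s \<noteq> t \<and> (\<forall>x\<in>W \<union> (Y - W). g x \<in> {s, t}) \<and> color_count g W s = color_count g W t"
        then obtain s t where "s \<noteq> t" "\<forall>x\<in>W \<union> (Y - W). g x \<in> {s, t}" "color_count g W s = color_count g W t" by (elim exE conjE)
        then have "q - 1 = 2 * color_count g W s" using two_colors_sum[OF finW, of g s t] W(2) by simp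
        then have "odd q" using q by presburger
        then show False using assms(1) by simp
      qed
      then have "\<forall>y\<in>Y - W. g y = g x" using st g x unfolding staged_def by blast
      from majority_class_if_large[OF fin _ big this] have "majority_class Y g = {y \<in> Y. g y = g x}" by simp
      then have "x \<in> majority_class Y g" using x by simp
      then show ?thesis by (simp add: majority_class_def)
    qed
    then show "wins 0 S'" using x by (intro goal) auto
  qed simp
  then show ?thesis by simp
qed

section \<open>From the game to the four search problems\<close>

lemma min_queries_linear:
  fixes q c :: nat
  assumes q: "q \<ge> 2" and c: "c \<ge> 1" and A: "A \<in> {majority_ball, plurality_ball}"
    and P: "P \<in> {non_minority_ball, almost_plurality_ball}"
  shows "\<exists>n0 K. \<forall>n\<ge>n0. min_queries A P n q c \<le> enat (K * n)"
proof -
  obtain K1 n1 where no: "\<And>A P X S Q0. A \<in> {majority_ball, plurality_ball} \<Longrightarrow>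
    P \<in> {non_minority_ball, almost_plurality_ball} \<Longrightarrow> finite X \<Longrightarrow> n1 \<le> card X \<Longrightarrow>
    \<forall>g\<in>S. \<forall>x\<in>X. g x < c \<Longrightarrow> Q0 \<subseteq> X \<Longrightarrow> card Q0 = q \<Longrightarrow> \<forall>g\<in>S. \<not> yes A g Q0 \<Longrightarrow>
    win A X q (report_goal P X) (K1 * card X) S"
    using win_after_no[OF q c] by blast
  define k where "k = q div 2"
  define K2 where "K2 = 2 ^ (10 * k + 2 ^ (2 * k)) + 728 * 2 ^ (2 * k) + 5 * (q + 1)"
  have "min_queries A P n q c \<le> enat ((K1 + K2) * n)" if n: "n \<ge> n1 + 20 * q + 10" for n
  proof -
    let ?X = "{..<n}"
    \<comment> \<open>For odd \<open>q\<close> the game needs an odd number of balls. If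
      \<open>n\<close> is even, one ball is set aside: more than half of \<open>n - 1\<close> balls
      is then at least half of \<open>n\<close>.\<close>
    define Y where "Y = (if odd q \<and> even n then {..<n - 1} else ?X)"
    \<comment> \<open>The \<open>K1 * n\<close> queries that follow a NO answer are reserved from
      the start, so a NO may come at any point of the game.\<close>
    define wins where "wins j S \<longleftrightarrow> (S \<subseteq> colorings n c \<longrightarrow> win A ?X q (report_goal P ?X) (K1 * n + j) S)" for j S
    have Y: "Y \<subseteq> ?X" "n \<le> card Y + 1" "card Y \<le> n" "finite Y" by (auto simp: Y_def)
    interpret plurality_game Y q wins
    proof
      show "finite Y" by (rule Y(4))
      show "q \<ge> 2" by (rule q)
    next
      fix Q S j
      assume Q: "Q \<subseteq> Y" "card Q = q"
        and c: "\<And>a S'. a \<in> Q \<Longrightarrow> S' \<subseteq> S \<Longrightarrow> \<forall>g\<in>S'. plurality_ball g Q a \<Longrightarrow> wins j S'"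
      have finQ: "finite Q" using Q(1) Y(4) by (rule finite_subset)
      have QX: "Q \<subseteq> ?X" using Q(1) Y(1) by blast
      show "wins (Suc j) S" unfolding wins_def
      proof
        assume S: "S \<subseteq> colorings n c"
        have "win A ?X q (report_goal P ?X) (Suc (K1 * n + j)) S"
        proof (rule win_query[OF QX Q(2)])
          fix a
          let ?S = "{g \<in> S. correct_report A g Q a}"
          show "win A ?X q (report_goal P ?X) (K1 * n + j) ?S"
          proof (cases a)
            case None
            have "win A ?X q (report_goal P ?X) (K1 * card ?X) ?S"
            proof (rule no[OF A P _ _ _ QX Q(2)])
              show "\<forall>g\<in>?S. \<forall>x\<in>?X. g x < c" using S by (auto simp: colorings_def)
              show "\<forall>g\<in>?S. \<not> yes A g Q" using None by (auto simp: yes_def)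
            qed (use n in auto)
            then show ?thesis by (elim win_mono) simp
          next
            case (Some x)
            show ?thesis
            proof (cases "x \<in> Q")
              case True
              have "\<forall>g\<in>?S. plurality_ball g Q x"
                using Some A majority_imp_plurality[OF finQ] by auto
              then have "wins j ?S" by (intro c[OF True]) auto
              then show ?thesis using S unfolding wins_def by blast
            next
              case False
              then have "?S = {}" using Some by auto
              moreover have "report_goal P ?X {}" by (simp add: report_goal_def)
              ultimately have "report_goal P ?X ?S" by (simp only:)
              then show ?thesis by (rule win_goal)
            qed
          qed
        qed
        then show "win A ?X q (report_goal P ?X) (K1 * n + Suc j) S" by simp
      qed
    next
      fix j j' S assume "wins j S" "j \<le> j'"
      then show "wins j' S" unfolding wins_def using win_mono[of A ?X q "report_goal P ?X" "K1 * n + j" S "K1 * n + j'"] by auto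
    next
      fix x S j assume x: "x \<in> Y" and maj: "\<forall>g\<in>S. majority_ball g Y x"
      have "non_minority_ball g ?X x" if "g \<in> S" for g
      proof -
        have "card Y < 2 * color_count g Y (g x)" using maj that by (auto simp: majority_ball_def)
        moreover have "color_count g Y (g x) \<le> color_count g ?X (g x)" using Y(1) by (intro color_count_mono) auto
        ultimately show ?thesis using x Y by (auto simp: non_minority_ball_def)
      qed
      then have "\<forall>g\<in>S. correct_report P g ?X (Some x)"
        using P x Y(1) by (auto simp: almost_plurality_ball_def)
      then have "report_goal P ?X S" unfolding report_goal_def by blast
      then show "wins j S" unfolding wins_def by (blast intro: win_goal)
    qed
    have "wins (K2 * card Y) (colorings n c)"
    proof (cases "even q")
      case True
      then have "wins ((q + 1) * card Y) (colorings n c)" using n Y(2) by (intro wins_even) auto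
      moreover have "(q + 1) * card Y \<le> K2 * card Y" by (intro mult_le_mono1) (simp add: K2_def)
      ultimately show ?thesis by (rule mono)
    next
      case False
      then have "q = 2 * k + 1" "k \<ge> 1" using q by (auto simp: k_def elim!: oddE)
      moreover have "odd (card Y)" using False n by (auto simp: Y_def)
      ultimately show ?thesis unfolding K2_def using n Y(2) by (intro wins_odd) auto
    qed
    then have "win A ?X q (report_goal P ?X) (K1 * n + K2 * card Y) (colorings n c)" by (simp add: wins_def)
    moreover have "K1 * n + K2 * card Y \<le> (K1 + K2) * n" using Y(3) by (simp add: algebra_simps)
    ultimately have "win A ?X q (report_goal P ?X) ((K1 + K2) * n) (colorings n c)" by (rule win_mono)
    then show ?thesis by (intro min_queries_le) (simp add: report_goal_def[abs_def])
  qed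
  then show ?thesis by blast
qed

theorem theorem1p3:
  fixes q c :: nat
  assumes "q \<ge> 2" and "c \<ge> 1"
  shows "\<exists>(n0::nat) (K::nat). \<forall>n\<ge>n0.
           MB n q c \<le> enat (K * n) \<and>
           MC n q c \<le> enat (K * n) \<and>
           PB n q c \<le> enat (K * n) \<and>
           PC n q c \<le> enat (K * n)"
proof -
  note lin = min_queries_linear[OF assms]
  obtain n1 K1 where 1: "\<And>n. n \<ge> n1 \<Longrightarrow> MB n q c \<le> enat (K1 * n)"
    using lin[of majority_ball non_minority_ball] by (auto simp: MB_def)
  obtain n2 K2 where 2: "\<And>n. n \<ge> n2 \<Longrightarrow> MC n q c \<le> enat (K2 * n)"
    using lin[of majority_ball almost_plurality_ball] by (auto simp: MC_def)
  obtain n3 K3 where 3: "\<And>n. n \<ge> n3 \<Longrightarrow> PB n q c \<le> enat (K3 * n)"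
    using lin[of plurality_ball non_minority_ball] by (auto simp: PB_def)
  obtain n4 K4 where 4: "\<And>n. n \<ge> n4 \<Longrightarrow> PC n q c \<le> enat (K4 * n)"
    using lin[of plurality_ball almost_plurality_ball] by (auto simp: PC_def)
  let ?K = "K1 + K2 + K3 + K4"
  have "MB n q c \<le> enat (?K * n) \<and> MC n q c \<le> enat (?K * n) \<and> PB n q c \<le> enat (?K * n) \<and> PC n q c \<le> enat (?K * n)"
    if n: "n \<ge> n1 + n2 + n3 + n4" for n
  proof -
    have "enat (K1 * n) \<le> enat (?K * n)" "enat (K2 * n) \<le> enat (?K * n)"
      "enat (K3 * n) \<le> enat (?K * n)" "enat (K4 * n) \<le> enat (?K * n)" by (auto simp: algebra_simps)
    then show ?thesis using 1[of n] 2[of n] 3[of n] 4[of n] n by (auto intro: order_trans)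
  qed
  then show ?thesis by blast
qed

end
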